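(* Let $\mathbf X$ be a flag simplicial complex with connected $1$-skeleton $G(\mathbf X)$. Then the following conditions are equivalent: (i) $\mathbf X$ is weakly systolic; (ii) $\mathbf X$ satisfies the vertex condition (V) and the edge condition (E) for each vertex $v$ and every $i$; (iii) $G(\mathbf X)$ is a weakly modular thin graph; (iv) $G(\mathbf X)$ is a weakly modular graph without induced $C_4$; (v) $G(\mathbf X)$ is a weakly modular graph with convex balls; (vi) $G(\mathbf X)$ is a graph with convex balls in which any induced $5$-cycle $C_5$ is included in a $5$-wheel $W_5$ (i.e. there is a vertex adjacent to all vertices of the $5$-cycle); (vii) $\mathbf X$ is simply connected, satisfies the $\widehat W_5$-condition, and does not contain an induced $C_4$.
   Context: All graphs are undirected, connected, without loops or multiple edges; $d$ is the shortest-path distance. For a graph, $B_r(x)$ (resp. $S_r(x)$) is the set of vertices at distance at most (resp. exactly) $r$ from $x$; $I(u,v)=\{x: d(u,x)+d(x,v)=d(u,v)\}$. A vertex set $A$ is convex if $I(u,v)\subseteq A$ for all $u,v\in A$. A graph has convex balls if every ball $B_r(x)$, $x$ a vertex, $r\ge 0$, is convex. A graph is thin if for any two distinct nonadjacent vertices $u,v$, any two distinct neighbors of $v$ in $I(u,v)$ are adjacent. A graph is weakly modular if it satisfies: the triangle condition (T): for any vertices $u,v,w$ with $1=d(v,w)<d(u,v)=d(u,w)$ there is a common neighbor $x$ of $v,w$ with $d(u,x)=d(u,v)-1$; and the quadrangle condition (Q): for any vertices $u,v,w,z$ with $d(v,z)=d(w,z)=1$ and $2=d(v,w)\le d(u,v)=d(u,w)=d(u,z)-1$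 there is a common neighbor $x$ of $v,w$ with $d(u,x)=d(u,v)-1$. A simplicial complex $\mathbf X$ is flag if every set of vertices, each pair of which lies in a common simplex, is contained in a simplex. $G(\mathbf X)$ denotes its $1$-skeleton, and distances, balls and spheres in $\mathbf X$ are those of $G(\mathbf X)$. The link $\mathrm{lk}(\sigma,\mathbf X)$ consists of simplices $\sigma'$ with $\sigma\cap\sigma'=\emptyset$ and $\sigma\cup\sigma'\in\mathbf X$. For a vertex $v$ and an integer $n\ge 0$, a flag complex $\mathbf X$ satisfies $SD_n(v)$ if for each $0\le i\le n$ and each (nonempty) simplex $\sigma$ all of whose vertices lie in $S_{i+1}(v)$, the set $V(\mathrm{lk}(\sigma,\mathbf X))\cap B_i(v)$ spans a nonempty simplex of $\mathbf X$. A flag complex is weakly systolic if it satisfies $SD_n(v)$ for all vertices $v$ and all natural numbers $n$. For a vertex $v$ and $i\ge 0$: (V) for every vertex $w\in S_{i+1}(v)$, the set $V(\mathrm{lk}(w,\mathbf X))\cap B_i(v)$ is a single simplex; (E) for every edge $e$ with both endpoints in $S_{i+1}(v)$, the set $V(\mathrm{lk}(e,\mathbf X))\cap B_i(v)$ is nonempty. $C_k$ is the $k$-cycle; the $k$-wheel $W_k$ is a $k$-cycle $x_1,\dots,x_k$ together with a central vertex $c$ adjacent to all the $x_i$. $\widehat W_5$ is $W_5$ together with a further vertex $a\neq c$ adjacent to two consecutive vertices $x_i,x_{i+1}$ of the $5$-cycle and to no other vertex of the wheel. The $\widehat W_5$-condition: for any induced $\widehat W_5$ in $G(\mathbf X)$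 there is a vertex $v\notin\widehat W_5$ adjacent in $G(\mathbf X)$ to all vertices of that $\widehat W_5$. *)

theory Defs
  imports "HOL-Analysis.Analysis"
begin

section \<open>Graphs\<close>

text \<open>A graph is given by a vertex set V and a symmetric, irreflexive adjacency
  relation E on V. For u, v in one component, walks of length n are pairs in E ^^ n.\<close>

definition simple_graph :: "'a set \<Rightarrow> 'a rel \<Rightarrow> bool" where
  "simple_graph V E \<longleftrightarrow> E \<subseteq> V \<times> V \<and> sym E \<and> irrefl E"

definition connected_graph :: "'a set \<Rightarrow> 'a rel \<Rightarrow> bool" where
  "connected_graph V E \<longleftrightarrow> simple_graph V E \<and> (\<forall>u\<in>V. \<forall>v\<in>V. (u, v) \<in> E\<^sup>*)"

text \<open>The value is arbitrary if u and v are not joined by a walk.\<close>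

definition gdist :: "'a rel \<Rightarrow> 'a \<Rightarrow> 'a \<Rightarrow> nat" where
  "gdist E u v = (LEAST n. (u, v) \<in> E ^^ n)"

definition gball :: "'a set \<Rightarrow> 'a rel \<Rightarrow> nat \<Rightarrow> 'a \<Rightarrow> 'a set" where
  "gball V E r x = {y \<in> V. gdist E x y \<le> r}"

definition gsphere :: "'a set \<Rightarrow> 'a rel \<Rightarrow> nat \<Rightarrow> 'a \<Rightarrow> 'a set" where
  "gsphere V E r x = {y \<in> V. gdist E x y = r}"

definition ginterval :: "'a set \<Rightarrow> 'a rel \<Rightarrow> 'a \<Rightarrow> 'a \<Rightarrow> 'a set" where
  "ginterval V E u v = {x \<in> V. gdist E u x + gdist E x v = gdist E u v}"

definition gconvex :: "'a set \<Rightarrow> 'a rel \<Rightarrow> 'a set \<Rightarrow> bool" where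
  "gconvex V E A \<longleftrightarrow> A \<subseteq> V \<and> (\<forall>u\<in>A. \<forall>v\<in>A. ginterval V E u v \<subseteq> A)"

definition convex_balls :: "'a set \<Rightarrow> 'a rel \<Rightarrow> bool" where
  "convex_balls V E \<longleftrightarrow> (\<forall>x\<in>V. \<forall>r. gconvex V E (gball V E r x))"

definition thin_graph :: "'a set \<Rightarrow> 'a rel \<Rightarrow> bool" where
  "thin_graph V E \<longleftrightarrow>
     (\<forall>u\<in>V. \<forall>v\<in>V. u \<noteq> v \<and> (u, v) \<notin> E \<longrightarrow>
        (\<forall>x\<in>ginterval V E u v. \<forall>y\<in>ginterval V E u v.
           x \<noteq> y \<and> (v, x) \<in> E \<and> (v, y) \<in> E \<longrightarrow> (x, y) \<in> E))"

definition triangle_condition :: "'a set \<Rightarrow> 'a rel \<Rightarrow> bool" where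
  "triangle_condition V E \<longleftrightarrow>
     (\<forall>u\<in>V. \<forall>v\<in>V. \<forall>w\<in>V.
        gdist E v w = 1 \<and> 1 < gdist E u v \<and> gdist E u v = gdist E u w \<longrightarrow>
        (\<exists>x\<in>V. (v, x) \<in> E \<and> (w, x) \<in> E \<and> gdist E u x = gdist E u v - 1))"

definition quadrangle_condition :: "'a set \<Rightarrow> 'a rel \<Rightarrow> bool" where
  "quadrangle_condition V E \<longleftrightarrow>
     (\<forall>u\<in>V. \<forall>v\<in>V. \<forall>w\<in>V. \<forall>z\<in>V.
        gdist E v z = 1 \<and> gdist E w z = 1 \<and>
        gdist E v w = 2 \<and> 2 \<le> gdist E u v \<and>
        gdist E u v = gdist E u w \<and> gdist E u z = gdist E u v + 1 \<longrightarrow>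
        (\<exists>x\<in>V. (v, x) \<in> E \<and> (w, x) \<in> E \<and> gdist E u x = gdist E u v - 1))"

definition weakly_modular :: "'a set \<Rightarrow> 'a rel \<Rightarrow> bool" where
  "weakly_modular V E \<longleftrightarrow> triangle_condition V E \<and> quadrangle_condition V E"

text \<open>The k-cycle x 0, ..., x (k - 1), for k at least 3; indices are read modulo k.\<close>

definition induced_cycle :: "'a set \<Rightarrow> 'a rel \<Rightarrow> nat \<Rightarrow> (nat \<Rightarrow> 'a) \<Rightarrow> bool" where
  "induced_cycle V E k x \<longleftrightarrow>
     x ` {..<k} \<subseteq> V \<and> inj_on x {..<k} \<and>
     (\<forall>i<k. \<forall>j<k. (x i, x j) \<in> E \<longleftrightarrow> j = Suc i mod k \<or> i = Suc j mod k)"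

definition C4_free :: "'a set \<Rightarrow> 'a rel \<Rightarrow> bool" where
  "C4_free V E \<longleftrightarrow> (\<nexists>x. induced_cycle V E 4 x)"

definition C5s_in_W5s :: "'a set \<Rightarrow> 'a rel \<Rightarrow> bool" where
  "C5s_in_W5s V E \<longleftrightarrow>
     (\<forall>x. induced_cycle V E 5 x \<longrightarrow> (\<exists>c\<in>V. \<forall>i<5. (c, x i) \<in> E))"

definition induced_W5 :: "'a set \<Rightarrow> 'a rel \<Rightarrow> (nat \<Rightarrow> 'a) \<Rightarrow> 'a \<Rightarrow> bool" where
  "induced_W5 V E x c \<longleftrightarrow>
     induced_cycle V E 5 x \<and> c \<in> V - x ` {..<5} \<and> (\<forall>i<5. (c, x i) \<in> E)"

definition induced_W5_hat :: "'a set \<Rightarrow> 'a rel \<Rightarrow> (nat \<Rightarrow> 'a) \<Rightarrow> 'a \<Rightarrow> 'a \<Rightarrow> bool" where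
  "induced_W5_hat V E x c a \<longleftrightarrow>
     induced_W5 V E x c \<and> a \<in> V - x ` {..<5} \<and> a \<noteq> c \<and> (a, c) \<notin> E \<and>
     (\<exists>i<5. \<forall>j<5. (a, x j) \<in> E \<longleftrightarrow> j = i \<or> j = Suc i mod 5)"

definition W5_hat_condition :: "'a set \<Rightarrow> 'a rel \<Rightarrow> bool" where
  "W5_hat_condition V E \<longleftrightarrow>
     (\<forall>x c a. induced_W5_hat V E x c a \<longrightarrow>
        (\<exists>v\<in>V - (x ` {..<5} \<union> {c, a}). \<forall>y\<in>x ` {..<5} \<union> {c, a}. (v, y) \<in> E))"


section \<open>Simplicial complexes\<close>

text \<open>A complex is the set of its simplices; the empty set is not a simplex.\<close>

definition abstract_simplicial_complex :: "'a set set \<Rightarrow> bool" where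
  "abstract_simplicial_complex X \<longleftrightarrow>
     (\<forall>\<sigma>\<in>X. finite \<sigma> \<and> \<sigma> \<noteq> {} \<and> (\<forall>\<tau>. \<tau> \<subseteq> \<sigma> \<and> \<tau> \<noteq> {} \<longrightarrow> \<tau> \<in> X))"

definition vertices :: "'a set set \<Rightarrow> 'a set" where
  "vertices X = \<Union>X"

definition edges :: "'a set set \<Rightarrow> 'a rel" where
  "edges X = {(u, v). u \<noteq> v \<and> {u, v} \<in> X}"

text \<open>Infinite sets A are included. As simplices are finite, a flag complex has no infinite
  set of pairwise adjacent vertices, although its dimension may be unbounded.\<close>

definition flag :: "'a set set \<Rightarrow> bool" where
  "flag X \<longleftrightarrow>
     (\<forall>A. A \<subseteq> vertices X \<and> (\<forall>u\<in>A. \<forall>v\<in>A. \<exists>\<sigma>\<in>X. u \<in> \<sigma> \<and> v \<in> \<sigma>) \<longrightarrow> (\<exists>\<sigma>\<in>X. A \<subseteq> \<sigma>))"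

definition link :: "'a set \<Rightarrow> 'a set set \<Rightarrow> 'a set set" where
  "link \<sigma> X = {\<tau> \<in> X. \<sigma> \<inter> \<tau> = {} \<and> \<sigma> \<union> \<tau> \<in> X}"

abbreviation complex_ball :: "'a set set \<Rightarrow> nat \<Rightarrow> 'a \<Rightarrow> 'a set" where
  "complex_ball X r v \<equiv> gball (vertices X) (edges X) r v"

abbreviation complex_sphere :: "'a set set \<Rightarrow> nat \<Rightarrow> 'a \<Rightarrow> 'a set" where
  "complex_sphere X r v \<equiv> gsphere (vertices X) (edges X) r v"

definition SD :: "'a set set \<Rightarrow> nat \<Rightarrow> 'a \<Rightarrow> bool" where
  "SD X n v \<longleftrightarrow>
     (\<forall>i\<le>n. \<forall>\<sigma>\<in>X. \<sigma> \<subseteq> complex_sphere X (i + 1) v \<longrightarrow>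
        vertices (link \<sigma> X) \<inter> complex_ball X i v \<in> X)"

definition weakly_systolic :: "'a set set \<Rightarrow> bool" where
  "weakly_systolic X \<longleftrightarrow> (\<forall>v\<in>vertices X. \<forall>n. SD X n v)"

definition vertex_condition :: "'a set set \<Rightarrow> 'a \<Rightarrow> nat \<Rightarrow> bool" where
  "vertex_condition X v i \<longleftrightarrow>
     (\<forall>w\<in>complex_sphere X (i + 1) v. vertices (link {w} X) \<inter> complex_ball X i v \<in> X)"

definition edge_condition :: "'a set set \<Rightarrow> 'a \<Rightarrow> nat \<Rightarrow> bool" where
  "edge_condition X v i \<longleftrightarrow>
     (\<forall>x\<in>complex_sphere X (i + 1) v. \<forall>y\<in>complex_sphere X (i + 1) v. (x, y) \<in> edges X \<longrightarrow>
        vertices (link {x, y} X) \<inter> complex_ball X i v \<noteq> {})"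


section \<open>Geometric realization and simple connectivity\<close>

text \<open>Points of the realization are given by barycentric coordinates.\<close>

definition realization_points :: "'a set set \<Rightarrow> ('a \<Rightarrow> real) set" where
  "realization_points X =
     {p. (\<forall>v. 0 \<le> p v) \<and> {v. p v \<noteq> 0} \<in> X \<and> (\<Sum>v\<in>{v. p v \<noteq> 0}. p v) = 1}"

definition closed_cell :: "'a set set \<Rightarrow> 'a set \<Rightarrow> ('a \<Rightarrow> real) set" where
  "closed_cell X \<sigma> = {p \<in> realization_points X. {v. p v \<noteq> 0} \<subseteq> \<sigma>}"

text \<open>The weak (coherent) topology: U is open iff its trace on every closed cell is open.
  The topology on each cell is the one of coordinatewise convergence, which is the
  Euclidean one since simplices are finite.\<close>

definition realization :: "'a set set \<Rightarrow> ('a \<Rightarrow> real) topology" where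
  "realization X = topology (\<lambda>U. U \<subseteq> realization_points X \<and>
     (\<forall>\<sigma>\<in>X. openin (top_of_set (closed_cell X \<sigma>)) (U \<inter> closed_cell X \<sigma>)))"

lemma openin_realization:
  "openin (realization X) U \<longleftrightarrow> U \<subseteq> realization_points X \<and>
     (\<forall>\<sigma>\<in>X. openin (top_of_set (closed_cell X \<sigma>)) (U \<inter> closed_cell X \<sigma>))"
proof -
  have "istopology (\<lambda>U. U \<subseteq> realization_points X \<and>
     (\<forall>\<sigma>\<in>X. openin (top_of_set (closed_cell X \<sigma>)) (U \<inter> closed_cell X \<sigma>)))"
    unfolding istopology_def
  proof (intro conjI allI impI)
    fix S T
    assume S: "S \<subseteq> realization_points X \<and>
        (\<forall>\<sigma>\<in>X. openin (top_of_set (closed_cell X \<sigma>)) (S \<inter> closed_cell X \<sigma>))"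
      and T: "T \<subseteq> realization_points X \<and>
        (\<forall>\<sigma>\<in>X. openin (top_of_set (closed_cell X \<sigma>)) (T \<inter> closed_cell X \<sigma>))"
    show "S \<inter> T \<subseteq> realization_points X"
      using S by (simp add: le_infI1)
    show "\<forall>\<sigma>\<in>X. openin (top_of_set (closed_cell X \<sigma>)) (S \<inter> T \<inter> closed_cell X \<sigma>)"
    proof
      fix \<sigma> assume s: "\<sigma> \<in> X"
      have "openin (top_of_set (closed_cell X \<sigma>))
          ((S \<inter> closed_cell X \<sigma>) \<inter> (T \<inter> closed_cell X \<sigma>))"
        by (rule openin_Int[OF bspec[OF conjunct2[OF S] s] bspec[OF conjunct2[OF T] s]])
      moreover have "(S \<inter> closed_cell X \<sigma>) \<inter> (T \<inter> closed_cell X \<sigma>) = S \<inter> T \<inter> closed_cell X \<sigma>"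
        by (simp add: Int_ac)
      ultimately show "openin (top_of_set (closed_cell X \<sigma>)) (S \<inter> T \<inter> closed_cell X \<sigma>)"
        by (rule back_subst)
    qed
  next
    fix K
    assume K: "\<forall>U\<in>K. U \<subseteq> realization_points X \<and>
        (\<forall>\<sigma>\<in>X. openin (top_of_set (closed_cell X \<sigma>)) (U \<inter> closed_cell X \<sigma>))"
    show "\<Union>K \<subseteq> realization_points X"
      using K by (simp add: Sup_le_iff)
    show "\<forall>\<sigma>\<in>X. openin (top_of_set (closed_cell X \<sigma>)) (\<Union>K \<inter> closed_cell X \<sigma>)"
    proof
      fix \<sigma> assume s: "\<sigma> \<in> X"
      have "openin (top_of_set (closed_cell X \<sigma>)) (\<Union>((\<lambda>U. U \<inter> closed_cell X \<sigma>) ` K))"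
      proof (rule openin_Union)
        fix W assume "W \<in> (\<lambda>U. U \<inter> closed_cell X \<sigma>) ` K"
        then obtain U where "U \<in> K" "W = U \<inter> closed_cell X \<sigma>" by (rule imageE)
        then show "openin (top_of_set (closed_cell X \<sigma>)) W" using K s by metis
      qed
      moreover have "\<Union>((\<lambda>U. U \<inter> closed_cell X \<sigma>) ` K) = \<Union>K \<inter> closed_cell X \<sigma>"
        by (rule Int_Union2[symmetric])
      ultimately show "openin (top_of_set (closed_cell X \<sigma>)) (\<Union>K \<inter> closed_cell X \<sigma>)"
        by (rule back_subst)
    qed
  qed
  then show ?thesis
    by (simp add: realization_def topology_inverse')
qed

text \<open>The library's notion of simple connectivity applies only to subsets of a type of class
  topological_space; this is the same notion for abstract topologies.\<close>

definition simply_connected_space :: "'b topology \<Rightarrow> bool" where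
  "simply_connected_space T \<longleftrightarrow>
     path_connected_space T \<and>
     (\<forall>f. continuous_map (top_of_set (sphere (0::complex) 1)) T f \<longrightarrow>
        (\<exists>g. continuous_map (top_of_set (cball (0::complex) 1)) T g \<and>
             (\<forall>z\<in>sphere 0 1. g z = f z)))"

end

theory Submission
  imports Defs
begin

text \<open>
  Conditions (V) and (E) at a base point v are the common form to which every other condition is
  reduced. The graph-theoretic equivalences are short: a square or pentagon that violates one
  condition is closed up by a common neighbour that another condition provides.

  (V) and (E) imply simple connectivity because the ball of radius n + 1 around v can be deformed
  into the ball of radius n. A point of the realization is cut into the layers of its barycentric
  coordinates on the outer sphere, and the layers are moved, lowest first, to a common lower
  neighbour of the simplex that supports them. A compact set meets only finitely many simplices,
  so finitely many such steps contract any loop.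

  Conversely, over a graph without induced squares that satisfies the condition on extended
  5-wheels, one builds level by level a covering graph that satisfies (V) and (E) at its root: a
  new vertex is a pair of a vertex w on the current outer sphere and a neighbour z of its image
  that has no lift adjacent to w, where adjacent (or equal) w with the same z are identified. If
  the realization is simply connected, then lifting the labels of a fine grid on a disc shows that
  the covering is trivial, and the graph inherits (V) and (E).
\<close>

section \<open>Vertex and edge conditions in graphs\<close>

text \<open>The complex may be infinite, of unbounded dimension and diameter, so there is no last
  sphere from which to retract all of it, and coordinatewise continuity does not control its
  topology. For a single map with compact domain both obstacles vanish: its image has a finite
  support set, and pushing this set down one sphere adds only finitely many vertices. Layers are
  needed because lower neighbours chosen separately for the vertices of a simplex need not be
  adjacent. The superlevel sets of one point are nested, so the lower neighbours chosen for two of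
  them have a common upper neighbour, and (V) makes them equal or adjacent. In the converse
  direction the cover is a graph map that is an isomorphism between the neighbourhoods of each
  vertex and of its image. Hence adjacent labels lift uniquely and lifts around a triangle close up,
  which is all that a triangulated grid requires. The condition on extended wheels enters the
  construction at one place: the identification of the pairs that form a new vertex has to be
  transitive.\<close>

lemma rot5:
  fixes i j k :: nat
  assumes "i < 5" "j < 5" "k < 5"
  shows "(i + j) mod 5 = (i + k) mod 5 \<longleftrightarrow> j = k"
    and "(i + k) mod 5 = Suc ((i + j) mod 5) mod 5 \<longleftrightarrow> k = Suc j mod 5"
    and "(i + j) mod 5 = i \<longleftrightarrow> j = 0"
    and "(i + j) mod 5 = Suc i mod 5 \<longleftrightarrow> j = 1"
proof -
  have "i \<in> {0, 1, 2, 3, 4}" "j \<in> {0, 1, 2, 3, 4}" "k \<in> {0, 1, 2, 3, 4}" using assms by auto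
  then show "(i + j) mod 5 = (i + k) mod 5 \<longleftrightarrow> j = k"
    "(i + k) mod 5 = Suc ((i + j) mod 5) mod 5 \<longleftrightarrow> k = Suc j mod 5"
    "(i + j) mod 5 = i \<longleftrightarrow> j = 0" "(i + j) mod 5 = Suc i mod 5 \<longleftrightarrow> j = 1"
    by (elim insertE emptyE; simp)+
qed

locale conn_graph =
  fixes V :: "'a set" and E :: "'a rel"
  assumes conn: "connected_graph V E"
begin

section \<open>Graph distance\<close>

abbreviation d :: "'a \<Rightarrow> 'a \<Rightarrow> nat" where "d \<equiv> gdist E"

lemma adj_V: "(x, y) \<in> E \<Longrightarrow> x \<in> V \<and> y \<in> V"
  using conn by (auto simp: connected_graph_def simple_graph_def)

lemma adj_sym: "(x, y) \<in> E \<Longrightarrow> (y, x) \<in> E"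
  using conn by (auto simp: connected_graph_def simple_graph_def dest: symD)

lemma adj_commute: "(x, y) \<in> E \<longleftrightarrow> (y, x) \<in> E"
  using adj_sym by blast

lemma adj_irrefl: "(x, x) \<notin> E"
  using conn by (auto simp: connected_graph_def simple_graph_def irrefl_def)

lemma walk_exists:
  assumes "x \<in> V" "y \<in> V" shows "\<exists>n. (x, y) \<in> E ^^ n"
  using assms conn by (auto simp: connected_graph_def rtrancl_power)

lemma dist_walk:
  assumes "x \<in> V" "y \<in> V" shows "(x, y) \<in> E ^^ d x y"
  unfolding gdist_def using walk_exists[OF assms] by (rule LeastI_ex)

lemma dist_le: "(x, y) \<in> E ^^ n \<Longrightarrow> d x y \<le> n"
  unfolding gdist_def by (rule Least_le)

lemma dist_self [simp]: "d x x = 0"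
  using dist_le[of x x 0] by simp

lemma dist_eq_0: "x \<in> V \<Longrightarrow> y \<in> V \<Longrightarrow> d x y = 0 \<longleftrightarrow> x = y"
  using dist_walk[of x y] by auto

lemma dist_triangle:
  assumes "x \<in> V" "y \<in> V" "z \<in> V" shows "d x z \<le> d x y + d y z"
proof (rule dist_le)
  show "(x, z) \<in> E ^^ (d x y + d y z)"
    using dist_walk[OF assms(1,2)] dist_walk[OF assms(2,3)] by (auto simp: relpow_add)
qed

lemma dist_sym_le:
  assumes "x \<in> V" "y \<in> V" shows "d y x \<le> d x y"
proof (rule dist_le)
  have "(b, a) \<in> E ^^ n" if "(a, b) \<in> E ^^ n" for a b n
    using that
  proof (induction n arbitrary: b)
    case (Suc n)
    then obtain c where "(a, c) \<in> E ^^ n" "(c, b) \<in> E" by auto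
    then show ?case using Suc.IH[of c] adj_sym[of c b] relpow_Suc_I2[of b c E a n] by simp
  qed simp
  then show "(y, x) \<in> E ^^ d x y" using dist_walk[OF assms] by blast
qed

lemma dist_sym: "x \<in> V \<Longrightarrow> y \<in> V \<Longrightarrow> d x y = d y x"
  using dist_sym_le by (simp add: le_antisym)

lemma dist_eq_1: "x \<in> V \<Longrightarrow> y \<in> V \<Longrightarrow> d x y = 1 \<longleftrightarrow> (x, y) \<in> E"
proof
  assume "x \<in> V" "y \<in> V" "d x y = 1"
  then show "(x, y) \<in> E" using dist_walk[of x y] by simp
next
  assume V: "x \<in> V" "y \<in> V" and xy: "(x, y) \<in> E"
  have "d x y \<le> 1" using dist_le[of x y 1] xy by simp
  moreover have "d x y \<noteq> 0" using dist_eq_0[OF V] xy adj_irrefl by auto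
  ultimately show "d x y = 1" by simp
qed

lemma dist_adj: "(x, y) \<in> E \<Longrightarrow> d x y = 1"
  using dist_eq_1 adj_V by blast

lemma dist_adj': "(x, y) \<in> E \<Longrightarrow> d y x = 1"
  using dist_adj adj_sym by simp

lemma dist_step: "u \<in> V \<Longrightarrow> (x, y) \<in> E \<Longrightarrow> d u y \<le> Suc (d u x)"
  using dist_triangle[of u x y] dist_adj adj_V by fastforce

lemma dist_step': "u \<in> V \<Longrightarrow> (x, y) \<in> E \<Longrightarrow> d u x \<le> Suc (d u y)"
  using dist_step adj_sym by blast

lemma dist_le_1:
  assumes "x \<in> V" "y \<in> V" "d x y \<le> 1" shows "x = y \<or> (x, y) \<in> E"
  using assms dist_eq_0[of x y] dist_eq_1[of x y] by linarith

lemma dist_ge_2: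
  assumes "x \<in> V" "y \<in> V" "x \<noteq> y" "(x, y) \<notin> E" shows "2 \<le> d x y"
  using dist_le_1[OF assms(1,2)] assms(3,4) by linarith

lemma dist_eq_2:
  assumes "(x, z) \<in> E" "(z, y) \<in> E" "x \<noteq> y" "(x, y) \<notin> E" shows "d x y = 2"
  using dist_ge_2[of x y] dist_step[of x z y] dist_adj[of x z] adj_V[of x z] adj_V[of z y] assms
  by fastforce

lemma dist_pred:
  assumes "u \<in> V" "v \<in> V" "d u v = Suc n"
  shows "\<exists>w. (w, v) \<in> E \<and> d u w = n"
proof -
  have "(u, v) \<in> E ^^ Suc n" using dist_walk[OF assms(1,2)] assms(3) by simp
  then obtain w where w: "(u, w) \<in> E ^^ n" "(w, v) \<in> E" by auto
  have "d u w \<le> n" using dist_le w by blast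
  moreover have "Suc n \<le> Suc (d u w)" using dist_step[OF assms(1) w(2)] assms(3) by simp
  ultimately show ?thesis using w by auto
qed

section \<open>Criteria for induced squares and pentagons\<close>

lemma C4_freeD:
  assumes "C4_free V E" "(a, b) \<in> E" "(b, c) \<in> E" "(c, e) \<in> E" "(e, a) \<in> E"
    and ac: "a \<noteq> c" and be: "b \<noteq> e" and "(b, e) \<notin> E"
  shows "(a, c) \<in> E"
proof (rule ccontr)
  assume nac: "(a, c) \<notin> E"
  define x where "x i = [a, b, c, e] ! i" for i
  have sy: "(b, a) \<in> E" "(c, b) \<in> E" "(e, c) \<in> E" "(a, e) \<in> E" "(c, a) \<notin> E" "(e, b) \<notin> E"
    using adj_sym assms nac by blast+
  have neq: "a \<noteq> b" "b \<noteq> c" "c \<noteq> e" "e \<noteq> a" using assms adj_irrefl by auto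
  have "induced_cycle V E 4 x"
    unfolding induced_cycle_def
  proof (intro conjI)
    have "x ` {..<4} = {a, b, c, e}" by (auto simp: x_def numeral_eq_Suc lessThan_Suc)
    then show "x ` {..<4} \<subseteq> V" using adj_V assms by auto
    have "distinct [a, b, c, e]" using neq ac be by auto
    then have "inj_on ((!) [a, b, c, e]) {..<4}" by (intro inj_on_nth) auto
    then show "inj_on x {..<4}" by (simp add: x_def inj_on_def)
    show "\<forall>i<4. \<forall>j<4. ((x i, x j) \<in> E) = (j = Suc i mod 4 \<or> i = Suc j mod 4)"
      using assms(2-5,8) sy nac adj_irrefl unfolding x_def eval_nat_numeral BitM.simps All_less_Suc by simp
  qed
  then show False using assms(1) by (auto simp: C4_free_def)
qed

lemma C4_freeI:
  assumes "\<And>a b c e. (a, b) \<in> E \<Longrightarrow> (b, c) \<in> E \<Longrightarrow> (c, e) \<in> E \<Longrightarrow> (e, a) \<in> E \<Longrightarrow>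
    a \<noteq> c \<Longrightarrow> b \<noteq> e \<Longrightarrow> (b, e) \<notin> E \<Longrightarrow> (a, c) \<in> E"
  shows "C4_free V E"
  unfolding C4_free_def
proof
  assume "\<exists>x. induced_cycle V E 4 x"
  then obtain x where x: "induced_cycle V E 4 x" by blast
  have inj: "x i = x j \<longleftrightarrow> i = j" if "i < 4" "j < 4" for i j
    using x that by (auto simp: induced_cycle_def inj_on_def)
  have ad: "(x i, x j) \<in> E \<longleftrightarrow> j = Suc i mod 4 \<or> i = Suc j mod 4" if "i < 4" "j < 4" for i j
    using x that by (auto simp: induced_cycle_def)
  have "(x 0, x 2) \<in> E"
    by (rule assms[of "x 0" "x 1" "x 2" "x 3"]) (simp_all add: ad inj)
  then show False by (simp add: ad)
qed

text \<open>Distinctness need not be assumed: if two nonadjacent corners were equal, a neighbour of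
  one of them would be a nonneighbour of the other.\<close>

lemma induced_C5I:
  assumes "(a, b) \<in> E" "(b, c) \<in> E" "(c, e) \<in> E" "(e, f) \<in> E" "(f, a) \<in> E"
    and "(a, c) \<notin> E" "(a, e) \<notin> E" "(b, e) \<notin> E" "(b, f) \<notin> E" "(c, f) \<notin> E"
  shows "induced_cycle V E 5
    (\<lambda>i. [a, b, c, e, f] ! i)"
    (is "induced_cycle V E 5 ?x")
proof -
  have sy: "(b, a) \<in> E" "(c, b) \<in> E" "(e, c) \<in> E" "(f, e) \<in> E" "(a, f) \<in> E"
    "(c, a) \<notin> E" "(e, a) \<notin> E" "(e, b) \<notin> E" "(f, b) \<notin> E" "(f, c) \<notin> E"
    using adj_sym assms by blast+
  have neq: "distinct [a, b, c, e, f]"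
    using assms sy adj_irrefl by auto
  show ?thesis
    unfolding induced_cycle_def
  proof (intro conjI)
    have "?x ` {..<5} = {a, b, c, e, f}" by (auto simp: numeral_eq_Suc lessThan_Suc)
    then show "?x ` {..<5} \<subseteq> V" using adj_V assms by auto
    have "inj_on ?x {..<5}" using neq by (intro inj_on_nth) auto
    then show "inj_on ?x {..<5}" by (simp add: inj_on_def)
    show "\<forall>i<5. \<forall>j<5. ((?x i, ?x j) \<in> E) = (j = Suc i mod 5 \<or> i = Suc j mod 5)"
      using assms sy adj_irrefl unfolding eval_nat_numeral BitM.simps All_less_Suc by simp
  qed
qed

text \<open>Condition (V) without the level and without the complex. For a neighbour
  \<open>x\<close> of \<open>w\<close>, \<open>d v x < d v w\<close> already means one level lower;
  a lower neighbour exists by \<open>dist_pred\<close>; and in a flag complex pairwise adjacency is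
  all that a nonempty set of vertices needs in order to be a simplex.\<close>

definition Vcond :: "'a \<Rightarrow> bool" where
  "Vcond v \<longleftrightarrow> (\<forall>w x y. (x, w) \<in> E \<longrightarrow> (y, w) \<in> E \<longrightarrow> d v x < d v w \<longrightarrow> d v y < d v w \<longrightarrow>
     x \<noteq> y \<longrightarrow> (x, y) \<in> E)"

definition Econd :: "'a \<Rightarrow> bool" where
  "Econd v \<longleftrightarrow> (\<forall>x y. (x, y) \<in> E \<longrightarrow> d v x = d v y \<longrightarrow> 0 < d v x \<longrightarrow>
     (\<exists>z. (z, x) \<in> E \<and> (z, y) \<in> E \<and> Suc (d v z) = d v x))"

section \<open>Consequences and characterizations of (V) and (E)\<close>

definition VE :: bool where "VE \<longleftrightarrow> (\<forall>v\<in>V. Vcond v \<and> Econd v)"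

lemma VcondD: "Vcond v \<Longrightarrow> (x, w) \<in> E \<Longrightarrow> (y, w) \<in> E \<Longrightarrow> d v x < d v w \<Longrightarrow> d v y < d v w \<Longrightarrow>
    x = y \<or> (x, y) \<in> E"
  unfolding Vcond_def by blast

lemma EcondD: "Econd v \<Longrightarrow> (x, y) \<in> E \<Longrightarrow> d v x = d v y \<Longrightarrow> 0 < d v x \<Longrightarrow>
     \<exists>z. (z, x) \<in> E \<and> (z, y) \<in> E \<and> Suc (d v z) = d v x"
  unfolding Econd_def by blast

text \<open>Seen from the corner \<open>b\<close>, the opposite corner \<open>e\<close> has distance
  2 and the other two corners are its lower neighbours, so (V) joins them.\<close>

lemma VE_C4_free: assumes VE shows "C4_free V E"
proof (rule C4_freeI)
  fix a b c e assume h: "(a, b) \<in> E" "(b, c) \<in> E" "(c, e) \<in> E" "(e, a) \<in> E" "a \<noteq> c" "b \<noteq> e" "(b, e) \<notin> E"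
  have "d b e = 2" using dist_eq_2[of b c e] h by simp
  moreover have "d b a = 1" "d b c = 1" using h by (simp_all add: dist_adj dist_adj')
  moreover have "Vcond b" using assms h adj_V by (auto simp: VE_def)
  ultimately show "(a, c) \<in> E" using VcondD[of b a e c] h by (force simp: adj_commute)
qed

text \<open>The triangle condition is (E). The quadrangle condition holds vacuously:
  \<open>v\<close> and \<open>w\<close> are lower neighbours of \<open>z\<close>, so (V) forbids
  that their distance is 2.\<close>

lemma VE_weakly_modular: assumes VE shows "weakly_modular V E"
  unfolding weakly_modular_def
proof
  show "triangle_condition V E"
    unfolding triangle_condition_def
  proof (intro ballI impI)
    fix u v w assume V: "u \<in> V" "v \<in> V" "w \<in> V"
      and h: "gdist E v w = 1 \<and> 1 < gdist E u v \<and> gdist E u v = gdist E u w"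
    have "(v, w) \<in> E" using dist_eq_1 V h by blast
    then obtain z where "(z, v) \<in> E \<and> (z, w) \<in> E \<and> Suc (d u z) = d u v"
      using EcondD[of u v w] assms V h by (auto simp: VE_def)
    then show "\<exists>x\<in>V. (v, x) \<in> E \<and> (w, x) \<in> E \<and> gdist E u x = gdist E u v - 1"
      using adj_V adj_sym by (metis diff_Suc_1)
  qed
  show "quadrangle_condition V E"
    unfolding quadrangle_condition_def
  proof (intro ballI impI)
    fix u v w z assume V: "u \<in> V" "v \<in> V" "w \<in> V" "z \<in> V"
      and h: "gdist E v z = 1 \<and> gdist E w z = 1 \<and>
        gdist E v w = 2 \<and> 2 \<le> gdist E u v \<and>
        gdist E u v = gdist E u w \<and> gdist E u z = gdist E u v + 1"
    have "(v, z) \<in> E" "(w, z) \<in> E" using dist_eq_1 V h by blast+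
    then have "v = w \<or> (v, w) \<in> E" using VcondD[of u v z w] assms V h by (auto simp: VE_def)
    then have "d v w \<le> 1" using dist_adj by fastforce
    then show "\<exists>x\<in>V. (v, x) \<in> E \<and> (w, x) \<in> E \<and> gdist E u x = gdist E u v - 1" using h by simp
  qed
qed

lemma VE_thin: assumes VE shows "thin_graph V E"
  unfolding thin_graph_def
proof (intro ballI impI)
  fix u v x y assume V: "u \<in> V" "v \<in> V" and h: "u \<noteq> v \<and> (u, v) \<notin> E"
    and x: "x \<in> ginterval V E u v" and y: "y \<in> ginterval V E u v"
    and xy: "x \<noteq> y \<and> (v, x) \<in> E \<and> (v, y) \<in> E"
  have "d x v = 1" "d y v = 1" using xy by (simp_all add: dist_adj dist_adj')
  then have "d u x < d u v" "d u y < d u v" using x y by (auto simp: ginterval_def)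
  then show "(x, y) \<in> E" using VcondD[of u x v y] assms V xy by (auto simp: VE_def adj_commute)
qed

lemma thin_C4_free: assumes "thin_graph V E" shows "C4_free V E"
proof (rule C4_freeI)
  fix a b c e assume h: "(a, b) \<in> E" "(b, c) \<in> E" "(c, e) \<in> E" "(e, a) \<in> E" "a \<noteq> c" "b \<noteq> e" "(b, e) \<notin> E"
  have V: "a \<in> V" "b \<in> V" "c \<in> V" "e \<in> V" using h adj_V by blast+
  have "d b e = 2" using dist_eq_2[of b c e] h by simp
  moreover have "d b a = 1" "d b c = 1" "d a e = 1" "d c e = 1" using h by (simp_all add: dist_adj dist_adj')
  ultimately have "a \<in> ginterval V E b e" "c \<in> ginterval V E b e" using V by (auto simp: ginterval_def)
  then show "(a, c) \<in> E" using assms V h adj_sym[OF h(3)] unfolding thin_graph_def by blast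
qed

text \<open>The ball of radius 1 around \<open>a\<close> contains \<open>b\<close> and
  \<open>e\<close>, hence also \<open>c\<close>, which lies between them.\<close>

lemma convex_balls_C4_free: assumes "convex_balls V E" shows "C4_free V E"
proof (rule C4_freeI, rule ccontr)
  fix a b c e assume h: "(a, b) \<in> E" "(b, c) \<in> E" "(c, e) \<in> E" "(e, a) \<in> E" "a \<noteq> c" "b \<noteq> e" "(b, e) \<notin> E"
    and n: "(a, c) \<notin> E"
  have V: "a \<in> V" "b \<in> V" "c \<in> V" "e \<in> V" using h adj_V by blast+
  have "d b e = 2" using dist_eq_2[of b c e] h by simp
  moreover have "d b c = 1" "d c e = 1" "d a b = 1" "d a e = 1" using h by (simp_all add: dist_adj dist_adj')
  ultimately have "c \<in> ginterval V E b e" "b \<in> gball V E 1 a" "e \<in> gball V E 1 a"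
    using V by (auto simp: ginterval_def gball_def)
  then have "c \<in> gball V E 1 a" using assms V unfolding convex_balls_def gconvex_def by blast
  then show False using dist_le_1[of a c] V h n by (auto simp: gball_def)
qed

lemma triangleD:
  assumes "weakly_modular V E" "u \<in> V" "(v, w) \<in> E" "1 < d u v" "d u v = d u w"
  shows "\<exists>x. (v, x) \<in> E \<and> (w, x) \<in> E \<and> d u x = d u v - 1"
  using assms adj_V[OF assms(3)] dist_adj[OF assms(3)]
  unfolding weakly_modular_def triangle_condition_def by blast

lemma quadrangleD:
  assumes "weakly_modular V E" "u \<in> V" "(v, z) \<in> E" "(w, z) \<in> E" "d v w = 2" "2 \<le> d u v"
    "d u v = d u w" "d u z = d u v + 1"
  shows "\<exists>x. (v, x) \<in> E \<and> (w, x) \<in> E \<and> d u x = d u v - 1"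
  using assms adj_V[OF assms(3)] adj_V[OF assms(4)] dist_adj[OF assms(3)] dist_adj[OF assms(4)]
  unfolding weakly_modular_def quadrangle_condition_def by blast

text \<open>For two nonadjacent lower neighbours \<open>x\<close>, \<open>y\<close> of
  \<open>w\<close> the quadrangle condition yields \<open>z\<close> two levels below
  \<open>w\<close>. Levels exclude the diagonal from \<open>w\<close> to \<open>z\<close> in the
  square \<open>x\<close>, \<open>w\<close>, \<open>y\<close>, \<open>z\<close>, so the other
  diagonal is present. (E) is the triangle condition.\<close>

lemma weakly_modular_C4_free_VE:
  assumes wm: "weakly_modular V E" and c4: "C4_free V E" shows VE
  unfolding VE_def
proof (intro ballI conjI)
  fix v assume v: "v \<in> V"
  show "Vcond v"
    unfolding Vcond_def
  proof (intro allI impI, rule ccontr)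
    fix w x y assume h: "(x, w) \<in> E" "(y, w) \<in> E" "d v x < d v w" "d v y < d v w" "x \<noteq> y" "(x, y) \<notin> E"
    have V: "x \<in> V" "y \<in> V" "w \<in> V" using h adj_V by blast+
    have dxy: "d x y = 2" using dist_eq_2[of x w y] h adj_sym by blast
    have sx: "d v w = Suc (d v x)" using dist_step[OF v h(1)] h(3) by simp
    have sy: "d v w = Suc (d v y)" using dist_step[OF v h(2)] h(4) by simp
    have "d v x \<noteq> 0" using dist_eq_0 sx sy v V h(5) by (metis Suc_inject)
    \<comment> \<open>The triangle and quadrangle conditions say nothing about vertices at distance
      1; there the base vertex itself is the common lower neighbour.\<close>
    then consider "d v x = 1" | "2 \<le> d v x" by linarith
    then obtain z where z: "(x, z) \<in> E" "(y, z) \<in> E" "d v z < d v x"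
    proof cases
      case 1
      then have "(v, x) \<in> E" "(v, y) \<in> E" using dist_eq_1 v V sx sy by auto
      then show ?thesis using that[of v] 1 by (simp add: adj_commute)
    next
      case 2
      then obtain z where "(x, z) \<in> E" "(y, z) \<in> E" "d v z = d v x - 1"
        using quadrangleD[OF wm v h(1,2) dxy] sx sy by auto
      then show ?thesis using that[of z] 2 by simp
    qed
    have "(x, y) \<in> E"
    proof (rule C4_freeD[OF c4, of x w y z])
      show "w \<noteq> z" using z sx by auto
      show "(w, z) \<notin> E" using dist_step'[OF v, of w z] z sx by auto
    qed (use h z in \<open>auto simp: adj_commute\<close>)
    then show False using h by simp
  qed
  show "Econd v"
    unfolding Econd_def
  proof (intro allI impI)
    fix x y assume h: "(x, y) \<in> E" "d v x = d v y" "0 < d v x"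
    have V: "x \<in> V" "y \<in> V" using h adj_V by blast+
    show "\<exists>z. (z, x) \<in> E \<and> (z, y) \<in> E \<and> Suc (d v z) = d v x"
    proof (cases "d v x = 1")
      case True
      then have "(v, x) \<in> E" "(v, y) \<in> E" using dist_eq_1 v V h by auto
      then show ?thesis using True by auto
    next
      case False
      then have "1 < d v x" using h by simp
      then obtain z where "(x, z) \<in> E" "(y, z) \<in> E" "d v z = d v x - 1"
        using triangleD[OF wm v h(1) _ h(2)] by auto
      then show ?thesis using \<open>1 < d v x\<close> by (intro exI[of _ z]) (auto simp: adj_commute)
    qed
  qed
qed

text \<open>In a minimal counterexample the geodesic leaves the ball in its first step \<open>x'\<close> and stays on
  the next sphere; (E) replaces \<open>x'\<close> by a vertex w inside the ball, from which the rest of the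
  geodesic is a smaller counterexample.\<close>

lemma VE_convex_balls: assumes VE shows "convex_balls V E"
proof -
  have main: "d u z \<le> r" if "u \<in> V" "x \<in> V" "y \<in> V" "z \<in> V" "d u x \<le> r" "d u y \<le> r"
      "d x z + d z y = d x y" for u x y z r
    using that
  proof (induction "d x y" arbitrary: x y z r rule: less_induct)
    case less
    note V = less.prems(1-4)
    show ?case
    proof (rule ccontr)
      assume far: "\<not> d u z \<le> r"
      have "x \<noteq> z" using far less.prems by auto
      then obtain n where n: "d x z = Suc n" using dist_eq_0[of x z] V not0_implies_Suc by metis
      then have "d z x = Suc n" using dist_sym V by simp
      then obtain x' where x': "(x', x) \<in> E" "d z x' = n" using dist_pred[of z x n] V by blast
      have V': "x' \<in> V" using x' adj_V by blast
      have xx': "(x, x') \<in> E" "d x x' = 1" using x' by (simp_all add: dist_adj' adj_sym)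
      have t: "d x y \<le> 1 + d x' y" "d x' y \<le> d x' z + d z y"
        using dist_triangle[of x x' y] dist_triangle[of x' z y] V V' xx' by auto
      have x'z: "d x' z = n" using x' dist_sym V V' by simp
      have x'y: "Suc (d x' y) = d x y" "d x' z + d z y = d x' y" using t n x'z less.prems(7) by auto
      have lx': "\<not> d u x' \<le> r"
        using less.hyps[of x' y z r] x'y V V' less.prems far by auto
      then have lx'1: "d u x' = Suc r" "d u x = r"
        using dist_step[OF V(1) xx'(1)] less.prems(5) by auto
      have "x' \<noteq> y" using lx' less.prems by auto
      then obtain k where k: "d x' y = Suc k" using dist_eq_0[of x' y] V V' not0_implies_Suc by metis
      then have "d y x' = Suc k" using dist_sym V V' by simp
      then obtain x2 where x2: "(x2, x') \<in> E" "d y x2 = k" using dist_pred[of y x' k] V V' by blast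
      have V2: "x2 \<in> V" using x2 adj_V by blast
      have x2y: "d x2 y = k" using x2 dist_sym V V2 by simp
      have dxy: "d x y = Suc (Suc k)" using x'y k by simp
      have dx2: "d x x2 = 2"
        using dist_step[of x x' x2] dist_triangle[of x x2 y] V V2 adj_sym[OF x2(1)] xx' x2y dxy by simp
      \<comment> \<open>The rest of the geodesic, from \<open>x'\<close> to \<open>y\<close>, is
        shorter and has both ends in the ball of radius \<open>Suc r\<close>, so the induction
        hypothesis bounds the level of its next vertex.\<close>
      have lx2: "d u x2 \<le> Suc r"
        using less.hyps[of x' y x2 "Suc r"] V V' V2 x'y k x2y dist_adj[OF adj_sym[OF x2(1)]]
          lx'1 less.prems by simp
      have nadj: "x \<noteq> x2" "(x, x2) \<notin> E" using dx2 dist_adj by force+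
      have VC: "Vcond u" "Econd u" using assms V by (auto simp: VE_def)
      show False
      proof (cases "d u x2 \<le> r")
        case True
        then show False using VcondD[OF VC(1) xx'(1) x2(1)] lx'1 nadj by simp
      next
        case False
        then have lx2': "d u x2 = Suc r" using lx2 by simp
        obtain w where w: "(w, x') \<in> E" "(w, x2) \<in> E" "d u w = r"
          using EcondD[OF VC(2) adj_sym[OF x2(1)]] lx2' lx'1 by auto
        have Vw: "w \<in> V" using w adj_V by blast
        have "x = w \<or> (x, w) \<in> E" using VcondD[OF VC(1) xx'(1) w(1)] w lx'1 by simp
        then have xw: "(x, w) \<in> E" using w nadj by auto
        have wx2: "d w x2 = 1" "d x w = 1" using w xw dist_adj by auto
        have "d w y = Suc k"
          using dist_triangle[of w x2 y] dist_triangle[of x w y] V V2 Vw wx2 x2y dxy by simp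
        then show False
          using less.hyps[of w y x2 r] V V2 Vw dxy wx2 x2y w less.prems lx2' by simp
      qed
    qed
  qed
  show ?thesis
    unfolding convex_balls_def gconvex_def ginterval_def gball_def
  proof (intro ballI allI conjI subsetI CollectI)
    fix u r x y z
    assume "u \<in> V" "x \<in> {y \<in> V. d u y \<le> r}" "y \<in> {y \<in> V. d u y \<le> r}"
      and "z \<in> {z \<in> V. d x z + d z y = d x y}"
    then show "d u z \<le> r" using main[of u x y z r] by simp
  qed auto
qed

text \<open>From \<open>x 0\<close> the opposite edge lies on the sphere of radius 2. Its common
  lower neighbour \<open>c\<close> is adjacent to \<open>x 0\<close>, \<open>x 2\<close>,
  \<open>x 3\<close>, and the squares through \<open>x 1\<close> and through \<open>x 4\<close>
  force the two missing spokes.\<close>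

lemma VE_C5s_in_W5s: assumes VE shows "C5s_in_W5s V E"
  unfolding C5s_in_W5s_def
proof (intro allI impI)
  fix x assume x: "induced_cycle V E 5 x"
  have c4: "C4_free V E" using VE_C4_free assms by simp
  have inj: "x i = x j \<longleftrightarrow> i = j" if "i < 5" "j < 5" for i j
    using x that by (auto simp: induced_cycle_def inj_on_def)
  have ad: "(x i, x j) \<in> E \<longleftrightarrow> j = Suc i mod 5 \<or> i = Suc j mod 5" if "i < 5" "j < 5" for i j
    using x that by (auto simp: induced_cycle_def)
  have V: "x i \<in> V" if "i < 5" for i using x that by (auto simp: induced_cycle_def)
  have "d (x 0) (x 2) = 2" by (rule dist_eq_2[of _ "x 1"]) (simp_all add: ad inj)
  moreover have "d (x 0) (x 3) = 2" by (rule dist_eq_2[of _ "x 4"]) (simp_all add: ad inj)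
  moreover have "Econd (x 0)" using assms V by (simp add: VE_def)
  ultimately obtain c where c: "(c, x 2) \<in> E" "(c, x 3) \<in> E" "d (x 0) c = 1"
    using EcondD[of "x 0" "x 2" "x 3"] by (auto simp: ad)
  have Vc: "c \<in> V" using c adj_V by blast
  have c0: "(c, x 0) \<in> E" using c dist_eq_1[of "x 0" c] V Vc by (simp add: adj_commute)
  have c1: "(c, x 1) \<in> E"
  proof (rule C4_freeD[OF c4, of c "x 0" "x 1" "x 2"])
    show "c \<noteq> x 1" using c by (auto simp: ad)
  qed (use c c0 in \<open>auto simp: ad inj adj_commute\<close>)
  have c4: "(c, x 4) \<in> E"
  proof (rule C4_freeD[OF c4, of c "x 0" "x 4" "x 3"])
    show "c \<noteq> x 4" using c by (auto simp: ad)
  qed (use c c0 in \<open>auto simp: ad inj adj_commute\<close>)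
  have "i < 5 \<Longrightarrow> i = 0 \<or> i = 1 \<or> i = 2 \<or> i = 3 \<or> i = 4" for i :: nat by auto
  then show "\<exists>c\<in>V. \<forall>i<5. (c, x i) \<in> E" using Vc c c0 c1 c4 by metis
qed

text \<open>For (V), \<open>w\<close> would lie between two nonadjacent lower neighbours and so
  belong to a ball that it lies outside of. For (E), lower neighbours \<open>x\<close> of
  \<open>w\<close> and \<open>y\<close> of \<open>w'\<close> without a common choice lead to an
  induced pentagon \<open>x\<close>, \<open>w\<close>, \<open>w'\<close>, \<open>y\<close>,
  \<open>z\<close>, and the hub of its wheel is the common lower neighbour that was supposed not to
  exist.\<close>

lemma convex_balls_C5s_VE:
  assumes cb: "convex_balls V E" and c5: "C5s_in_W5s V E" shows VE
  unfolding VE_def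
proof (intro ballI conjI)
  fix v assume v: "v \<in> V"
  have c4: "C4_free V E" using convex_balls_C4_free cb by simp
  have cv: "d v z \<le> r" if "x \<in> V" "y \<in> V" "z \<in> V" "d v x \<le> r" "d v y \<le> r"
      "d x z + d z y = d x y" for x y z r
  proof -
    have "gconvex V E (gball V E r v)" using cb v by (simp add: convex_balls_def)
    moreover have "x \<in> gball V E r v" "y \<in> gball V E r v" "z \<in> ginterval V E x y"
      using that by (auto simp: gball_def ginterval_def)
    ultimately have "z \<in> gball V E r v" unfolding gconvex_def by blast
    then show ?thesis by (simp add: gball_def)
  qed
  show "Vcond v"
    unfolding Vcond_def
  proof (intro allI impI, rule ccontr)
    fix w x y assume h: "(x, w) \<in> E" "(y, w) \<in> E" "d v x < d v w" "d v y < d v w" "x \<noteq> y" "(x, y) \<notin> E"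
    have V: "x \<in> V" "y \<in> V" "w \<in> V" using h adj_V by blast+
    have "d x y = 2" using dist_eq_2[of x w y] h adj_sym by blast
    moreover have "d x w = 1" "d w y = 1" using h by (simp_all add: dist_adj dist_adj')
    ultimately have "d v w \<le> d v w - 1" using cv[of x y w "d v w - 1"] V h by simp
    then show False using h by simp
  qed
  show "Econd v"
    unfolding Econd_def
  proof (intro allI impI)
    fix w w' assume h: "(w, w') \<in> E" "d v w = d v w'" "0 < d v w"
    have V: "w \<in> V" "w' \<in> V" using h adj_V by blast+
    obtain n where n: "d v w = Suc n" using h by (metis gr0_conv_Suc)
    obtain x where x: "(x, w) \<in> E" "d v x = n" using dist_pred v V n by blast
    obtain y where y: "(y, w') \<in> E" "d v y = n" using dist_pred[of v w' n] v V n h by auto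
    have V': "x \<in> V" "y \<in> V" using x y adj_V by blast+
    have "\<exists>z. (z, w) \<in> E \<and> (z, w') \<in> E \<and> d v z \<le> n"
    proof (rule ccontr)
      assume no: "\<not> ?thesis"
      have nx: "(x, w') \<notin> E" and ny: "(y, w) \<notin> E" using no x y by auto
      have xy: "x \<noteq> y" using nx y by auto
      have dxw: "d x w = 1" "d w w' = 1" "d w' y = 1" using x h y by (simp_all add: dist_adj dist_adj')
      have nadj: "(x, y) \<notin> E"
      proof
        assume "(x, y) \<in> E"
        then have "(x, w') \<in> E"
          using C4_freeD[OF c4, of x w w' y] x h y nx ny dist_adj n by (fastforce simp: adj_commute)
        then show False using nx by simp
      qed
      have dwy: "d w y = 2"
        using dist_eq_2[of w w' y] h adj_sym[OF y(1)] y n ny by (fastforce simp: adj_commute)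
      \<comment> \<open>At distance 3 the walk \<open>x\<close>, \<open>w\<close>,
        \<open>w'\<close>, \<open>y\<close> would be a geodesic, and convexity would put
        \<open>w\<close> into the ball of radius \<open>n\<close>.\<close>
      have "d x y \<noteq> 3"
      proof
        assume "d x y = 3"
        then have "d v w \<le> n" using cv[of x y w n] V V' x y dxw dwy by simp
        then show False using n by simp
      qed
      moreover have "d x y \<le> 3" using dist_triangle[of x w y] dwy dxw V V' by simp
      moreover have "2 \<le> d x y" using dist_ge_2 V' nadj xy by simp
      ultimately have dxy: "d x y = 2" by simp
      then obtain z where z: "(z, y) \<in> E" "d x z = 1" using dist_pred[of x y 1] V' by auto
      have Vz: "z \<in> V" using z adj_V by blast
      have xz: "(x, z) \<in> E" using z dist_eq_1 V' Vz by simp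
      \<comment> \<open>A common neighbour of \<open>x\<close> and \<open>y\<close> lies between
        them, so convexity keeps it in the ball. This serves twice: for \<open>z\<close> and, at the
        end, for the hub of the wheel.\<close>
      have dz: "d v c \<le> n" if "(c, x) \<in> E" "(c, y) \<in> E" for c
        using cv[of x y c n] that V' adj_V x y dxy dist_adj adj_sym by (metis one_add_one order_refl)
      have zn: "d v z \<le> n" using dz xz z adj_sym by blast
      have zw: "(z, w) \<notin> E"
      proof
        assume a: "(z, w) \<in> E"
        then have "(z, w') \<in> E"
          using C4_freeD[OF c4, of z w w' y] h y z ny zn n by (fastforce simp: adj_commute)
        then show False using no a zn by blast
      qed
      have zw': "(z, w') \<notin> E"
      proof
        assume a: "(z, w') \<in> E"
        then have "(z, w) \<in> E"
          using C4_freeD[OF c4, of z w' w x] h x xz nx zn n by (fastforce simp: adj_commute)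
        then show False using no a zn by blast
      qed
      have "induced_cycle V E 5 (\<lambda>i. [x, w, w', y, z] ! i)"
        by (rule induced_C5I) (use x h y z xz nx ny zw zw' nadj adj_sym in blast)+
      then obtain c where c: "\<forall>i<5. (c, [x, w, w', y, z] ! i) \<in> E"
        using c5 unfolding C5s_in_W5s_def by blast
      have "(c, x) \<in> E" "(c, w) \<in> E" "(c, w') \<in> E" "(c, y) \<in> E"
        using c[rule_format, of 0] c[rule_format, of 1] c[rule_format, of 2] c[rule_format, of 3]
        by auto
      then show False using no dz by blast
    qed
    then obtain z where z: "(z, w) \<in> E" "(z, w') \<in> E" "d v z \<le> n" by blast
    have "Suc (d v z) = d v w" using dist_step[OF v z(1)] z(3) n by simp
    then show "\<exists>z. (z, w) \<in> E \<and> (z, w') \<in> E \<and> Suc (d v z) = d v w" using z by blast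
  qed
qed

text \<open>All levels are taken from the apex \<open>a\<close>. There \<open>q 0\<close>,
  \<open>q 1\<close> have level 1 and \<open>q 2\<close>, \<open>q 4\<close>, \<open>c\<close> have
  level 2; \<open>q 3\<close> has level 2 too, since at level 3 it would have the nonadjacent lower
  neighbours \<open>q 2\<close> and \<open>q 4\<close>. (E) at the edge from \<open>q 3\<close> to
  \<open>q 4\<close> yields \<open>y\<close>. Its remaining adjacencies come alternately from (V)
  and from squares: \<open>q 0\<close>, \<open>c\<close>, \<open>q 1\<close>,
  \<open>q 2\<close>.\<close>

lemma VE_W5_hat: assumes VE shows "W5_hat_condition V E"
  unfolding W5_hat_condition_def
proof (intro allI impI)
  fix x c a assume "induced_W5_hat V E x c a"
  then have x: "induced_cycle V E 5 x" and cV: "c \<in> V" and cx: "\<forall>i<5. (c, x i) \<in> E"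
    and aV: "a \<in> V" and ac: "a \<noteq> c" "(a, c) \<notin> E"
    and aX: "a \<notin> x ` {..<5}"
    and "\<exists>i<5. \<forall>j<5. (a, x j) \<in> E \<longleftrightarrow> j = i \<or> j = Suc i mod 5"
    by (auto simp: induced_W5_hat_def induced_W5_def)
  then obtain i where i: "i < 5" "\<forall>j<5. (a, x j) \<in> E \<longleftrightarrow> j = i \<or> j = Suc i mod 5" by blast
  have c4: "C4_free V E" using VE_C4_free assms by simp
  \<comment> \<open>The rim is rotated so that the apex is attached to \<open>q 0\<close> and
    \<open>q 1\<close>.\<close>
  define q where "q j = x ((i + j) mod 5)" for j
  have rot: "(i + j) mod 5 = (i + k) mod 5 \<longleftrightarrow> j = k"
    "(i + k) mod 5 = Suc ((i + j) mod 5) mod 5 \<longleftrightarrow> k = Suc j mod 5"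
    "(i + j) mod 5 = i \<longleftrightarrow> j = 0" "(i + j) mod 5 = Suc i mod 5 \<longleftrightarrow> j = 1"
    if "j < 5" "k < 5" for j k
    using rot5[OF i(1) that] by blast+
  have xi: "x j = x k \<longleftrightarrow> j = k" if "j < 5" "k < 5" for j k
    using x that by (auto simp: induced_cycle_def inj_on_def)
  have xa: "(x j, x k) \<in> E \<longleftrightarrow> k = Suc j mod 5 \<or> j = Suc k mod 5" if "j < 5" "k < 5" for j k
    using x that by (auto simp: induced_cycle_def)
  have lt: "j mod 5 < 5" for j :: nat by simp
  have inj: "q j = q k \<longleftrightarrow> j = k" if "j < 5" "k < 5" for j k
    unfolding q_def xi[OF lt lt] by (rule rot(1)[OF that])
  have ad: "(q j, q k) \<in> E \<longleftrightarrow> k = Suc j mod 5 \<or> j = Suc k mod 5" if "j < 5" "k < 5" for j k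
    unfolding q_def xa[OF lt lt] rot(2)[OF that] rot(2)[OF that(2,1)] ..
  have aq: "(a, q j) \<in> E \<longleftrightarrow> j = 0 \<or> j = 1" if "j < 5" for j
    unfolding q_def i(2)[rule_format, OF lt] rot(3,4)[OF that that] ..
  have cq: "(c, q j) \<in> E" for j using cx unfolding q_def by auto
  have anq: "a \<noteq> q j" for j using aX unfolding q_def by auto
  have V: "q j \<in> V" for j using cq adj_V by blast
  have img: "x ` {..<5} \<subseteq> q ` {..<5}"
  proof
    fix y assume "y \<in> x ` {..<5}"
    then obtain k where k: "k < 5" "y = x k" by auto
    have "(i + (5 + k - i) mod 5) mod 5 = k" using i(1) k(1) by (simp add: mod_add_right_eq)
    then have "y = q ((5 + k - i) mod 5)" using k(2) by (simp add: q_def)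
    then show "y \<in> q ` {..<5}" by (simp add: image_iff) (metis mod_less_divisor zero_less_numeral lessThan_iff)
  qed
  have VC: "Vcond a" "Econd a" using assms aV by (auto simp: VE_def)
  have e: "(q 0, q 1) \<in> E" "(q 1, q 2) \<in> E" "(q 2, q 3) \<in> E" "(q 3, q 4) \<in> E" "(q 4, q 0) \<in> E"
    and e': "(q 1, q 0) \<in> E" "(q 2, q 1) \<in> E" "(q 3, q 2) \<in> E" "(q 4, q 3) \<in> E" "(q 0, q 4) \<in> E"
    and ne: "(q 2, q 4) \<notin> E" "(q 0, q 3) \<notin> E" "(q 1, q 3) \<notin> E"
    and qn: "q 2 \<noteq> q 4" "q 0 \<noteq> q 3" "q 1 \<noteq> q 3" "q 4 \<noteq> q 0"
    by (simp_all add: ad inj)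
  have ea: "(a, q 0) \<in> E" "(a, q 1) \<in> E" "(a, q 2) \<notin> E" "(a, q 3) \<notin> E" "(a, q 4) \<notin> E"
    by (simp_all add: aq)
  have qc: "(q j, c) \<in> E" for j using cq adj_sym by blast
  have d1: "d a (q 0) = 1" "d a (q 1) = 1" using ea dist_adj by blast+
  have d2: "d a (q 4) = 2" by (rule dist_eq_2[OF ea(1) e'(5) anq ea(5)])
  have d2': "d a (q 2) = 2" by (rule dist_eq_2[OF ea(2) e(2) anq ea(3)])
  have d2c: "d a c = 2" by (rule dist_eq_2[OF ea(1) qc ac])
  have "2 \<le> d a (q 3)" by (rule dist_ge_2[OF aV V anq ea(4)])
  moreover have "d a (q 3) \<noteq> 3"
    using VcondD[OF VC(1) e(3) e'(4)] d2 d2' qn ne by fastforce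
  moreover have "d a (q 3) \<le> 3" using dist_step[OF aV e'(4)] d2 by simp
  ultimately have d3: "d a (q 3) = 2" by simp
  obtain y where y: "(y, q 3) \<in> E" "(y, q 4) \<in> E" "d a y = 1"
    using EcondD[OF VC(2) e(4)] d3 d2 by auto
  have yV: "y \<in> V" using y adj_V by blast
  have ya: "(y, a) \<in> E" using dist_eq_1[OF aV yV] y(3) adj_sym by blast
  have y0: "(y, q 0) \<in> E"
    using VcondD[OF VC(1) y(2) e'(5)] y d1 d2 ne by fastforce
  have yc': "y \<noteq> c" using y d2c by auto
  have yc: "(y, c) \<in> E"
    by (rule C4_freeD[OF c4 y0 qc cq _ yc' qn(2) ne(2)]) (rule y(1)[THEN adj_sym])
  have "y \<noteq> q 1" using y ne by auto
  then have y1: "(y, q 1) \<in> E"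
    using VcondD[OF VC(1) yc qc[of 1]] y d1 d2c by auto
  have y2': "y \<noteq> q 2" using y d2' by auto
  have y2: "(y, q 2) \<in> E"
    by (rule C4_freeD[OF c4 y1 e(2) e(3) _ y2' qn(3) ne(3)]) (rule y(1)[THEN adj_sym])
  have "{..<5::nat} = {0, 1, 2, 3, 4}" by auto
  then have "\<forall>z\<in>q ` {..<5}. (y, z) \<in> E" using y(1,2) y0 y1 y2 by simp
  then have all: "\<forall>z\<in>x ` {..<5} \<union> {c, a}. (y, z) \<in> E" using img yc ya by blast
  then have "y \<notin> x ` {..<5} \<union> {c, a}" using adj_irrefl by blast
  then show "\<exists>v\<in>V - (x ` {..<5} \<union> {c, a}). \<forall>y\<in>x ` {..<5} \<union> {c, a}. (v, y) \<in> E"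
    using all yV by blast
qed

text \<open>This takes (E) from edges to all simplices. Singletons use a geodesic and pairs use (E).
  Otherwise let \<open>z\<close> serve all vertices but \<open>a\<close>, and \<open>z'\<close> all
  but \<open>b\<close>. They share an upper neighbour \<open>c\<close>, so they are equal or
  adjacent by (V); if neither served all of \<sigma>, then \<open>z\<close>, \<open>b\<close>,
  \<open>a\<close>, \<open>z'\<close> would be an induced square.\<close>

lemma common_lower_neighbour:
  assumes VE: VE and v: "v \<in> V" and "finite \<sigma>" "\<sigma> \<noteq> {}"
    and cl: "\<forall>x\<in>\<sigma>. \<forall>y\<in>\<sigma>. x \<noteq> y \<longrightarrow> (x, y) \<in> E"
    and lev: "\<forall>x\<in>\<sigma>. x \<in> V \<and> d v x = Suc i"
  shows "\<exists>z. d v z = i \<and> (\<forall>x\<in>\<sigma>. (z, x) \<in> E)"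
  using assms(3-)
proof (induction "card \<sigma>" arbitrary: \<sigma> rule: less_induct)
  case less
  have VC: "Vcond v" "Econd v" using VE v by (auto simp: VE_def)
  have c4: "C4_free V E" using VE_C4_free VE by simp
  obtain a where a: "a \<in> \<sigma>" using less.prems by auto
  show ?case
  proof (cases "\<sigma> = {a}")
    case True
    then show ?thesis using dist_pred[OF v, of a i] less.prems by auto
  next
    case False
    then obtain b where b: "b \<in> \<sigma>" "b \<noteq> a" using a by auto
    have IH: "\<exists>z. d v z = i \<and> (\<forall>x\<in>\<sigma> - {u}. (z, x) \<in> E)" if "u \<in> \<sigma>" for u
    proof (rule less.hyps)
      show "card (\<sigma> - {u}) < card \<sigma>" using that less.prems(1) by (metis card_Diff1_less)
      show "\<sigma> - {u} \<noteq> {}" using a b by auto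
    qed (use less.prems in auto)
    show ?thesis
    proof (cases "\<sigma> = {a, b}")
      case True
      then show ?thesis
        using EcondD[OF VC(2), of a b] less.prems a b by fastforce
    next
      case ne: False
      then obtain c where c: "c \<in> \<sigma>" "c \<noteq> a" "c \<noteq> b" using a b by auto
      obtain z where z: "d v z = i" "\<forall>x\<in>\<sigma> - {a}. (z, x) \<in> E" using IH a by blast
      obtain z' where z': "d v z' = i" "\<forall>x\<in>\<sigma> - {b}. (z', x) \<in> E" using IH b by blast
      have "z = z' \<or> (z, z') \<in> E"
        using VcondD[OF VC(1), of z c z'] z z' c less.prems(4) by auto
      moreover have "(z, a) \<in> E \<or> (z', b) \<in> E" if "(z, z') \<in> E"
      proof (rule ccontr)
        assume n: "\<not> ?thesis"
        have "(z, b) \<in> E" "(b, a) \<in> E" "(z', a) \<in> E" "z \<noteq> a" "b \<noteq> z'"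
          using z(2) z'(2) a b less.prems(3) z(1) z'(1) less.prems(4)[rule_format, of a]
            less.prems(4)[rule_format, of b] by auto
        then have "(z, a) \<in> E"
          using C4_freeD[OF c4, of z b a z'] n that adj_sym by blast
        then show False using n by simp
      qed
      ultimately show ?thesis using z z' b by blast
    qed
  qed
qed

end

section \<open>Topology of the realization\<close>

lemma topspace_realization [simp]: "topspace (realization X) = realization_points X"
proof -
  have "openin (realization X) (realization_points X)"
    unfolding openin_realization
  proof (intro conjI ballI)
    fix \<sigma>
    have "realization_points X \<inter> closed_cell X \<sigma> = closed_cell X \<sigma>" by (auto simp: closed_cell_def)
    then show "openin (top_of_set (closed_cell X \<sigma>)) (realization_points X \<inter> closed_cell X \<sigma>)" by simp
  qed simp
  moreover have "topspace (realization X) \<subseteq> realization_points X"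
    using openin_realization openin_topspace by blast
  ultimately show ?thesis by (simp add: openin_subset subset_antisym)
qed

text \<open>For \<open>S\<close> the set of nonzero reals this is the open star of \<open>u\<close>.
  The open stars form the cover by which points of a disc are labelled later.\<close>

lemma openin_realization_coordinate:
  assumes "open (S :: real set)"
  shows "openin (realization X) {p \<in> realization_points X. p u \<in> S}"
  unfolding openin_realization
proof (intro conjI ballI)
  fix \<sigma> assume "\<sigma> \<in> X"
  have "continuous_on (closed_cell X \<sigma>) (\<lambda>p. p u)"
    by (rule continuous_on_subset[OF continuous_on_product_coordinates subset_UNIV])
  then have "openin (top_of_set (closed_cell X \<sigma>)) (closed_cell X \<sigma> \<inter> (\<lambda>p. p u) -` S)"
    using assms continuous_openin_preimage_gen by blast
  moreover have "closed_cell X \<sigma> \<inter> (\<lambda>p. p u) -` S = {p \<in> realization_points X. p u \<in> S} \<inter> closed_cell X \<sigma>"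
    by (auto simp: closed_cell_def)
  ultimately show "openin (top_of_set (closed_cell X \<sigma>)) ({p \<in> realization_points X. p u \<in> S} \<inter> closed_cell X \<sigma>)"
    by simp
qed auto

lemma continuous_map_realization_coordinate:
  "continuous_map (realization X) euclideanreal (\<lambda>p. p u)"
  unfolding continuous_map_def using openin_realization_coordinate by auto

text \<open>In general the weak topology is finer than coordinatewise convergence, but only the
  finitely many simplices inside \<open>F\<close> matter here: the preimage of the complement of an
  open set is a finite union of closed sets, one for each of them.\<close>

lemma continuous_map_into_realization:
  assumes "finite F"
    and pts: "\<And>z. z \<in> topspace T \<Longrightarrow> f z \<in> realization_points X"
    and supp: "\<And>z u. z \<in> topspace T \<Longrightarrow> f z u \<noteq> 0 \<Longrightarrow> u \<in> F"
    and cont: "\<And>u. continuous_map T euclideanreal (\<lambda>z. f z u)"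
  shows "continuous_map T (realization X) f"
  unfolding continuous_map_def
proof (intro conjI allI impI)
  show "f \<in> topspace T \<rightarrow> topspace (realization X)" using pts by auto
  fix U assume U: "openin (realization X) U"
  have cf: "continuous_map T (euclidean :: ('a \<Rightarrow> real) topology) f"
    unfolding euclidean_product_topology[symmetric]
    using cont by (simp add: continuous_map_componentwise_UNIV)
  have closed: "closedin T {z \<in> topspace T. f z \<in> closed_cell X \<sigma> - U}" if s: "\<sigma> \<in> X" for \<sigma>
  proof -
    have "openin (top_of_set (closed_cell X \<sigma>)) (U \<inter> closed_cell X \<sigma>)"
      using U s by (simp add: openin_realization)
    moreover have "closed_cell X \<sigma> - (closed_cell X \<sigma> - U) = U \<inter> closed_cell X \<sigma>" by blast
    ultimately have "closedin (top_of_set (closed_cell X \<sigma>)) (closed_cell X \<sigma> - U)"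
      unfolding closedin_def topspace_euclidean_subtopology by (simp only: Diff_subset)
    then obtain C where C: "closed C" "closed_cell X \<sigma> - U = closed_cell X \<sigma> \<inter> C"
      using closedin_closed by metis
    have "closedin T {z \<in> topspace T. f z \<in> C}"
      using closedin_continuous_map_preimage[OF cf, of C] C(1) by simp
    moreover have cl0: "closedin T {z \<in> topspace T. f z u \<in> {0}}" for u
      using closedin_continuous_map_preimage[OF cont[of u], of "{0}"] by simp
    \<comment> \<open>Lying in the cell is itself a closed condition, namely that the coordinates in
      \<open>F - \<sigma>\<close> vanish. The factor \<open>topspace T\<close> gives the right value
      when there is no such coordinate.\<close>
    have "closedin T (topspace T \<inter> (\<Inter>u\<in>F - \<sigma>. {z \<in> topspace T. f z u \<in> {0}}))"
    proof (cases "F - \<sigma> = {}")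
      case False
      then show ?thesis using cl0
        by (intro closedin_Int closedin_topspace closedin_Inter) auto
    next
      case True
      show ?thesis unfolding True by simp
    qed
    ultimately have "closedin T (topspace T \<inter> (\<Inter>u\<in>F - \<sigma>. {z \<in> topspace T. f z u \<in> {0}}) \<inter>
        {z \<in> topspace T. f z \<in> C})" by blast
    moreover have "topspace T \<inter> (\<Inter>u\<in>F - \<sigma>. {z \<in> topspace T. f z u \<in> {0}}) \<inter> {z \<in> topspace T. f z \<in> C} =
        {z \<in> topspace T. f z \<in> closed_cell X \<sigma> \<inter> C}"
      using pts supp unfolding closed_cell_def by blast
    ultimately show ?thesis using C(2) by simp
  qed
  have "finite (Pow F \<inter> X)" using assms(1) by simp
  then have "closedin T (\<Union>\<sigma>\<in>Pow F \<inter> X. {z \<in> topspace T. f z \<in> closed_cell X \<sigma> - U})"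
    using closed by (intro closedin_Union) auto
  moreover have "(\<Union>\<sigma>\<in>Pow F \<inter> X. {z \<in> topspace T. f z \<in> closed_cell X \<sigma> - U}) =
      topspace T - {z \<in> topspace T. f z \<in> U}"
  proof -
    have "\<exists>\<sigma>\<in>Pow F \<inter> X. f z \<in> closed_cell X \<sigma>" if "z \<in> topspace T" for z
    proof
      show "{v. f z v \<noteq> 0} \<in> Pow F \<inter> X" using pts[OF that] supp[OF that] by (auto simp: realization_points_def)
      show "f z \<in> closed_cell X {v. f z v \<noteq> 0}" using pts[OF that] by (auto simp: closed_cell_def)
    qed
    then show ?thesis by blast
  qed
  ultimately have "closedin T (topspace T - {z \<in> topspace T. f z \<in> U})" by simp
  then show "openin T {z \<in> topspace T. f z \<in> U}" by (auto simp: openin_closedin)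
qed

section \<open>Compact subsets of the realization\<close>

lemma finite_functions_closed:
  assumes "finite (Q :: ('a \<Rightarrow> real) set)" shows "closed Q"
proof -
  have "closed {q}" for q :: "'a \<Rightarrow> real"
  proof -
    have "closed (\<Inter>u. {p. p u = q u})"
      by (intro closed_INT ballI closed_Collect_eq continuous_on_product_coordinates continuous_intros)
    moreover have "(\<Inter>u. {p. p u = q u}) = {q}" by auto
    ultimately show ?thesis by simp
  qed
  then have "closed (\<Union>q\<in>Q. {q})" using assms by (intro closed_UN) auto
  then show ?thesis by simp
qed

text \<open>Choose for each vertex in a support a point of \<open>K\<close> with nonzero coordinate
  there. A cell contains only finitely many chosen points, so every set of chosen points is closed.
  As each point has finite support, infinitely many vertices would give an infinite closed discrete
  subset of a compact set.\<close>

lemma compactin_realization_finite_support: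
  assumes X: "abstract_simplicial_complex X" and K: "compactin (realization X) K"
  shows "finite (\<Union>p\<in>K. {v. p v \<noteq> 0})"
proof (rule ccontr)
  assume inf: "infinite (\<Union>p\<in>K. {v. p v \<noteq> 0})"
  have KR: "K \<subseteq> realization_points X" using compactin_subset_topspace[OF K] by simp
  define F where "F = (\<Union>p\<in>K. {v. p v \<noteq> 0})"
  have "\<exists>p\<in>K. p v \<noteq> 0" if "v \<in> F" for v using that by (auto simp: F_def)
  then obtain pt where pt: "\<And>v. v \<in> F \<Longrightarrow> pt v \<in> K \<and> pt v v \<noteq> 0" by metis
  define P where "P = pt ` F"
  have fs: "finite {v. p v \<noteq> 0}" if "p \<in> K" for p
    using that KR X by (auto simp: realization_points_def abstract_simplicial_complex_def)
  have PK: "P \<subseteq> K" using pt by (auto simp: P_def)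
  have infP: "infinite P"
  proof
    assume "finite P"
    then have "finite (\<Union>p\<in>P. {v. p v \<noteq> 0})" using fs PK by blast
    moreover have "F \<subseteq> (\<Union>p\<in>P. {v. p v \<noteq> 0})" using pt by (auto simp: P_def)
    ultimately show False using inf F_def finite_subset by blast
  qed
  have op: "openin (realization X) (realization_points X - Q)" if Q: "Q \<subseteq> P" for Q
    unfolding openin_realization
  proof (intro conjI ballI)
    fix \<sigma> assume s: "\<sigma> \<in> X"
    have "Q \<inter> closed_cell X \<sigma> \<subseteq> pt ` \<sigma>"
    proof
      fix p assume p: "p \<in> Q \<inter> closed_cell X \<sigma>"
      then obtain v where v: "v \<in> F" "p = pt v" using Q P_def by auto
      then have "v \<in> \<sigma>" using p pt by (auto simp: closed_cell_def)
      then show "p \<in> pt ` \<sigma>" using v by simp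
    qed
    moreover have "finite (pt ` \<sigma>)" using s X by (simp add: abstract_simplicial_complex_def)
    ultimately have "closed (Q \<inter> closed_cell X \<sigma>)" 
      using finite_subset finite_functions_closed by blast
    then have "openin (top_of_set (closed_cell X \<sigma>)) (closed_cell X \<sigma> \<inter> - (Q \<inter> closed_cell X \<sigma>))"
      by (intro openin_open_Int open_Compl)
    moreover have "closed_cell X \<sigma> \<inter> - (Q \<inter> closed_cell X \<sigma>) = (realization_points X - Q) \<inter> closed_cell X \<sigma>"
      by (auto simp: closed_cell_def)
    ultimately show "openin (top_of_set (closed_cell X \<sigma>)) ((realization_points X - Q) \<inter> closed_cell X \<sigma>)" by simp
  qed auto
  \<comment> \<open>Each member of this cover contains exactly one point of \<open>P\<close>, so a
    finite subcover would make \<open>P\<close> finite.\<close>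
  define \<U> where "\<U> = (\<lambda>q. realization_points X - (P - {q})) ` P"
  have "P \<noteq> {}" using infP by auto
  have "K \<subseteq> \<Union>\<U>"
  proof
    fix p assume p: "p \<in> K"
    show "p \<in> \<Union>\<U>"
    proof (cases "p \<in> P")
      case True
      then show ?thesis using p KR by (auto simp: \<U>_def)
    next
      case False
      then show ?thesis using p KR \<open>P \<noteq> {}\<close> by (auto simp: \<U>_def)
    qed
  qed
  moreover have "\<forall>U\<in>\<U>. openin (realization X) U" unfolding \<U>_def using op by auto
  ultimately obtain \<F> where F: "finite \<F>" "\<F> \<subseteq> \<U>" "K \<subseteq> \<Union>\<F>"
    using K unfolding compactin_def by meson
  then obtain Q where Q: "finite Q" "Q \<subseteq> P" "\<F> = (\<lambda>q. realization_points X - (P - {q})) ` Q"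
    unfolding \<U>_def by (meson finite_subset_image)
  have "P \<subseteq> Q"
  proof
    fix x assume x: "x \<in> P"
    then obtain q where "q \<in> Q" "x \<in> realization_points X - (P - {q})" using F(3) PK Q(3) by blast
    then show "x \<in> Q" using x by blast
  qed
  then show False using Q(1) infP finite_subset by blast
qed

text \<open>Polar coordinates with the radius reversed: s = 0 is the unit circle and s = 1 is the centre.\<close>

definition unit_polar :: "real \<times> real \<Rightarrow> complex" where
  "unit_polar = (\<lambda>(s, t). of_real (1 - s) * exp (2 * pi * \<i> * of_real t))"

lemma unit_polar_norm: "s \<le> 1 \<Longrightarrow> norm (unit_polar (s, t)) = 1 - s"
  unfolding unit_polar_def by (simp add: norm_mult del: of_real_diff)

lemma unit_polar_continuous: "continuous_on S unit_polar"
  unfolding unit_polar_def case_prod_unfold by (intro continuous_intros)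

lemma unit_polar_eq:
  assumes "s \<in> {0..1}" "t \<in> {0..1}" "s' \<in> {0..1}" "t' \<in> {0..1}" "unit_polar (s, t) = unit_polar (s', t')"
  shows "s = s' \<and> (s = 1 \<or> t = t' \<or> {t, t'} = {0, 1})"
proof -
  have s: "s = s'" using unit_polar_norm[of s t] unit_polar_norm[of s' t'] assms by simp
  have "t = t' \<or> {t, t'} = {0, 1}" if "s \<noteq> 1"
  proof -
    have "exp (2 * pi * \<i> * of_real t) = exp (2 * pi * \<i> * of_real t')"
      using assms(5) s that by (simp add: unit_polar_def)
    then obtain n :: int where "2 * pi * \<i> * of_real t = 2 * pi * \<i> * of_real t' + (2 * of_int n * pi) * \<i>"
      unfolding exp_eq by auto
    then have "2 * pi * t = 2 * pi * t' + 2 * n * pi"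
      by (auto simp: complex_eq_iff)
    then have "2 * pi * (t - t' - n) = 0" by (simp add: algebra_simps)
    then have n: "t - t' = n" by simp
    then have "- 1 \<le> n" "n \<le> 1" using assms(2,4) by auto
    then consider "n = 0" | "n = 1" | "n = - 1" by linarith
    then show ?thesis
    proof cases
      case 2
      then have "t = 1" "t' = 0" using n assms(2,4) by auto
      then show ?thesis by auto
    next
      case 3
      then have "t = 0" "t' = 1" using n assms(2,4) by auto
      then show ?thesis by auto
    qed (use n in auto)
  qed
  then show ?thesis using s by blast
qed

lemma unit_polar_surj:
  assumes "norm z \<le> 1" obtains t where "t \<in> {0..1}" "z = unit_polar (1 - norm z, t)"
proof
  show "Arg2pi z / (2 * pi) \<in> {0..1}"
    using Arg2pi[of z] by (auto simp: field_simps intro: less_imp_le)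
  show "z = unit_polar (1 - norm z, Arg2pi z / (2 * pi))"
    using Arg2pi_eq[of z] by (simp add: unit_polar_def mult.commute)
qed

text \<open>A continuous surjection from a compact space onto a Hausdorff space is a quotient map.
  Maps on the disc can therefore be defined on the square, provided that they respect the
  identifications described by \<open>unit_polar_eq\<close>.\<close>

lemma quotient_map_unit_polar:
  "quotient_map (top_of_set ({0..1} \<times> {0..1})) (top_of_set (cball 0 1)) unit_polar"
proof (rule T1_Spaces.continuous_imp_quotient_map)
  show "continuous_map (top_of_set ({0..1} \<times> {0..1})) (top_of_set (cball 0 1)) unit_polar"
    using unit_polar_continuous by (auto simp: unit_polar_norm)
  show "compact_space (top_of_set ({0..1::real} \<times> {0..1::real}))"
    by (simp add: compact_space_subtopology compact_Times)
  show "Hausdorff_space (top_of_set (cball (0::complex) 1))"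
    by (simp add: Hausdorff_space_subtopology)
  show "unit_polar ` topspace (top_of_set ({0..1} \<times> {0..1})) = topspace (top_of_set (cball 0 1))"
  proof -
    have "z \<in> unit_polar ` ({0..1} \<times> {0..1})" if "norm z \<le> 1" for z
    proof -
      obtain t where t: "t \<in> {0..1}" "z = unit_polar (1 - norm z, t)" using unit_polar_surj[OF \<open>norm z \<le> 1\<close>] .
      have "(1 - norm z, t) \<in> {0..1} \<times> {0..1}" using t(1) that by simp
      then show ?thesis using t(2) by (rule rev_image_eqI)
    qed
    then show ?thesis by (auto simp: unit_polar_norm)
  qed
qed

lemma quotient_map_unit_circle:
  "quotient_map (top_of_set {0..1}) (top_of_set (sphere 0 1)) (\<lambda>t. unit_polar (0, t))"
proof (rule T1_Spaces.continuous_imp_quotient_map)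
  have "continuous_on {0..1} (\<lambda>t. unit_polar (0, t))"
    unfolding unit_polar_def case_prod_conv by (intro continuous_intros)
  then show "continuous_map (top_of_set {0..1}) (top_of_set (sphere 0 1)) (\<lambda>t. unit_polar (0, t))"
    by (auto simp: unit_polar_norm)
  show "Hausdorff_space (top_of_set (sphere (0::complex) 1))"
    by (simp add: Hausdorff_space_subtopology)
  show "(\<lambda>t. unit_polar (0, t)) ` topspace (top_of_set {0..1}) = topspace (top_of_set (sphere 0 1))"
  proof -
    have "z \<in> (\<lambda>t. unit_polar (0, t)) ` {0..1}" if "norm z = 1" for z
    proof -
      have "norm z \<le> 1" using that by simp
      then obtain t where t: "t \<in> {0..1}" "z = unit_polar (1 - norm z, t)" by (rule unit_polar_surj)
      then show ?thesis unfolding that by (simp add: rev_image_eqI)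
    qed
    then show ?thesis by (auto simp: unit_polar_norm)
  qed
qed (simp add: compact_space_subtopology)

text \<open>Time in the homotopy is read as the reversed radius. That the final map is constant is
  what makes the extension well defined at the centre.\<close>

lemma nullhomotopic_circle_extends:
  assumes "homotopic_with (\<lambda>_. True) (top_of_set (sphere (0::complex) 1)) T f (\<lambda>_. c)"
  shows "\<exists>g. continuous_map (top_of_set (cball (0::complex) 1)) T g \<and> (\<forall>z\<in>sphere 0 1. g z = f z)"
proof -
  obtain h where h: "continuous_map (prod_topology (top_of_set {0..1::real}) (top_of_set (sphere (0::complex) 1))) T h"
    and h0: "\<And>z. h (0, z) = f z" and h1: "\<And>z. h (1, z) = c"
    using assms unfolding homotopic_with_def by auto
  define k where "k = (\<lambda>(s, t). h (s, unit_polar (0, t)))"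
  have "continuous_map (top_of_set ({0..1} \<times> {0..1}))
      (prod_topology (top_of_set {0..1::real}) (top_of_set (sphere (0::complex) 1)))
      (\<lambda>x. (fst x, unit_polar (0, snd x)))"
  proof -
    have "continuous_on ({0..1} \<times> {0..1}) (\<lambda>x. (fst x, unit_polar (0, snd x)))"
      unfolding unit_polar_def case_prod_conv by (intro continuous_intros)
    then show ?thesis
      by (auto simp: unit_polar_norm subtopology_Times[symmetric] euclidean_product_topology
          prod_topology_subtopology_eu)
  qed
  from continuous_map_compose[OF this h]
  have "continuous_map (top_of_set ({0..1} \<times> {0..1})) T k"
    by (simp add: k_def o_def case_prod_unfold)
  moreover have "k x = k y" if xy: "x \<in> topspace (top_of_set ({0..1} \<times> {0..1}))"
      "y \<in> topspace (top_of_set ({0..1} \<times> {0..1}))" "unit_polar x = unit_polar y" for x y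
  proof -
    obtain s t s' t' where st: "x = (s, t)" "y = (s', t')" by (cases x, cases y)
    have "unit_polar (0, 0) = unit_polar (0, 1)" by (simp add: unit_polar_def)
    then have e: "k (s, 0) = k (s, 1)" by (simp add: k_def)
    have "k (1, t) = k (1, t')" by (simp add: k_def h1)
    then show ?thesis
      using unit_polar_eq[of s t s' t'] xy e unfolding st by (auto simp: doubleton_eq_iff)
  qed
  ultimately obtain g where g: "continuous_map (top_of_set (cball 0 1)) T g"
    "g ` topspace (top_of_set (cball 0 1)) = k ` topspace (top_of_set ({0..1} \<times> {0..1}))"
    "\<And>x. x \<in> topspace (top_of_set ({0..1} \<times> {0..1})) \<Longrightarrow> g (unit_polar x) = k x"
    using quotient_map_lift_exists[OF quotient_map_unit_polar, of T k] by metis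
  have "g z = f z" if "z \<in> sphere 0 1" for z
  proof -
    have n: "norm z = 1" using that by simp
    then have "norm z \<le> 1" by simp
    then obtain t where t: "t \<in> {0..1}" "z = unit_polar (1 - norm z, t)" by (rule unit_polar_surj)
    then have "z = unit_polar (0, t)" by (simp only: n cancel_comm_monoid_add_class.diff_cancel)
    with t(1) show ?thesis using g(3)[of "(0, t)"] by (simp add: k_def h0)
  qed
  then show ?thesis using g(1) by blast
qed

section \<open>Contracting loops\<close>

locale flag_complex =
  fixes X :: "'a set set"
  assumes asc: "abstract_simplicial_complex X"
    and flg: "flag X"
    and conX: "connected_graph (vertices X) (edges X)"

sublocale flag_complex \<subseteq> conn_graph "vertices X" "edges X"
  by unfold_locales (rule conX)

context flag_complex
begin

lemma face: "\<sigma> \<in> X \<Longrightarrow> \<tau> \<subseteq> \<sigma> \<Longrightarrow> \<tau> \<noteq> {} \<Longrightarrow> \<tau> \<in> X"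
  using bspec[OF asc[unfolded abstract_simplicial_complex_def], THEN conjunct2, THEN conjunct2,
      THEN spec, THEN mp, OF _ conjI] .

lemma simplex_iff:
  "A \<in> X \<longleftrightarrow> A \<noteq> {} \<and> A \<subseteq> vertices X \<and> (\<forall>u\<in>A. \<forall>v\<in>A. u \<noteq> v \<longrightarrow> (u, v) \<in> edges X)"
proof
  assume A: "A \<in> X"
  have pair: "{u, v} \<in> X" if "u \<in> A" "v \<in> A" for u v
  proof -
    have "{u, v} \<subseteq> A" "{u, v} \<noteq> {}" using that by auto
    then show ?thesis by (rule face[OF A])
  qed
  then show "A \<noteq> {} \<and> A \<subseteq> vertices X \<and> (\<forall>u\<in>A. \<forall>v\<in>A. u \<noteq> v \<longrightarrow> (u, v) \<in> edges X)"
  proof (intro conjI ballI impI)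
    show "A \<noteq> {}" using A asc unfolding abstract_simplicial_complex_def by simp
    show "A \<subseteq> vertices X" using A unfolding vertices_def by blast
    fix u v assume "u \<in> A" "v \<in> A" "u \<noteq> v"
    then show "(u, v) \<in> edges X" using pair by (simp add: edges_def)
  qed
next
  assume A: "A \<noteq> {} \<and> A \<subseteq> vertices X \<and> (\<forall>u\<in>A. \<forall>v\<in>A. u \<noteq> v \<longrightarrow> (u, v) \<in> edges X)"
  have "\<exists>\<sigma>\<in>X. u \<in> \<sigma> \<and> v \<in> \<sigma>" if uv: "u \<in> A" "v \<in> A" for u v
  proof (cases "u = v")
    case True
    then have "v \<in> \<Union>X" using A uv unfolding vertices_def by blast
    then show ?thesis using True by blast
  next
    case False
    then have "{u, v} \<in> X" using A uv by (auto simp: edges_def)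
    then show ?thesis by blast
  qed
  then obtain \<sigma> where "\<sigma> \<in> X" "A \<subseteq> \<sigma>" using flg A unfolding flag_def by meson
  then show "A \<in> X" using face[of \<sigma> A] conjunct1[OF A] by blast
qed

lemma simplexD:
  assumes "A \<in> X"
  shows "A \<noteq> {}" "A \<subseteq> vertices X" "u \<in> A \<Longrightarrow> v \<in> A \<Longrightarrow> u \<noteq> v \<Longrightarrow> (u, v) \<in> edges X"
  using assms simplex_iff[of A] by metis+

lemma simplex_finite: "A \<in> X \<Longrightarrow> finite A"
  using asc by (auto simp: abstract_simplicial_complex_def)

lemma vertices_nonempty: "vertices X \<noteq> {}"
proof -
  have "\<exists>\<sigma>\<in>X. {} \<subseteq> \<sigma>" using flg unfolding flag_def by blast
  then obtain \<sigma> where "\<sigma> \<in> X" by blast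
  then have "\<sigma> \<noteq> {}" "\<sigma> \<subseteq> vertices X" using simplexD by auto
  then show ?thesis by blast
qed

text \<open>The realization of the full subcomplex on \<open>F\<close>: the support of each point is
  a simplex, but \<open>F\<close> itself need not be one.\<close>

definition supported :: "'a set \<Rightarrow> ('a \<Rightarrow> real) set" where
  "supported F = {p \<in> realization_points X. \<forall>u. p u \<noteq> 0 \<longrightarrow> u \<in> F}"

lemma supportedD:
  assumes "p \<in> supported F" "finite F"
  shows "0 \<le> p u" "p u \<noteq> 0 \<Longrightarrow> u \<in> F" "sum p F = 1" "{v. p v \<noteq> 0} \<in> X" "p u \<le> 1"
proof -
  have p: "\<And>u. 0 \<le> p u" "{v. p v \<noteq> 0} \<in> X" "(\<Sum>v\<in>{v. p v \<noteq> 0}. p v) = 1" "\<And>u. p u \<noteq> 0 \<Longrightarrow> u \<in> F"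
    using assms(1) by (auto simp: supported_def realization_points_def)
  show "0 \<le> p u" "p u \<noteq> 0 \<Longrightarrow> u \<in> F" "{v. p v \<noteq> 0} \<in> X" using p by auto
  have "(\<Sum>v\<in>{v. p v \<noteq> 0}. p v) = sum p F"
    by (rule sum.mono_neutral_left) (use assms(2) p(4) in auto)
  then show s: "sum p F = 1" using p(3) by simp
  show "p u \<le> 1"
  proof (cases "u \<in> F")
    case True
    then have "p u \<le> sum p F" using assms(2) p(1) by (simp add: member_le_sum)
    then show ?thesis using s by simp
  next
    case False
    then have "p u = 0" using p(4)[of u] by blast
    then show ?thesis by simp
  qed
qed

lemma normalised_supported:
  assumes "finite F" and pos: "\<And>u. 0 \<le> W u" and supp: "\<And>u. W u \<noteq> 0 \<Longrightarrow> u \<in> F" and X: "{u. W u \<noteq> 0} \<in> X"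
  shows "0 < sum W F" and "(\<lambda>u. W u / sum W F) \<in> supported F"
proof -
  obtain u where u: "W u \<noteq> 0" using simplexD(1)[OF X] by blast
  then have "0 < W u" using pos[of u] by simp
  also have "W u \<le> sum W F" using assms(1) supp[OF u] pos by (simp add: member_le_sum)
  finally show p: "0 < sum W F" .
  have "(\<Sum>v | W v / sum W F \<noteq> 0. W v / sum W F) = (\<Sum>v\<in>F. W v / sum W F)"
    by (rule sum.mono_neutral_left) (use assms(1) supp in auto)
  also have "\<dots> = 1" using p by (simp flip: sum_divide_distrib)
  finally show "(\<lambda>u. W u / sum W F) \<in> supported F"
    using p pos X supp by (auto simp: supported_def realization_points_def)
qed

text \<open>The mass is positive exactly if \<open>\<sigma>\<close> is a superlevel set of p on U whose layer starts below s.
  Only its sign and continuity matter, since the weights are normalised afterwards; this is why a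
  product replaces the actual thickness of the layer.\<close>

definition dmass :: "'a set \<Rightarrow> real \<Rightarrow> ('a \<Rightarrow> real) \<Rightarrow> 'a set \<Rightarrow> real" where
  "dmass U s p \<sigma> = (\<Prod>w\<in>\<sigma>. max 0 (min s (p w))) * (\<Prod>w\<in>\<sigma>. \<Prod>w'\<in>U - \<sigma>. max 0 (min s (p w) - p w'))"

text \<open>At time \<open>s\<close> inner vertices keep their coordinates and each outer vertex
  keeps its excess over \<open>s\<close>; the layers below \<open>s\<close> are represented by
  positive masses on the chosen lower neighbours \<open>c \<sigma>\<close>. A vertex may be chosen
  for several \<sigma> and may also lie in \<open>L\<close>, hence a sum.\<close>

definition dweight :: "'a set \<Rightarrow> 'a set \<Rightarrow> ('a set \<Rightarrow> 'a) \<Rightarrow> real \<Rightarrow> ('a \<Rightarrow> real) \<Rightarrow> 'a \<Rightarrow> real" where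
  "dweight L U c s p u = (if u \<in> L then p u else 0) + (if u \<in> U then max 0 (p u - s) else 0) +
     (\<Sum>\<sigma>\<in>Pow U \<inter> X. if c \<sigma> = u then dmass U s p \<sigma> else 0)"

lemma dmass_nonneg: "0 \<le> dmass U s p \<sigma>"
  unfolding dmass_def by (intro mult_nonneg_nonneg prod_nonneg) auto

lemma dmass_nonzero:
  assumes "dmass U s p \<sigma> \<noteq> 0" "finite U" "\<sigma> \<subseteq> U" "w \<in> \<sigma>"
  shows "0 < s" "0 < p w" "w' \<in> U - \<sigma> \<Longrightarrow> p w' < p w \<and> p w' < s"
proof -
  have fin: "finite \<sigma>" "finite (U - \<sigma>)" using assms finite_subset by auto
  have "max 0 (min s (p w)) \<noteq> 0"
  proof
    assume "max 0 (min s (p w)) = 0"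
    then have "(\<Prod>w\<in>\<sigma>. max 0 (min s (p w))) = 0" using fin assms(4) by (intro prod_zero) auto
    then show False using assms(1) by (simp add: dmass_def)
  qed
  then show "0 < s" "0 < p w" by (auto simp: max_def min_def split: if_splits)
  assume "w' \<in> U - \<sigma>"
  have "max 0 (min s (p w) - p w') \<noteq> 0"
  proof
    assume "max 0 (min s (p w) - p w') = 0"
    then have "(\<Prod>w'\<in>U - \<sigma>. max 0 (min s (p w) - p w')) = 0"
      using fin \<open>w' \<in> U - \<sigma>\<close> by (intro prod_zero) auto
    then have "(\<Prod>w\<in>\<sigma>. \<Prod>w'\<in>U - \<sigma>. max 0 (min s (p w) - p w')) = 0"
      using fin assms(4) by (intro prod_zero) auto
    then show False using assms(1) by (simp add: dmass_def)
  qed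
  then show "p w' < p w \<and> p w' < s" by (auto simp: max_def min_def split: if_splits)
qed

lemma dmass_positive:
  assumes "finite U" "\<sigma> \<subseteq> U" "0 < s" "\<And>w. w \<in> \<sigma> \<Longrightarrow> 0 < p w"
    "\<And>w w'. w \<in> \<sigma> \<Longrightarrow> w' \<in> U - \<sigma> \<Longrightarrow> p w' < p w \<and> p w' < s"
  shows "0 < dmass U s p \<sigma>"
proof -
  have "0 < max 0 (min s (p w))" if "w \<in> \<sigma>" for w
    using assms(3) assms(4)[OF that] by simp
  moreover have "0 < max 0 (min s (p w) - p w')" if "w \<in> \<sigma>" "w' \<in> U - \<sigma>" for w w'
    using assms(5)[OF that] by simp
  ultimately show ?thesis unfolding dmass_def by (intro mult_pos_pos prod_pos)
qed

text \<open>What needs proof is that the support of the moved point is again a nonempty simplex. Any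
  two of its vertices were both in the old support, or one of them is some \<open>c \<sigma>\<close>
  with positive mass; then either the other lies in \<sigma>, or both are lower neighbours of one
  outer vertex and (V) applies.\<close>

lemma deformation:
  assumes v: "v \<in> vertices X" and VC: "Vcond v"
    and F: "finite F" "F \<subseteq> vertices X" "\<And>u. u \<in> F \<Longrightarrow> d v u \<le> Suc n"
    and L: "L = {u \<in> F. d v u \<le> n}" and U: "U = {u \<in> F. d v u = Suc n}"
    and c: "\<And>\<sigma>. \<sigma> \<in> Pow U \<inter> X \<Longrightarrow> d v (c \<sigma>) = n \<and> (\<forall>w\<in>\<sigma>. (c \<sigma>, w) \<in> edges X)"
    and p: "p \<in> supported F" and s: "0 \<le> s" "s \<le> 1"
  shows "0 < sum (dweight L U c s p) (F \<union> c ` (Pow U \<inter> X))"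
    and "(\<lambda>u. dweight L U c s p u / sum (dweight L U c s p) (F \<union> c ` (Pow U \<inter> X))) \<in> supported (F \<union> c ` (Pow U \<inter> X))"
    and "s = 0 \<Longrightarrow> dweight L U c s p u / sum (dweight L U c s p) (F \<union> c ` (Pow U \<inter> X)) = p u"
    and "s = 1 \<Longrightarrow> dweight L U c s p u \<noteq> 0 \<Longrightarrow> u \<in> L \<union> c ` (Pow U \<inter> X)"
proof -
  let ?S = "Pow U \<inter> X" and ?W = "dweight L U c s p"
  define F' where "F' = F \<union> c ` ?S"
  have finU: "finite U" and finL: "finite L" using F L U by auto
  have finS: "finite ?S" using finU by simp
  have finF': "finite F'" using F finS by (simp add: F'_def)
  have LU: "F = L \<union> U" "L \<inter> U = {}" using F(3) L U by (auto simp: le_Suc_eq)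
  note p' = supportedD[OF p F(1)]
  have nn: "0 \<le> (\<Sum>\<sigma>\<in>?S. if c \<sigma> = u then dmass U s p \<sigma> else 0)" for u
    by (intro sum_nonneg) (simp add: dmass_nonneg)
  have pos: "0 \<le> ?W u" for u
    unfolding dweight_def using p'(1) nn[of u] by auto
  have suppW: "u \<in> L \<and> p u \<noteq> 0 \<or> u \<in> U \<and> s < p u \<or> (\<exists>\<sigma>\<in>?S. c \<sigma> = u \<and> dmass U s p \<sigma> \<noteq> 0)"
    if W: "?W u \<noteq> 0" for u
  proof (rule ccontr)
    assume n: "\<not> ?thesis"
    have "(\<Sum>\<sigma>\<in>?S. if c \<sigma> = u then dmass U s p \<sigma> else 0) = 0"
      by (rule sum.neutral) (use n in auto)
    then show False using n W unfolding dweight_def by (auto split: if_splits)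
  qed
  have ge: "dmass U s p \<sigma> \<le> ?W (c \<sigma>)" if sg: "\<sigma> \<in> ?S" for \<sigma>
  proof -
    have "(if c \<sigma> = c \<sigma> then dmass U s p \<sigma> else 0) \<le> (\<Sum>\<tau>\<in>?S. if c \<tau> = c \<sigma> then dmass U s p \<tau> else 0)"
      by (rule member_le_sum[OF sg]) (use finS dmass_nonneg in auto)
    then show ?thesis unfolding dweight_def using p'(1)[of "c \<sigma>"] by auto
  qed
  have adjX: "(u, w) \<in> edges X" if "p u \<noteq> 0" "p w \<noteq> 0" "u \<noteq> w" for u w
    using simplexD(3)[OF p'(4)] that by blast
  have nonempty: "{u. ?W u \<noteq> 0} \<noteq> {}"
  proof (cases "\<exists>u\<in>F. (u \<in> L \<and> p u \<noteq> 0) \<or> (u \<in> U \<and> s < p u)")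
    case True
    then obtain u where u: "u \<in> L \<and> 0 < p u \<or> u \<in> U \<and> s < p u" using p'(1) by (metis order_le_less)
    have "0 < ?W u"
      unfolding dweight_def using p'(1)[of u] nn[of u] u by auto
    then show ?thesis by (metis (mono_tags) empty_iff less_irrefl mem_Collect_eq)
  next
    case False
    obtain u where u: "p u \<noteq> 0" using simplexD(1)[OF p'(4)] by blast
    then have uU: "u \<in> U" using False LU p'(2) by blast
    \<comment> \<open>Nothing remains in \<open>L\<close> or above level \<open>s\<close>, so the
      maximum on \<open>U\<close> is at most \<open>s\<close>. The set where it is attained is a
      superlevel set with positive mass, which keeps the total weight positive.\<close>
    define m where "m = Max (p ` U)"
    define \<sigma> where "\<sigma> = {w \<in> U. p w = m}"
    have le: "p w \<le> m" if "w \<in> U" for w using that finU by (simp add: m_def)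
    have "m \<in> p ` U" unfolding m_def using finU uU by (intro Max_in) auto
    then obtain w0 where w0: "w0 \<in> U" "p w0 = m" by auto
    have m0: "0 < m" using le[OF uU] p'(1)[of u] u by simp
    have ms: "m \<le> s" using False w0 LU by force
    have "\<sigma> \<subseteq> {v. p v \<noteq> 0}" using m0 by (auto simp: \<sigma>_def)
    moreover have "\<sigma> \<noteq> {}" using w0 by (auto simp: \<sigma>_def)
    ultimately have "\<sigma> \<in> X" by (rule face[OF p'(4)])
    then have sg: "\<sigma> \<in> ?S" by (auto simp: \<sigma>_def)
    have "0 < dmass U s p \<sigma>"
    proof (rule dmass_positive[OF finU])
      fix w w' assume w: "w \<in> \<sigma>" "w' \<in> U - \<sigma>"
      then have "p w' < m" using le[of w'] by (auto simp: \<sigma>_def order_le_less)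
      then show "p w' < p w \<and> p w' < s" using w ms by (simp add: \<sigma>_def)
    qed (use m0 ms in \<open>auto simp: \<sigma>_def\<close>)
    then have "0 < ?W (c \<sigma>)" using ge[OF sg] by simp
    then show ?thesis by (metis (mono_tags) empty_iff less_irrefl mem_Collect_eq)
  qed
  have lower: "x = y \<or> (x, y) \<in> edges X"
    if "w \<in> U" "d v x \<le> n" "d v y \<le> n" "(x, w) \<in> edges X" "(y, w) \<in> edges X" for w x y
    using VcondD[OF VC that(4,5)] that U by simp
  have clique: "x = y \<or> (x, y) \<in> edges X" if x: "?W x \<noteq> 0" and y: "?W y \<noteq> 0" for x y
  proof -
    have "x = y \<or> (x, y) \<in> edges X"
      if \<sigma>: "\<sigma> \<in> ?S" "c \<sigma> = x" "dmass U s p \<sigma> \<noteq> 0" and y: "?W y \<noteq> 0" for \<sigma> x y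
    proof -
      have \<sigma>': "\<sigma> \<subseteq> U" "\<sigma> \<noteq> {}" using \<sigma>(1) simplexD(1) by auto
      note m = dmass_nonzero[OF \<sigma>(3) finU \<sigma>'(1)]
      have cs: "d v x \<le> n" "\<And>w. w \<in> \<sigma> \<Longrightarrow> (x, w) \<in> edges X" using c[OF \<sigma>(1)] \<sigma>(2) by auto
      obtain w where w: "w \<in> \<sigma>" using \<sigma>' by blast
      consider "y \<in> L" "p y \<noteq> 0" | "y \<in> U" "s < p y" | \<tau> where "\<tau> \<in> ?S" "c \<tau> = y" "dmass U s p \<tau> \<noteq> 0"
        using suppW[OF y] by blast
      then show ?thesis
      proof cases
        case 1
        have "w \<noteq> y" using 1 w \<sigma>' LU by auto
        then have "(y, w) \<in> edges X" using adjX[of y w] 1 m(2)[OF w] by auto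
        then show ?thesis using lower[of w x y] cs w 1 \<sigma>' L by auto
      next
        case 2
        \<comment> \<open>Outer vertices outside \<sigma> have coordinates below \<open>s\<close>,
          so an outer vertex that still keeps some weight belongs to \<sigma>.\<close>
        then have "y \<in> \<sigma>" using m(3)[OF w, of y] by force
        then show ?thesis using cs by blast
      next
        case 3
        have \<tau>': "\<tau> \<subseteq> U" "\<tau> \<noteq> {}" using 3(1) simplexD(1) by auto
        note m' = dmass_nonzero[OF 3(3) finU \<tau>'(1)]
        \<comment> \<open>Sets with positive mass are superlevel sets of the same point, hence
          nested. If they were disjoint, the coordinates of a vertex from each would be strictly
          ordered both ways.\<close>
        have "\<sigma> \<inter> \<tau> \<noteq> {}"
        proof
          assume e: "\<sigma> \<inter> \<tau> = {}"
          obtain w' where w': "w' \<in> \<tau>" using \<tau>' by blast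
          have "p w' < p w" using m(3)[OF w, of w'] w' e \<tau>' by blast
          moreover have "p w < p w'" using m'(3)[OF w', of w] w e \<sigma>' by blast
          ultimately show False by simp
        qed
        then obtain w' where w': "w' \<in> \<sigma>" "w' \<in> \<tau>" by blast
        then have "(y, w') \<in> edges X" "d v y \<le> n" using c[OF 3(1)] 3(2) by auto
        then show ?thesis using lower[of w' x y] cs w' \<sigma>' by blast
      qed
    qed note key = this
    show ?thesis
    proof (cases "p x \<noteq> 0 \<and> p y \<noteq> 0")
      case True
      then show ?thesis using adjX by blast
    next
      case False
      \<comment> \<open>A vertex outside the old support can carry weight only as the target of some
        layer.\<close>
      then consider \<sigma> where "\<sigma> \<in> ?S" "c \<sigma> = x" "dmass U s p \<sigma> \<noteq> 0" | \<sigma> where "\<sigma> \<in> ?S" "c \<sigma> = y" "dmass U s p \<sigma> \<noteq> 0"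
        using suppW[OF x] suppW[OF y] s(1) by force
      then show ?thesis
      proof cases
        case 1
        then show ?thesis using key y by blast
      next
        case 2
        then show ?thesis using key[OF 2 x] adj_sym by blast
      qed
    qed
  qed
  have suppF': "u \<in> F'" if "?W u \<noteq> 0" for u using suppW[OF that] LU by (auto simp: F'_def)
  have cV: "c \<sigma> \<in> vertices X" if "\<sigma> \<in> ?S" for \<sigma>
    using c[OF that] that simplexD(1)[of \<sigma>] adj_V by blast
  have F'V: "F' \<subseteq> vertices X" using F(2) cV by (auto simp: F'_def)
  have "{u. ?W u \<noteq> 0} \<in> X"
    unfolding simplex_iff using nonempty clique suppF' F'V by blast
  from normalised_supported[OF finF' pos suppF' this]
  show "0 < sum ?W (F \<union> c ` ?S)" "(\<lambda>u. ?W u / sum ?W (F \<union> c ` ?S)) \<in> supported (F \<union> c ` ?S)"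
    unfolding F'_def by auto
  show "?W u / sum ?W (F \<union> c ` ?S) = p u" if s0: "s = 0"
  proof -
    have dm: "dmass U s p \<sigma> = 0" if "\<sigma> \<in> ?S" for \<sigma>
    proof (rule ccontr)
      assume a: "dmass U s p \<sigma> \<noteq> 0"
      obtain w where "w \<in> \<sigma>" using \<open>\<sigma> \<in> ?S\<close> simplexD(1)[of \<sigma>] by blast
      then show False using dmass_nonzero(1)[OF a finU _, of w] that s0 by auto
    qed
    have W: "?W u = p u" for u
    proof -
      have "(\<Sum>\<sigma>\<in>?S. if c \<sigma> = u then dmass U s p \<sigma> else 0) = 0"
        by (rule sum.neutral) (use dm in auto)
      then show ?thesis
        unfolding dweight_def using s0 LU p'(1)[of u] p'(2)[of u] by (cases "p u = 0") auto
    qed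
    have "sum p (F \<union> c ` ?S) = sum p F"
      by (rule sum.mono_neutral_right) (use finF' p'(2) in \<open>auto simp: F'_def\<close>)
    then have "sum ?W (F \<union> c ` ?S) = 1" using p'(3) W by simp
    then show ?thesis using W by simp
  qed
  \<comment> \<open>Coordinates are at most 1, so at time 1 no outer vertex has an excess
    left.\<close>
  show "u \<in> L \<union> c ` ?S" if "s = 1" "?W u \<noteq> 0"
    using suppW[OF that(2)] that(1) p'(5)[of u] by auto
qed

text \<open>One step of the contraction. All supports during the homotopy lie in the finite set
  \<open>F'\<close>, so its continuity can be checked in each coordinate; positivity of the total
  weight makes the normalisation continuous. At the end only vertices of level at most
  \<open>n\<close> remain, and the set is still finite, so the step can be repeated.\<close>

lemma push_down:
  assumes VE: VE and v: "v \<in> vertices X"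
    and F: "finite F" "F \<subseteq> vertices X" "\<And>u. u \<in> F \<Longrightarrow> d v u \<le> Suc n"
    and f: "continuous_map T (realization X) f" "\<And>z. z \<in> topspace T \<Longrightarrow> f z \<in> supported F"
  shows "\<exists>F' g. finite F' \<and> F' \<subseteq> vertices X \<and> (\<forall>u\<in>F'. d v u \<le> n) \<and>
    (\<forall>z\<in>topspace T. g z \<in> supported F') \<and> homotopic_with (\<lambda>_. True) T (realization X) f g"
proof -
  have VC: "Vcond v" using VE v by (simp add: VE_def)
  define L where "L = {u \<in> F. d v u \<le> n}"
  define U where "U = {u \<in> F. d v u = Suc n}"
  have "\<exists>z. d v z = n \<and> (\<forall>w\<in>\<sigma>. (z, w) \<in> edges X)" if sg: "\<sigma> \<in> Pow U \<inter> X" for \<sigma>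
  proof (rule common_lower_neighbour[OF VE v])
    show "\<forall>x\<in>\<sigma>. x \<in> vertices X \<and> d v x = Suc n" using sg F(2) by (auto simp: U_def)
  qed (use sg simplexD simplex_finite in auto)
  then obtain c where c: "\<And>\<sigma>. \<sigma> \<in> Pow U \<inter> X \<Longrightarrow> d v (c \<sigma>) = n \<and> (\<forall>w\<in>\<sigma>. (c \<sigma>, w) \<in> edges X)"
    by metis
  define F' where "F' = F \<union> c ` (Pow U \<inter> X)"
  have finU: "finite U" using F by (simp add: U_def)
  have finF': "finite F'" using F finU by (simp add: F'_def)
  note D = deformation[OF v VC F L_def U_def c, folded F'_def]
  define H where "H = (\<lambda>(s, z) u. dweight L U c s (f z) u / sum (dweight L U c s (f z)) F')"
  let ?P = "prod_topology (top_of_set {0..1::real}) T"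
  have tz: "fst x \<in> {0..1}" "snd x \<in> topspace T" if "x \<in> topspace ?P" for x using that by auto
  have cf: "continuous_map ?P euclideanreal (\<lambda>x. f (snd x) u)" for u
    using continuous_map_compose[OF continuous_map_compose[OF continuous_map_snd f(1)]
        continuous_map_realization_coordinate] by (simp add: o_def)
  have cs: "continuous_map ?P euclideanreal fst"
    using continuous_map_fst continuous_map_in_subtopology by blast
  have cdm: "continuous_map ?P euclideanreal (\<lambda>x. dmass U (fst x) (f (snd x)) \<sigma>)"
    if "\<sigma> \<in> Pow U \<inter> X" for \<sigma>
  proof -
    have "finite \<sigma>" "finite (U - \<sigma>)" using that finU simplex_finite by auto
    then show ?thesis unfolding dmass_def by (intro continuous_intros cf cs) auto
  qed
  have cW: "continuous_map ?P euclideanreal (\<lambda>x. dweight L U c (fst x) (f (snd x)) u)" for u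
  proof -
    have "continuous_map ?P euclideanreal (\<lambda>x. if u \<in> L then f (snd x) u else 0)"
      using cf by (cases "u \<in> L") auto
    moreover have "continuous_map ?P euclideanreal (\<lambda>x. if u \<in> U then max 0 (f (snd x) u - fst x) else 0)"
      by (cases "u \<in> U") (auto intro!: continuous_intros cf cs)
    moreover have "continuous_map ?P euclideanreal (\<lambda>x. if c \<sigma> = u then dmass U (fst x) (f (snd x)) \<sigma> else 0)"
      if "\<sigma> \<in> Pow U \<inter> X" for \<sigma>
      using cdm[OF that] by (cases "c \<sigma> = u") auto
    then have "continuous_map ?P euclideanreal (\<lambda>x. \<Sum>\<sigma>\<in>Pow U \<inter> X. if c \<sigma> = u then dmass U (fst x) (f (snd x)) \<sigma> else 0)"
      using finU by (intro continuous_map_sum) auto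
    ultimately show ?thesis unfolding dweight_def by (intro continuous_map_add)
  qed
  have HF': "H x \<in> supported F'" if "x \<in> topspace ?P" for x
    using D(2)[OF _ _ f(2)[OF tz(2)[OF that]], of "fst x"] tz(1)[OF that]
    by (simp add: H_def case_prod_unfold)
  have contH: "continuous_map ?P (realization X) H"
  proof (rule continuous_map_into_realization[OF finF'])
    fix z assume z: "z \<in> topspace ?P"
    show "H z \<in> realization_points X" "\<And>u. H z u \<noteq> 0 \<Longrightarrow> u \<in> F'"
      using HF'[OF z] by (auto simp: supported_def)
  next
    fix u
    have "sum (dweight L U c (fst x) (f (snd x))) F' \<noteq> 0" if "x \<in> topspace ?P" for x
      using D(1)[OF _ _ f(2)[OF tz(2)[OF that]], of "fst x"] tz(1)[OF that] by auto
    then show "continuous_map ?P euclideanreal (\<lambda>z. H z u)"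
      unfolding H_def case_prod_unfold by (intro continuous_intros cW finF') auto
  qed
  define g where "g = (\<lambda>z. H (1, z))"
  have "homotopic_with (\<lambda>_. True) T (realization X) (\<lambda>z. H (0, z)) g"
    unfolding homotopic_with_def g_def using contH by auto
  then have hom: "homotopic_with (\<lambda>_. True) T (realization X) f g"
  proof (rule homotopic_with_eq)
    fix z assume "z \<in> topspace T"
    then show "f z = H (0, z)" using D(3)[OF _ _ f(2)] by (auto simp: H_def)
  qed auto
  define F1 where "F1 = L \<union> c ` (Pow U \<inter> X)"
  have "g z \<in> supported F1" if "z \<in> topspace T" for z
  proof -
    have "H (1, z) \<in> supported F'" using HF'[of "(1, z)"] that by simp
    moreover have "u \<in> F1" if "H (1, z) u \<noteq> 0" for u
      using D(4)[OF _ _ f(2)[OF \<open>z \<in> topspace T\<close>], of 1 u] that by (auto simp: H_def F1_def)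
    ultimately show ?thesis by (simp add: supported_def g_def)
  qed
  moreover have "finite F1" using F finU by (simp add: F1_def L_def)
  moreover have "\<forall>u\<in>F1. d v u \<le> n" using c by (auto simp: F1_def L_def)
  moreover have "F1 \<subseteq> vertices X"
  proof -
    have "c \<sigma> \<in> vertices X" if "\<sigma> \<in> Pow U \<inter> X" for \<sigma>
      using c[OF that] that simplexD(1)[of \<sigma>] adj_V by blast
    then show ?thesis using F(2) by (auto simp: F1_def L_def)
  qed
  ultimately show ?thesis using hom by blast
qed

section \<open>Contraction of maps with compact domain\<close>

definition vertex_point :: "'a \<Rightarrow> 'a \<Rightarrow> real" where
  "vertex_point v = (\<lambda>u. if u = v then 1 else 0)"

lemma null_homotopic:
  assumes VE: VE and v: "v \<in> vertices X"
    and "finite F" "F \<subseteq> vertices X" "\<And>u. u \<in> F \<Longrightarrow> d v u \<le> n"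
    and "continuous_map T (realization X) f" "\<And>z. z \<in> topspace T \<Longrightarrow> f z \<in> supported F"
  shows "homotopic_with (\<lambda>_. True) T (realization X) f (\<lambda>_. vertex_point v)"
  using assms(3-)
proof (induction n arbitrary: F f)
  case 0
  have "f z = vertex_point v" if z: "z \<in> topspace T" for z
  proof -
    note q = supportedD[OF "0.prems"(5)[OF z] "0.prems"(1)]
    have Fv: "F \<subseteq> {v}" using "0.prems"(2,3) dist_eq_0 v by auto
    have "F \<noteq> {}" using q(3) by auto
    then have "F = {v}" using Fv by auto
    then have "f z v = 1" using q(3) by simp
    moreover have "f z u = 0" if "u \<noteq> v" for u using q(2)[of u] that Fv by auto
    ultimately show ?thesis by (auto simp: vertex_point_def)
  qed
  then show ?case using "0.prems"(4) by (intro homotopic_with_equal) auto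
next
  case (Suc n)
  obtain F' g where g: "finite F'" "F' \<subseteq> vertices X" "\<forall>u\<in>F'. d v u \<le> n"
    "\<forall>z\<in>topspace T. g z \<in> supported F'" "homotopic_with (\<lambda>_. True) T (realization X) f g"
    using push_down[OF VE v Suc.prems] by blast
  have "continuous_map T (realization X) g" using g(5) homotopic_with_imp_continuous_maps by blast
  then have "homotopic_with (\<lambda>_. True) T (realization X) g (\<lambda>_. vertex_point v)"
    using Suc.IH[of F' g] g by blast
  then show ?case using g(5) homotopic_with_trans by blast
qed

text \<open>Compactness provides a finite support set and with it a largest level, which is the
  number of steps. A general domain is allowed because the result is applied to the circle and also
  to a single point.\<close>

lemma compact_null_homotopic:
  assumes VE: VE and v: "v \<in> vertices X"
    and T: "compact_space T" and f: "continuous_map T (realization X) f"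
  shows "homotopic_with (\<lambda>_. True) T (realization X) f (\<lambda>_. vertex_point v)"
proof -
  define F where "F = (\<Union>p\<in>f ` topspace T. {u. p u \<noteq> 0})"
  have "compactin (realization X) (f ` topspace T)"
    using T f by (simp add: compact_space_def image_compactin)
  then have fin: "finite F" unfolding F_def by (rule compactin_realization_finite_support[OF asc])
  have pts: "f z \<in> realization_points X" if "z \<in> topspace T" for z
    using continuous_map_image_subset_topspace[OF f] that by auto
  have supp: "f z \<in> supported F" if "z \<in> topspace T" for z
    using pts[OF that] that by (auto simp: supported_def F_def)
  have "{u. p u \<noteq> 0} \<subseteq> vertices X" if "p \<in> realization_points X" for p
    using that simplexD(2) by (auto simp: realization_points_def)
  then have "F \<subseteq> vertices X" using pts unfolding F_def by blast
  moreover have "d v u \<le> Max (d v ` F)" if "u \<in> F" for u using that fin by simp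
  ultimately show ?thesis using null_homotopic[OF VE v fin _ _ f supp] by blast
qed

lemma VE_simply_connected:
  assumes VE: VE shows "simply_connected_space (realization X)"
  unfolding simply_connected_space_def
proof (intro conjI allI impI)
  obtain v where v: "v \<in> vertices X" using vertices_nonempty by blast
  have "path_component_of (realization X) x (vertex_point v)" if "x \<in> topspace (realization X)" for x
  proof -
    \<comment> \<open>A homotopy between maps from a one-point space is a path between their
      values.\<close>
    have "homotopic_with (\<lambda>_. True) (top_of_set {0::real}) (realization X) (\<lambda>_. x) (\<lambda>_. vertex_point v)"
      by (rule compact_null_homotopic[OF VE v]) (use that in \<open>auto simp: compact_space_subtopology\<close>)
    then show ?thesis unfolding homotopic_constant_maps by (auto simp: null_topspace_iff_trivial[symmetric])
  qed
  then show "path_connected_space (realization X)"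
    unfolding path_connected_space_iff_path_component
    using path_component_of_sym path_component_of_trans by metis
  fix f assume "continuous_map (top_of_set (sphere (0::complex) 1)) (realization X) f"
  then have "homotopic_with (\<lambda>_. True) (top_of_set (sphere (0::complex) 1)) (realization X) f (\<lambda>_. vertex_point v)"
    by (intro compact_null_homotopic[OF VE v]) (auto simp: compact_space_subtopology)
  then show "\<exists>g. continuous_map (top_of_set (cball (0::complex) 1)) (realization X) g \<and> (\<forall>z\<in>sphere 0 1. g z = f z)"
    by (rule nullhomotopic_circle_extends)
qed

end

section \<open>The covering graph\<close>

context conn_graph
begin

lemma W5_hatD:
  assumes "W5_hat_condition V E"
    and e: "(x0, x1) \<in> E" "(x1, x2) \<in> E" "(x2, x3) \<in> E" "(x3, x4) \<in> E" "(x4, x0) \<in> E"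
    and ne: "(x0, x2) \<notin> E" "(x0, x3) \<notin> E" "(x1, x3) \<notin> E" "(x1, x4) \<notin> E" "(x2, x4) \<notin> E"
    and c: "(c, x0) \<in> E" "(c, x1) \<in> E" "(c, x2) \<in> E" "(c, x3) \<in> E" "(c, x4) \<in> E"
    and a: "(a, x0) \<in> E" "(a, x1) \<in> E" "(a, x2) \<notin> E" "(a, x3) \<notin> E" "(a, x4) \<notin> E" "(a, c) \<notin> E" "a \<noteq> c"
  shows "\<exists>y. \<forall>x\<in>{x0, x1, x2, x3, x4, c, a}. (y, x) \<in> E"
proof -
  define x where "x = (\<lambda>i. [x0, x1, x2, x3, x4] ! i)"
  have cyc: "induced_cycle V E 5 x" unfolding x_def by (rule induced_C5I[OF e ne])
  have img: "x ` {..<5} = {x0, x1, x2, x3, x4}"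
    unfolding x_def by (auto simp: numeral_eq_Suc lessThan_Suc)
  have cx: "\<forall>i<5. (c, x i) \<in> E" unfolding x_def eval_nat_numeral BitM.simps All_less_Suc using c by simp
  have cn: "c \<notin> x ` {..<5}" using cx adj_irrefl by fastforce
  have an: "a \<notin> x ` {..<5}" unfolding img
    using a e ne adj_irrefl adj_sym by blast
  have ax: "\<forall>j<5. (a, x j) \<in> E \<longleftrightarrow> j = 0 \<or> j = Suc 0 mod 5"
    unfolding x_def eval_nat_numeral BitM.simps All_less_Suc using a by simp
  have "induced_W5_hat V E x c a"
    unfolding induced_W5_hat_def induced_W5_def
  proof (intro conjI)
    show "c \<in> V - x ` {..<5}" using cn c adj_V by blast
    show "a \<in> V - x ` {..<5}" using an a adj_V by blast
    show "\<exists>i<5. \<forall>j<5. (a, x j) \<in> E \<longleftrightarrow> j = i \<or> j = Suc i mod 5"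
      by (rule exI[of _ 0]) (use ax in simp)
  qed (use cyc cx a in auto)
  then have "\<exists>y\<in>V - (x ` {..<5} \<union> {c, a}). \<forall>z\<in>x ` {..<5} \<union> {c, a}. (y, z) \<in> E"
    using assms(1) unfolding W5_hat_condition_def by blast
  then obtain y where "\<forall>z\<in>x ` {..<5} \<union> {c, a}. (y, z) \<in> E" by blast
  then have "\<forall>x\<in>{x0, x1, x2, x3, x4, c, a}. (y, x) \<in> E" unfolding img by simp
  then show ?thesis ..
qed

text \<open>A vertex of the cover is a list: its head is its image in the graph, and its length is one more
  than its level. The tail of a new vertex is a chosen representative of its class of parents.\<close>

definition fresh :: "nat \<Rightarrow> 'a list set \<Rightarrow> 'a list rel \<Rightarrow> ('a list \<times> 'a) set" where
  "fresh n B A = {(w, z). w \<in> B \<and> length w = Suc n \<and> (hd w, z) \<in> E \<and> (\<forall>a. (a, w) \<in> A \<longrightarrow> hd a \<noteq> z)}"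

text \<open>The choice selects one representative for the whole class of parents of the new vertex.
  Pairs that are to be identified thus become literally the same list, and no quotient type is
  formed.\<close>

definition lift :: "nat \<Rightarrow> 'a list set \<Rightarrow> 'a list rel \<Rightarrow> 'a list \<Rightarrow> 'a \<Rightarrow> 'a list" where
  "lift n B A w z = z # (SOME w'. (w', z) \<in> fresh n B A \<and> (w' = w \<or> (w', w) \<in> A))"

definition next_verts :: "nat \<Rightarrow> 'a list set \<Rightarrow> 'a list rel \<Rightarrow> 'a list set" where
  "next_verts n B A = B \<union> {lift n B A w z |w z. (w, z) \<in> fresh n B A}"

text \<open>New vertices are joined only if they have a common parent, which builds (E) into the
  outer sphere. That enough edges arise in this way is the content of \<open>A'_full_old\<close> and
  \<open>A'_full_new\<close>.\<close>

definition next_edges :: "nat \<Rightarrow> 'a list set \<Rightarrow> 'a list rel \<Rightarrow> 'a list rel" where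
  "next_edges n B A = A \<union> {(w, lift n B A w z) |w z. (w, z) \<in> fresh n B A}
     \<union> {(lift n B A w z, w) |w z. (w, z) \<in> fresh n B A}
     \<union> {(lift n B A w z, lift n B A w z') |w z z'. (w, z) \<in> fresh n B A \<and> (w, z') \<in> fresh n B A \<and> (z, z') \<in> E}"

end

text \<open>The ball of radius \<open>n\<close> in the cover, with levels starting at length 1. By
  \<open>A_hom\<close>, \<open>inj\<close>, \<open>full\<close> and \<open>surj\<close>,
  \<open>hd\<close> is an isomorphism from the graph on the neighbours of \<open>w\<close> to the
  graph on the neighbours of \<open>hd w\<close>; \<open>surj\<close> stops at length
  \<open>n\<close> because the outer sphere, of length \<open>Suc n\<close>, may still lack
  neighbours. \<open>lower\<close> and \<open>common\<close> are (V) and (E) at the root, with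
  levels in place of distances.\<close>

locale partial_cover = conn_graph V E for V :: "'a set" and E +
  fixes v0 :: 'a and n :: nat and B :: "'a list set" and A :: "'a list rel"
  assumes c4: "C4_free V E" and w5: "W5_hat_condition V E"
    and B_len: "w \<in> B \<Longrightarrow> w \<noteq> [] \<and> length w \<le> Suc n"
    and B_V: "w \<in> B \<Longrightarrow> hd w \<in> V"
    and A_B: "(a, b) \<in> A \<Longrightarrow> a \<in> B \<and> b \<in> B"
    and A_sym: "(a, b) \<in> A \<Longrightarrow> (b, a) \<in> A"
    and A_hom: "(a, b) \<in> A \<Longrightarrow> (hd a, hd b) \<in> E"
    and A_len: "(a, b) \<in> A \<Longrightarrow> length a \<le> Suc (length b)"
    and B_1: "w \<in> B \<Longrightarrow> length w = Suc 0 \<Longrightarrow> w = [v0]"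
    and root: "[v0] \<in> B"
    and parent: "w \<in> B \<Longrightarrow> length w \<noteq> Suc 0 \<Longrightarrow> \<exists>u. (u, w) \<in> A \<and> Suc (length u) = length w"
    and inj: "(a, w) \<in> A \<Longrightarrow> (b, w) \<in> A \<Longrightarrow> hd a = hd b \<Longrightarrow> a = b"
    and full: "(a, w) \<in> A \<Longrightarrow> (b, w) \<in> A \<Longrightarrow> (hd a, hd b) \<in> E \<Longrightarrow> (a, b) \<in> A"
    and surj: "w \<in> B \<Longrightarrow> length w \<le> n \<Longrightarrow> (hd w, z) \<in> E \<Longrightarrow> \<exists>a. (a, w) \<in> A \<and> hd a = z"
    and lower: "(a, w) \<in> A \<Longrightarrow> (b, w) \<in> A \<Longrightarrow> Suc (length a) = length w \<Longrightarrow> Suc (length b) = length w \<Longrightarrow>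
      a = b \<or> (a, b) \<in> A"
    and common: "(w, w') \<in> A \<Longrightarrow> length w = length w' \<Longrightarrow>
      \<exists>u. (u, w) \<in> A \<and> (u, w') \<in> A \<and> Suc (length u) = length w"
begin

abbreviation "Z \<equiv> fresh n B A"
abbreviation "nw \<equiv> lift n B A"
abbreviation "B' \<equiv> next_verts n B A"
abbreviation "A' \<equiv> next_edges n B A"

lemma Z_D:
  assumes "(w, z) \<in> Z"
  shows "w \<in> B" "length w = Suc n" "(hd w, z) \<in> E" "(a, w) \<in> A \<Longrightarrow> hd a \<noteq> z"
  using assms by (auto simp: fresh_def)

text \<open>The neighbourhood of \<open>p\<close> is already complete, so \<open>z\<close> would
  have a lift next to \<open>p\<close>. By \<open>full\<close> that lift would also be a neighbour
  of \<open>w\<close>, against freshness.\<close>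

lemma lower_not_adj:
  assumes "(w, z) \<in> Z" "(p, w) \<in> A" "length p \<le> n"
  shows "(hd p, z) \<notin> E"
proof
  assume "(hd p, z) \<in> E"
  then obtain b where b: "(b, p) \<in> A" "hd b = z" using surj[of p z] A_B assms by blast
  then have "(b, w) \<in> A" using full[of b p w] A_sym[OF assms(2)] Z_D(3)[OF assms(1)] adj_sym by blast
  then show False using Z_D(4)[OF assms(1)] b by blast
qed

text \<open>A common lower neighbour of w and \<open>w''\<close> closes up an induced square with z. Otherwise the lower
  neighbours u of \<open>w, w'\<close> and \<open>u'\<close> of \<open>w', w''\<close>, and a common lower neighbour t of u and \<open>u'\<close>,
  span an extended 5-wheel with centre \<open>w'\<close>, rim \<open>u, u', w'', z, w\<close> and apex t.\<close>

lemma fresh_trans: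
  assumes Z: "(w, z) \<in> Z" "(w', z) \<in> Z" "(w'', z) \<in> Z"
    and ww': "(w, w') \<in> A" and w'w'': "(w', w'') \<in> A" and neq: "w \<noteq> w''"
  shows "(w, w'') \<in> A"
proof (rule ccontr)
  assume n: "(w, w'') \<notin> A"
  note z = Z_D[OF Z(1)] Z_D[OF Z(2)] Z_D[OF Z(3)]
  have not_adj: "(hd a, hd b) \<notin> E" if "(a, x) \<in> A" "(b, x) \<in> A" "(a, b) \<notin> A" for a b x
    using full that by blast
  have hww: "(hd w, hd w'') \<notin> E" using not_adj[OF ww' A_sym[OF w'w''] n] .
  have hneq: "hd w \<noteq> hd w''" using inj[OF ww' A_sym[OF w'w'']] neq by blast
  have no_common: False if p: "(p, w) \<in> A" "(p, w'') \<in> A" "length p = n" for p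
  proof -
    have "(z, hd p) \<in> E"
    proof (rule C4_freeD[OF c4, of z "hd w" "hd p" "hd w''"])
      show "(z, hd w) \<in> E" "(hd w'', z) \<in> E" using z adj_sym by blast+
      show "(hd w, hd p) \<in> E" "(hd p, hd w'') \<in> E" using p A_hom A_sym by blast+
      show "z \<noteq> hd p" using z(4)[OF p(1)] by simp
    qed (use hww hneq in auto)
    then show False using lower_not_adj[OF Z(1) p(1)] p(3) adj_sym by simp
  qed
  obtain u where u: "(u, w) \<in> A" "(u, w') \<in> A" "length u = n"
    using common[OF ww'] z(2,6) by auto
  obtain u' where u': "(u', w') \<in> A" "(u', w'') \<in> A" "length u' = n"
    using common[OF w'w''] z(6,10) by auto
  have nu: "(u, w'') \<notin> A" "(u', w) \<notin> A" using no_common u u' by blast+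
  have "u \<noteq> u'" using nu u' by blast
  then have uu': "(u, u') \<in> A" using lower[OF u(2) u'(1)] u u' z by simp
  then obtain t where t: "(t, u) \<in> A" "(t, u') \<in> A" "Suc (length t) = n"
    using common[OF uu'] u u' by auto
  \<comment> \<open>The vertex \<open>t\<close> lies two levels below \<open>w\<close>,
    \<open>w'\<close> and \<open>w''\<close>.\<close>
  have tn: "(t, w) \<notin> A" "(t, w') \<notin> A" "(t, w'') \<notin> A"
    using A_len[of w t] A_len[of w' t] A_len[of w'' t] A_sym t(3) z(2,6,10) by force+
  have tu: "(hd t, hd w) \<notin> E" "(hd t, hd w') \<notin> E" "(hd t, hd w'') \<notin> E"
    using not_adj[OF t(1) A_sym[OF u(1)]] not_adj[OF t(1) A_sym[OF u(2)]]
      not_adj[OF t(2) A_sym[OF u'(2)]] tn by blast+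
  have "t \<noteq> w" "t \<noteq> w'" using t(3) z(2,6) by auto
  then have tne: "hd t \<noteq> hd w" "hd t \<noteq> hd w'"
    using inj[OF t(1) A_sym[OF u(1)]] inj[OF t(1) A_sym[OF u(2)]] by blast+
  have uz: "(hd u, z) \<notin> E" "(hd u', z) \<notin> E"
    using lower_not_adj[OF Z(1) u(1)] lower_not_adj[OF Z(3) u'(2)] u(3) u'(3) by auto
  have tz: "(hd t, z) \<notin> E"
  proof
    assume a: "(hd t, z) \<in> E"
    have "(z, hd u) \<in> E"
    proof (rule C4_freeD[OF c4, of z "hd t" "hd u" "hd w"])
      show "z \<noteq> hd u" using z(4)[OF u(1)] by simp
    qed (use a adj_sym A_hom t u z tu tne in blast)+
    then show False using uz adj_sym by blast
  qed
  have "\<exists>y. \<forall>x\<in>{hd u, hd u', hd w'', z, hd w, hd w', hd t}. (y, x) \<in> E"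
    by (rule W5_hatD[OF w5 A_hom[OF uu'] A_hom[OF u'(2)] z(11) adj_sym[OF z(3)] A_hom[OF A_sym[OF u(1)]]
        not_adj[OF u(2) A_sym[OF w'w''] nu(1)] uz not_adj[OF u'(1) ww' nu(2)] _
        A_hom[OF A_sym[OF u(2)]] A_hom[OF A_sym[OF u'(1)]] A_hom[OF w'w''] z(7) A_hom[OF A_sym[OF ww']]
        A_hom[OF t(1)] A_hom[OF t(2)] tu(3) tz tu(1,2) tne(2)]) (use hww adj_sym in blast)
  then obtain y where y: "\<forall>x\<in>{hd u, hd u', hd w'', z, hd w, hd w', hd t}. (y, x) \<in> E" by blast
  \<comment> \<open>The vertex \<open>y\<close> given by the wheel condition is lifted next to
    \<open>u\<close>, and \<open>full\<close> carries its adjacencies upstairs, reaching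
    \<open>w''\<close> through \<open>u'\<close>. Being adjacent to both \<open>t\<close> and
    \<open>w\<close> fixes the length of the lift as \<open>n\<close>, so it is a common lower
    neighbour of \<open>w\<close> and \<open>w''\<close>.\<close>
  then have "(hd u, y) \<in> E" using adj_sym by blast
  moreover have "u \<in> B" "length u \<le> n" using A_B u by auto
  ultimately obtain y' where y': "(y', u) \<in> A" "hd y' = y" using surj by blast
  have l: "(y', w) \<in> A" "(y', u') \<in> A" "(y', t) \<in> A"
    using full[OF y'(1) A_sym[OF u(1)]] full[OF y'(1) A_sym[OF uu']] full[OF y'(1) t(1)] y y'(2) by auto
  have "(y', w'') \<in> A" using full[OF l(2) A_sym[OF u'(2)]] y y'(2) by auto
  moreover have "length y' = n"
    using A_len[OF l(3)] A_len[OF A_sym[OF l(1)]] t(3) z(2) by simp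
  ultimately show False using no_common l(1) by blast
qed

text \<open>By \<open>fresh_trans\<close>, being equal or adjacent is an equivalence relation on the
  fresh pairs with a given \<open>z\<close>. Equivalent parents satisfy the same choice predicate,
  and conversely the chosen representative links any two parents that share it.\<close>

lemma lift_eq:
  assumes "(w, z) \<in> Z" "(w', z') \<in> Z"
  shows "nw w z = nw w' z' \<longleftrightarrow> z = z' \<and> (w = w' \<or> (w, w') \<in> A)"
proof -
  define P where "P = (\<lambda>w z x. (x, z) \<in> Z \<and> (x = w \<or> (x, w) \<in> A))"
  have nw: "nw w z = z # Eps (P w z)" for w z by (simp add: lift_def P_def)
  have ex: "P w z (Eps (P w z))" if "(w, z) \<in> Z" for w z
    by (rule someI[of _ w]) (simp add: P_def that)
  have imp: "P w' z x" if "(w, z) \<in> Z" "(w', z) \<in> Z" "w = w' \<or> (w, w') \<in> A" "P w z x" for w w' z x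
    using that fresh_trans[of x z w w'] unfolding P_def by blast
  show ?thesis
  proof
    assume "nw w z = nw w' z'"
    then have z: "z = z'" and e: "Eps (P w z) = Eps (P w' z')" by (auto simp: nw)
    define x where "x = Eps (P w z)"
    have "P w z x" "P w' z x" using ex[OF assms(1)] ex[OF assms(2)] e z by (auto simp: x_def)
    then have "P w' z w"
      using imp[of x z w' w] assms z unfolding P_def by (metis A_sym)
    then show "z = z' \<and> (w = w' \<or> (w, w') \<in> A)" using z by (auto simp: P_def)
  next
    assume h: "z = z' \<and> (w = w' \<or> (w, w') \<in> A)"
    then have "P w z = P w' z'"
      using imp[of w z w'] imp[of w' z w] assms A_sym by (intro ext) blast
    then show "nw w z = nw w' z'" using h by (simp add: nw)
  qed
qed

lemma hd_lift [simp]: "hd (nw w z) = z"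
  by (simp add: lift_def)

lemma length_lift: "(w, z) \<in> Z \<Longrightarrow> length (nw w z) = Suc (Suc n)"
proof -
  assume a: "(w, z) \<in> Z"
  have "(SOME w'. (w', z) \<in> Z \<and> (w' = w \<or> (w', w) \<in> A), z) \<in> Z"
    using someI[of "\<lambda>w'. (w', z) \<in> Z \<and> (w' = w \<or> (w', w) \<in> A)" w] a by blast
  then show ?thesis using Z_D(2) by (simp add: lift_def)
qed

lemma lift_notin: "(w, z) \<in> Z \<Longrightarrow> nw w z \<notin> B"
  using length_lift B_len by fastforce

lemma old_nbr:
  assumes "w \<in> B"
  shows "(a, w) \<in> A' \<longleftrightarrow> (a, w) \<in> A \<or> (\<exists>z. (w, z) \<in> Z \<and> a = nw w z)"
  unfolding next_edges_def using assms lift_notin by blast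

text \<open>An edge between new vertices may be witnessed by another representative of the class of
  \<open>w\<close>; the second case therefore returns its own \<open>w'\<close> with the same
  lift.\<close>

lemma new_nbrE:
  assumes "(a, nw w z) \<in> A'" "(w, z) \<in> Z"
  obtains "(a, z) \<in> Z" "nw a z = nw w z"
  | w' z' where "(w', z) \<in> Z" "(w', z') \<in> Z" "nw w' z = nw w z" "a = nw w' z'" "(z, z') \<in> E"
proof -
  have "(a, nw w z) \<notin> A" using lift_notin A_B assms(2) by blast
  moreover have "nw w z \<noteq> w'" if "(w', z') \<in> Z" for w' z'
    using that Z_D(1) lift_notin[OF assms(2)] by blast
  ultimately consider z' where "(a, z') \<in> Z" "nw w z = nw a z'"
    | w' z1 z2 where "(w', z1) \<in> Z" "(w', z2) \<in> Z" "(z1, z2) \<in> E" "a = nw w' z1" "nw w z = nw w' z2"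
    using assms(1) unfolding next_edges_def by blast
  then show ?thesis
  proof cases
    case 1
    then have "z' = z" using hd_lift[of w z] by simp
    then show ?thesis using 1 that(1) by simp
  next
    case 2
    then have "z2 = z" using hd_lift[of w z] by simp
    then show ?thesis using 2 that(2)[of w' z1] adj_sym by simp
  qed
qed

section \<open>The enlarged graph is again a partial cover\<close>

lemma A'_sym: "(a, b) \<in> A' \<Longrightarrow> (b, a) \<in> A'"
  unfolding next_edges_def using A_sym adj_sym by blast

lemma new_edge: "(w, z) \<in> Z \<Longrightarrow> (w, nw w z) \<in> A'"
  unfolding next_edges_def by blast

lemma new_new_edge: "(w, z) \<in> Z \<Longrightarrow> (w, z') \<in> Z \<Longrightarrow> (z, z') \<in> E \<Longrightarrow> (nw w z, nw w z') \<in> A'"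
  unfolding next_edges_def by blast

lemma B'_cases:
  assumes "q \<in> B'" obtains "q \<in> B" | w z where "(w, z) \<in> Z" "q = nw w z"
  using assms unfolding next_verts_def by blast

lemma A'_B': "(a, b) \<in> A' \<Longrightarrow> a \<in> B' \<and> b \<in> B'"
  unfolding next_edges_def next_verts_def using A_B Z_D(1) by blast

lemma A'_hom: assumes "(a, b) \<in> A'" shows "(hd a, hd b) \<in> E"
  using assms A_hom Z_D(3) adj_sym unfolding next_edges_def by auto

lemma A'_len: assumes "(a, b) \<in> A'" shows "length a \<le> Suc (length b)"
  using assms A_len Z_D(2) length_lift unfolding next_edges_def by auto

lemma A'_parent:
  assumes "(w, z) \<in> Z" "(a, nw w z) \<in> A'" "a \<in> B"
  shows "(a, z) \<in> Z \<and> (a = w \<or> (a, w) \<in> A)"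
  using assms(2,1)
proof (cases rule: new_nbrE)
  case 1
  then show ?thesis using lift_eq[OF 1(1) assms(1)] by blast
next
  case (2 w' z')
  then show ?thesis using lift_notin assms(3) by blast
qed

text \<open>A lift of \<open>z\<close> next to \<open>a\<close> would by \<open>full\<close> be a
  neighbour of \<open>w\<close>, so \<open>z\<close> is missing at \<open>a\<close> as well. Inner
  vertices miss nothing, hence \<open>a\<close> is on the outer sphere.\<close>

lemma fresh_nbr:
  assumes "(w, z) \<in> Z" "(a, w) \<in> A" "(hd a, z) \<in> E"
  shows "(a, z) \<in> Z"
proof -
  have no: "hd b \<noteq> z" if "(b, a) \<in> A" for b
  proof
    assume h: "hd b = z"
    then have "(b, w) \<in> A" using full[OF that A_sym[OF assms(2)]] Z_D(3)[OF assms(1)] adj_sym by blast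
    then show False using Z_D(4)[OF assms(1)] h by blast
  qed
  have aB: "a \<in> B" using A_B assms by blast
  have "\<not> length a \<le> n" using surj[OF aB _ assms(3)] no by blast
  then have "length a = Suc n" using B_len[OF aB] by simp
  then show ?thesis using aB assms(3) no by (simp add: fresh_def)
qed

lemma A'_full_old:
  assumes w: "w \<in> B" and aw: "(a, w) \<in> A'" and bw: "(b, w) \<in> A'" and ab: "(hd a, hd b) \<in> E"
  shows "(a, b) \<in> A'"
proof -
  \<comment> \<open>The pair of \<open>a\<close> and \<open>z\<close> is fresh too and is identified
    with that of \<open>w\<close> and \<open>z\<close>, so the new vertex is also a child of
    \<open>a\<close>.\<close>
  have mixed: "(a, nw w z) \<in> A'" if "(a, w) \<in> A" "(w, z) \<in> Z" "(hd a, z) \<in> E" for a z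
  proof -
    have "(a, z) \<in> Z" using fresh_nbr that by blast
    moreover have "nw a z = nw w z" using lift_eq[OF \<open>(a, z) \<in> Z\<close> that(2)] that(1) by blast
    ultimately show ?thesis using new_edge by metis
  qed
  consider "(a, w) \<in> A" "(b, w) \<in> A" | z where "(a, w) \<in> A" "(w, z) \<in> Z" "b = nw w z"
    | z where "(b, w) \<in> A" "(w, z) \<in> Z" "a = nw w z"
    | z z' where "(w, z) \<in> Z" "a = nw w z" "(w, z') \<in> Z" "b = nw w z'"
    using aw bw old_nbr[OF w] by blast
  then show ?thesis
  proof cases
    case 1
    then show ?thesis using full ab unfolding next_edges_def by blast
  next
    case 2
    then show ?thesis using mixed ab by simp
  next
    case 3
    then show ?thesis using mixed[of b z] ab adj_sym A'_sym by simp
  next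
    case 4
    then show ?thesis using new_new_edge ab by simp
  qed
qed

lemma A'_inj_old:
  assumes w: "w \<in> B" and aw: "(a, w) \<in> A'" and bw: "(b, w) \<in> A'" and ab: "hd a = hd b"
  shows "a = b"
  using aw bw ab inj Z_D(4) unfolding old_nbr[OF w] by (metis hd_lift)

lemma A'_inj_new:
  assumes w: "(w, z) \<in> Z" and a: "(a, nw w z) \<in> A'" and b: "(b, nw w z) \<in> A'" and ab: "hd a = hd b"
  shows "a = b"
proof -
  \<comment> \<open>A parent \<open>a\<close> cannot have the same image as a new neighbour
    \<open>nw w' z'\<close>: if \<open>a = w'\<close>, then \<open>z'\<close> would be adjacent to
    itself, and if \<open>a\<close> is a neighbour of \<open>w'\<close>, then \<open>z'\<close> is
    not fresh at \<open>w'\<close>.\<close>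
  have mixed: False if "(a, z) \<in> Z" "nw a z = nw w z" "(w', z) \<in> Z" "(w', z') \<in> Z" "nw w' z = nw w z"
    "hd a = z'" for a w' z'
  proof -
    have "a = w' \<or> (a, w') \<in> A" using lift_eq[OF that(1,3)] that(2,5) by simp
    then show False using Z_D(3)[OF that(4)] Z_D(4)[OF that(4), of a] that(6) adj_irrefl by blast
  qed
  from a w show ?thesis
  proof (cases rule: new_nbrE)
    case 1
    note a1 = 1
    from b w show ?thesis
    proof (cases rule: new_nbrE)
      case 1
      then have "a = b \<or> (a, b) \<in> A" using lift_eq[OF a1(1) 1(1)] a1(2) by simp
      then show ?thesis using A_hom ab adj_irrefl by fastforce
    next
      case (2 w' z')
      then show ?thesis using mixed[OF a1 2(1-3)] ab by simp
    qed
  next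
    case (2 w1 z1)
    note a2 = 2
    from b w show ?thesis
    proof (cases rule: new_nbrE)
      case 1
      then show ?thesis using mixed[OF 1 a2(1-3)] ab a2(4) by simp
    next
      case (2 w2 z2)
      have "z1 = z2" using ab a2 2 by simp
      moreover have "w1 = w2 \<or> (w1, w2) \<in> A" using lift_eq[OF a2(1) 2(1)] a2(3) 2(3) by simp
      ultimately show ?thesis using lift_eq[OF a2(2) 2(2)] a2(4) 2(4) by simp
    qed
  qed
qed

lemma A'_full_new:
  assumes w: "(w, z) \<in> Z" and a: "(a, nw w z) \<in> A'" and b: "(b, nw w z) \<in> A'" and ab: "(hd a, hd b) \<in> E"
  shows "(a, b) \<in> A'"
proof -
  have mixed: "(a, nw w' z') \<in> A'" if "(a, z) \<in> Z" "nw a z = nw w z" "(w', z) \<in> Z" "(w', z') \<in> Z" "nw w' z = nw w z"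
    "(hd a, z') \<in> E" for a w' z'
  proof (cases "a = w'")
    case True
    then show ?thesis using new_edge that by blast
  next
    case False
    then have "(a, w') \<in> A" using lift_eq[OF that(1,3)] that(2,5) by simp
    then have "(a, w') \<in> A'" by (simp add: next_edges_def)
    moreover have "(nw w' z', w') \<in> A'" using new_edge[OF that(4)] A'_sym by blast
    ultimately show ?thesis using A'_full_old[OF Z_D(1)[OF that(3)]] that(6) by simp
  qed
  from a w show ?thesis
  proof (cases rule: new_nbrE)
    case 1
    note a1 = 1
    from b w show ?thesis
    proof (cases rule: new_nbrE)
      case 1
      then have "a = b \<or> (a, b) \<in> A" using lift_eq[OF a1(1) 1(1)] a1(2) by simp
      then show ?thesis using ab adj_irrefl unfolding next_edges_def by fastforce
    next
      case (2 w' z')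
      then show ?thesis using mixed[OF a1 2(1-3)] ab by simp
    qed
  next
    case (2 w1 z1)
    note a2 = 2
    from b w show ?thesis
    proof (cases rule: new_nbrE)
      case 1
      then show ?thesis using mixed[OF 1 a2(1-3)] ab a2(4) adj_sym A'_sym by simp
    next
      case (2 w2 z2)
      note b2 = 2
      have zz: "(z1, z2) \<in> E" using ab a2(4) b2(4) by simp
      have w12: "w1 = w2 \<or> (w1, w2) \<in> A" using lift_eq[OF a2(1) b2(1)] a2(3) b2(3) by simp
      have e1: "(nw w1 z1, w1) \<in> A'" "(nw w2 z2, w2) \<in> A'" using new_edge[OF a2(2)] new_edge[OF b2(2)] A'_sym by blast+
      show ?thesis
      proof (cases "w1 = w2 \<or> (w1, nw w2 z2) \<in> A' \<or> (w2, nw w1 z1) \<in> A'")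
        case True
        then show ?thesis
          using A'_full_old[OF Z_D(1)[OF a2(1)], of a b] A'_full_old[OF Z_D(1)[OF b2(1)], of a b] e1 A'_sym
            a2(4) b2(4) ab by blast
      next
        \<comment> \<open>Neither parent is adjacent to the other child. Then the images of the two
          parents and their children would form an induced square.\<close>
        case False
        then have w12A: "(w1, w2) \<in> A'" using w12 by (simp add: next_edges_def)
        then have w21A: "(w2, w1) \<in> A'" by (rule A'_sym)
        have n1: "(hd w1, z2) \<notin> E"
          using A'_full_old[OF Z_D(1)[OF b2(1)] w12A e1(2)] False by auto
        have n2: "(hd w2, z1) \<notin> E"
          using A'_full_old[OF Z_D(1)[OF a2(1)] w21A e1(1)] False by auto
        have "hd w2 \<noteq> z1" using A'_inj_old[OF Z_D(1)[OF a2(1)] w21A e1(1)] lift_notin[OF a2(2)] Z_D(1)[OF b2(1)]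
          by auto
        moreover have "hd w1 \<noteq> z2" using A'_inj_old[OF Z_D(1)[OF b2(1)] w12A e1(2)] lift_notin[OF b2(2)] Z_D(1)[OF a2(1)]
          by auto
        ultimately have "(hd w2, z1) \<in> E"
          using C4_freeD[OF c4, of "hd w2" "hd w1" z1 z2] A'_hom[OF w21A] Z_D(3)[OF a2(2)] Z_D(3)[OF b2(2)] zz n1
            adj_sym by blast
        then show ?thesis using n2 by simp
      qed
    qed
  qed
qed

lemma next_partial_cover: "partial_cover V E v0 (Suc n) B' A'"
proof unfold_locales
  show "C4_free V E" "W5_hat_condition V E" by (rule c4, rule w5)
  show "w \<noteq> [] \<and> length w \<le> Suc (Suc n)" if "w \<in> B'" for w
    using that by (cases rule: B'_cases) (use B_len length_lift in force)+
  show "hd w \<in> V" if "w \<in> B'" for w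
    using that by (cases rule: B'_cases) (use B_V Z_D(3) adj_V in force)+
  show "a \<in> B' \<and> b \<in> B'" if "(a, b) \<in> A'" for a b using A'_B'[OF that] .
  show "(b, a) \<in> A'" if "(a, b) \<in> A'" for a b using A'_sym[OF that] .
  show "(hd a, hd b) \<in> E" if "(a, b) \<in> A'" for a b using A'_hom[OF that] .
  show "length a \<le> Suc (length b)" if "(a, b) \<in> A'" for a b using A'_len[OF that] .
  show "w = [v0]" if "w \<in> B'" "length w = Suc 0" for w
    using that(1) by (cases rule: B'_cases) (use B_1 length_lift that(2) in force)+
  show "[v0] \<in> B'" using root by (simp add: next_verts_def)
  show "\<exists>u. (u, w) \<in> A' \<and> Suc (length u) = length w" if "w \<in> B'" "length w \<noteq> Suc 0" for w
    using that(1)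
  proof (cases rule: B'_cases)
    case 1
    then show ?thesis using parent[OF 1 that(2)] unfolding next_edges_def by blast
  next
    case (2 w' z)
    then show ?thesis using new_edge[OF 2(1)] length_lift[OF 2(1)] Z_D(2)[OF 2(1)] by auto
  qed
  show "a = b" if "(a, w) \<in> A'" "(b, w) \<in> A'" "hd a = hd b" for a b w
  proof -
    have "w \<in> B'" using A'_B' that by blast
    then show ?thesis
      by (cases rule: B'_cases) (use A'_inj_old A'_inj_new that in blast)+
  qed
  show "(a, b) \<in> A'" if "(a, w) \<in> A'" "(b, w) \<in> A'" "(hd a, hd b) \<in> E" for a b w
  proof -
    have "w \<in> B'" using A'_B' that by blast
    then show ?thesis
      by (cases rule: B'_cases) (use A'_full_old A'_full_new that in blast)+
  qed
  show "\<exists>a. (a, w) \<in> A' \<and> hd a = z" if "w \<in> B'" "length w \<le> Suc n" "(hd w, z) \<in> E" for w z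
  proof -
    have wB: "w \<in> B" using that(1)
      by (cases rule: B'_cases) (use length_lift that(2) in force)+
    show ?thesis
    proof (cases "\<exists>a. (a, w) \<in> A \<and> hd a = z")
      case True
      then show ?thesis unfolding next_edges_def by blast
    next
      case False
      \<comment> \<open>Neighbours are missing only on the old outer sphere, and each missing one is
        a fresh pair, which now receives its lift.\<close>
      then have "length w = Suc n" using surj[OF wB _ that(3)] that(2) by (meson le_SucE)
      then have "(w, z) \<in> Z" using wB that(3) False by (auto simp: fresh_def)
      then show ?thesis using new_edge A'_sym hd_lift by blast
    qed
  qed
  show "a = b \<or> (a, b) \<in> A'"
    if "(a, w) \<in> A'" "(b, w) \<in> A'" "Suc (length a) = length w" "Suc (length b) = length w" for a b w
  proof -
    have "w \<in> B'" using A'_B' that by blast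
    then show ?thesis
    proof (cases rule: B'_cases)
      case 1
      have "length w \<le> Suc n" using B_len[OF 1] by simp
      then have "(a, w) \<in> A" "(b, w) \<in> A"
        using that length_lift unfolding old_nbr[OF 1] by force+
      then show ?thesis using lower that(3,4) unfolding next_edges_def by blast
    next
      case (2 w' z)
      have len: "length a = Suc n" "length b = Suc n" using that(3,4) length_lift[OF 2(1)] 2(2) by auto
      have "a \<in> B'" "b \<in> B'" using A'_B' that by blast+
      then have "a \<in> B" "b \<in> B" using len length_lift by (auto elim!: B'_cases)
      then have "(a, z) \<in> Z \<and> (a = w' \<or> (a, w') \<in> A)" "(b, z) \<in> Z \<and> (b = w' \<or> (b, w') \<in> A)"
        using A'_parent[OF 2(1)] that(1,2) 2(2) by auto
      \<comment> \<open>The lower neighbours of a new vertex are exactly the members of its class of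
        parents, so (V) there is the transitivity of the identification.\<close>
      then have "a = b \<or> (a, b) \<in> A" using fresh_trans[of a z w' b] 2(1) A_sym by blast
      then show ?thesis unfolding next_edges_def by blast
    qed
  qed
  show "\<exists>u. (u, w) \<in> A' \<and> (u, w') \<in> A' \<and> Suc (length u) = length w"
    if "(w, w') \<in> A'" "length w = length w'" for w w'
  proof -
    have "w' \<in> B'" using A'_B' that by blast
    then show ?thesis
    proof (cases rule: B'_cases)
      case 1
      have "length w' \<le> Suc n" using B_len[OF 1] by simp
      then have "w \<noteq> nw w' z" if "(w', z) \<in> Z" for z
        using length_lift[OF that] \<open>length w = length w'\<close> by auto
      then have "(w, w') \<in> A" using that(1) old_nbr[OF 1] by blast
      then obtain u where "(u, w) \<in> A" "(u, w') \<in> A" "Suc (length u) = length w"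
        using common \<open>length w = length w'\<close> by blast
      then show ?thesis by (intro exI[of _ u]) (simp add: next_edges_def)
    next
      case (2 x z)
      from that(1)[unfolded 2(2)] 2(1) show ?thesis
      proof (cases rule: new_nbrE)
        case 1
        then show ?thesis using Z_D(2)[OF 1(1)] that(2) length_lift[OF 2(1)] 2(2) by simp
      next
        case (2 y z')
        note y = 2
        have "(y, w) \<in> A'" "(y, w') \<in> A'"
          using new_edge[OF y(1)] new_edge[OF y(2)] y(3,4) \<open>w' = nw x z\<close> by auto
        then show ?thesis using Z_D(2)[OF y(1)] length_lift[OF y(2)] y(4) by (intro exI[of _ y]) simp
      qed
    qed
  qed
qed

end

text \<open>The limit object with abstract vertices and levels. Unlike in a partial cover,
  \<open>surj\<close> holds at every vertex, so \<open>f\<close> is a local isomorphism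
  everywhere.\<close>

locale graph_cover = conn_graph V E for V :: "'a set" and E +
  fixes f :: "'b \<Rightarrow> 'a" and lev :: "'b \<Rightarrow> nat" and r :: 'b and B :: "'b set" and A :: "'b rel"
  assumes f_V: "w \<in> B \<Longrightarrow> f w \<in> V"
    and A_B: "(a, b) \<in> A \<Longrightarrow> a \<in> B \<and> b \<in> B"
    and A_sym: "(a, b) \<in> A \<Longrightarrow> (b, a) \<in> A"
    and A_hom: "(a, b) \<in> A \<Longrightarrow> (f a, f b) \<in> E"
    and A_lev: "(a, b) \<in> A \<Longrightarrow> lev a \<le> Suc (lev b)"
    and root: "r \<in> B" "lev r = 0" "w \<in> B \<Longrightarrow> lev w = 0 \<Longrightarrow> w = r"
    and parent: "w \<in> B \<Longrightarrow> lev w = Suc n \<Longrightarrow> \<exists>u. (u, w) \<in> A \<and> lev u = n"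
    and inj: "(a, w) \<in> A \<Longrightarrow> (b, w) \<in> A \<Longrightarrow> f a = f b \<Longrightarrow> a = b"
    and full: "(a, w) \<in> A \<Longrightarrow> (b, w) \<in> A \<Longrightarrow> (f a, f b) \<in> E \<Longrightarrow> (a, b) \<in> A"
    and surj: "w \<in> B \<Longrightarrow> (f w, z) \<in> E \<Longrightarrow> \<exists>a. (a, w) \<in> A \<and> f a = z"
    and lower: "(a, w) \<in> A \<Longrightarrow> (b, w) \<in> A \<Longrightarrow> Suc (lev a) = lev w \<Longrightarrow> Suc (lev b) = lev w \<Longrightarrow>
      a = b \<or> (a, b) \<in> A"
    and common: "(w, w') \<in> A \<Longrightarrow> lev w = lev w' \<Longrightarrow>
      \<exists>u. (u, w) \<in> A \<and> (u, w') \<in> A \<and> Suc (lev u) = lev w"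
begin

section \<open>Walks in the cover, and consequences of injectivity\<close>

lemma root_walk: "w \<in> B \<Longrightarrow> lev w = n \<Longrightarrow> (r, w) \<in> A ^^ n"
proof (induction n arbitrary: w)
  case 0
  then show ?case using root(3) by simp
next
  case (Suc n)
  then obtain u where "(u, w) \<in> A" "lev u = n" using parent by blast
  then show ?case using Suc.IH[of u] A_B by auto
qed

lemma walk_connected:
  assumes "a \<in> B" "b \<in> B" shows "\<exists>n. (a, b) \<in> A ^^ n"
proof -
  have "sym A" using A_sym by (auto intro: symI)
  then have "(a, r) \<in> A\<^sup>*"
    using root_walk[OF assms(1) refl] by (metis relpow_imp_rtrancl sym_rtrancl symD)
  moreover have "(r, b) \<in> A\<^sup>*" using root_walk[OF assms(2) refl] by (metis relpow_imp_rtrancl)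
  ultimately have "(a, b) \<in> A\<^sup>*" by simp
  then show ?thesis by (rule rtrancl_imp_relpow)
qed

lemma walk_hom: "(a, b) \<in> A ^^ n \<Longrightarrow> (f a, f b) \<in> E ^^ n"
proof (induction n arbitrary: b)
  case (Suc n)
  then obtain c where "(a, c) \<in> A ^^ n" "(c, b) \<in> A" by auto
  then show ?case using Suc.IH[of c] A_hom[of c b] by auto
qed simp

lemma walk_lift: "(f r, y) \<in> E ^^ n \<Longrightarrow> \<exists>w\<in>B. f w = y \<and> lev w \<le> n"
proof (induction n arbitrary: y)
  case 0
  then show ?case using root(1,2) by auto
next
  case (Suc n)
  then obtain x where x: "(f r, x) \<in> E ^^ n" "(x, y) \<in> E" by auto
  then obtain w where w: "w \<in> B" "f w = x" "lev w \<le> n" using Suc.IH by blast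
  then obtain a where a: "(a, w) \<in> A" "f a = y" using surj[of w y] x by blast
  then have "lev a \<le> Suc n" using A_lev[OF a(1)] w by simp
  moreover have "a \<in> B" using A_B[OF a(1)] by simp
  ultimately show ?case using a(2) by blast
qed

context
  assumes inj_f: "inj_on f B"
begin

lemma root_V: "f r \<in> V"
  using f_V root by blast

text \<open>Projecting a walk from the root bounds the distance by the level. Conversely a geodesic
  lifts to a walk ending over \<open>f w\<close>, and injectivity says that it ends at
  \<open>w\<close>.\<close>

lemma dist_lev: assumes "w \<in> B" shows "d (f r) (f w) = lev w"
proof (rule antisym)
  show "d (f r) (f w) \<le> lev w"
    by (rule dist_le[OF walk_hom[OF root_walk[OF assms refl]]])
  obtain w' where "w' \<in> B" "f w' = f w" "lev w' \<le> d (f r) (f w)"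
    using walk_lift[OF dist_walk[OF root_V f_V[OF assms]]] by blast
  then show "lev w \<le> d (f r) (f w)" using inj_f assms by (metis inj_onD)
qed

lemma lift_vertex: assumes "x \<in> V" obtains a where "a \<in> B" "f a = x"
  using walk_lift[OF dist_walk[OF root_V assms]] by blast

lemma lift_edge: assumes "(f a, f b) \<in> E" "a \<in> B" "b \<in> B" shows "(a, b) \<in> A"
proof -
  have "(f b, f a) \<in> E" using assms adj_sym by blast
  then obtain a' where "(a', b) \<in> A" "f a' = f a" using surj[OF assms(3)] by blast
  then show ?thesis using inj_onD[OF inj_f, of a' a] A_B assms by blast
qed

lemma Vcond_root: "Vcond (f r)"
  unfolding Vcond_def
proof (intro allI impI)
  fix w x y assume h: "(x, w) \<in> E" "(y, w) \<in> E" "d (f r) x < d (f r) w" "d (f r) y < d (f r) w" "x \<noteq> y"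
  have V: "x \<in> V" "y \<in> V" "w \<in> V" using h adj_V by blast+
  obtain a where a: "a \<in> B" "f a = x" using lift_vertex[OF V(1)] .
  obtain b where b: "b \<in> B" "f b = y" using lift_vertex[OF V(2)] .
  obtain c where c: "c \<in> B" "f c = w" using lift_vertex[OF V(3)] .
  have ac: "(a, c) \<in> A" "(b, c) \<in> A" using lift_edge a b c h by auto
  have "lev a < lev c" "lev b < lev c" using dist_lev a b c h by auto
  then have "Suc (lev a) = lev c" "Suc (lev b) = lev c"
    using A_lev[OF A_sym[OF ac(1)]] A_lev[OF A_sym[OF ac(2)]] by auto
  then have "a = b \<or> (a, b) \<in> A" using lower ac by blast
  then show "(x, y) \<in> E" using a b h A_hom by blast
qed

lemma Econd_root: "Econd (f r)"
  unfolding Econd_def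
proof (intro allI impI)
  fix x y assume h: "(x, y) \<in> E" "d (f r) x = d (f r) y" "0 < d (f r) x"
  have V: "x \<in> V" "y \<in> V" using h adj_V by blast+
  obtain a where a: "a \<in> B" "f a = x" using lift_vertex[OF V(1)] .
  obtain b where b: "b \<in> B" "f b = y" using lift_vertex[OF V(2)] .
  have ab: "(a, b) \<in> A" using lift_edge a b h by auto
  have "lev a = lev b" using dist_lev a b h by auto
  then obtain u where u: "(u, a) \<in> A" "(u, b) \<in> A" "Suc (lev u) = lev a" using common[OF ab] by blast
  then have "Suc (d (f r) (f u)) = d (f r) x" using dist_lev[of u] dist_lev[OF a(1)] A_B a by auto
  then show "\<exists>z. (z, x) \<in> E \<and> (z, y) \<in> E \<and> Suc (d (f r) z) = d (f r) x"
    using A_hom[OF u(1)] A_hom[OF u(2)] a b by blast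
qed

end

section \<open>Lifting labels along a grid\<close>

definition nb :: "'b \<Rightarrow> 'b \<Rightarrow> bool" where
  "nb x y \<longleftrightarrow> x \<in> B \<and> y \<in> B \<and> (x = y \<or> (x, y) \<in> A)"

definition near :: "'a \<Rightarrow> 'a \<Rightarrow> bool" where
  "near u v \<longleftrightarrow> u = v \<or> (u, v) \<in> E"

lemma nb_sym: "nb x y \<Longrightarrow> nb y x"
  unfolding nb_def using A_sym by blast

lemma nb_unique: assumes "nb x y" "nb x z" "f y = f z" shows "y = z"
proof -
  have "x = y \<or> (y, x) \<in> A" "x = z \<or> (z, x) \<in> A" using assms A_sym unfolding nb_def by blast+
  then show ?thesis using assms(3) inj[of y x z] A_hom[of y x] A_hom[of z x] adj_irrefl by metis
qed

lemma nb_triangle: assumes "nb x y" "nb x z" "near (f y) (f z)" shows "nb y z"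
proof (cases "f y = f z")
  case True
  then have "y = z" using nb_unique assms by blast
  then show ?thesis using assms unfolding nb_def by blast
next
  case False
  then have e: "(f y, f z) \<in> E" using assms(3) by (simp add: near_def)
  consider "x = y" | "x = z" | "(y, x) \<in> A" "(z, x) \<in> A" using assms A_sym unfolding nb_def by blast
  then show ?thesis
  proof cases
    case 1
    then show ?thesis using assms by simp
  next
    case 2
    then show ?thesis using assms nb_sym by simp
  next
    case 3
    then show ?thesis using full[OF 3 e] assms unfolding nb_def by blast
  qed
qed

definition transport :: "'b \<Rightarrow> 'a \<Rightarrow> 'b" where
  "transport x u = (SOME y. nb x y \<and> f y = u)"

lemma transport:
  assumes "x \<in> B" "near (f x) u" shows "nb x (transport x u)" "f (transport x u) = u"
proof -
  have "\<exists>y. nb x y \<and> f y = u"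
  proof (cases "f x = u")
    case True
    then show ?thesis using assms(1) by (auto simp: nb_def)
  next
    case False
    then obtain a where "(a, x) \<in> A" "f a = u" using surj[of x u] assms by (auto simp: near_def)
    then show ?thesis using A_B A_sym unfolding nb_def by blast
  qed
  then have "nb x (transport x u) \<and> f (transport x u) = u" unfolding transport_def by (rule someI_ex)
  then show "nb x (transport x u)" "f (transport x u) = u" by auto
qed

text \<open>Row 0 is the boundary circle, row \<open>N\<close> the centre of the disc, and columns 0
  and \<open>N\<close> are the same radius. The lift starts along row 0 and is moved inwards
  pointwise. It is closed at the centre, where the label is constant, and uniqueness of lifts takes
  this back to row 0. Labels are required to be near across diagonals too, so that each grid square
  splits into two triangles.\<close>

lemma grid_monodromy:
  fixes l :: "nat \<Rightarrow> nat \<Rightarrow> 'a"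
  assumes near1: "\<And>i j i' j'. i \<le> N \<Longrightarrow> j \<le> N \<Longrightarrow> i' \<le> N \<Longrightarrow> j' \<le> N \<Longrightarrow> i' \<le> Suc i \<Longrightarrow> i \<le> Suc i' \<Longrightarrow>
      j' \<le> Suc j \<Longrightarrow> j \<le> Suc j' \<Longrightarrow> near (l i j) (l i' j')"
    and sides: "\<And>i. i \<le> N \<Longrightarrow> l i 0 = l i N"
    and top: "\<And>j. j \<le> N \<Longrightarrow> l N j = l N 0"
    and a: "a \<in> B" "f a = l 0 0"
  obtains \<mu> where "\<mu> 0 = a" "\<mu> N = a" "\<And>j. j \<le> N \<Longrightarrow> f (\<mu> j) = l 0 j" "\<And>j. j < N \<Longrightarrow> nb (\<mu> j) (\<mu> (Suc j))"
proof -
  define \<mu>0 where "\<mu>0 = rec_nat a (\<lambda>j x. transport x (l 0 (Suc j)))"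
  define \<mu> where "\<mu> = rec_nat \<mu>0 (\<lambda>i row j. transport (row j) (l (Suc i) j))"
  have r0: "\<mu>0 0 = a" "\<mu>0 (Suc j) = transport (\<mu>0 j) (l 0 (Suc j))" for j by (simp_all add: \<mu>0_def)
  have r: "\<mu> 0 = \<mu>0" "\<mu> (Suc i) j = transport (\<mu> i j) (l (Suc i) j)" for i j by (simp_all add: \<mu>_def)
  have row0: "j \<le> N \<Longrightarrow> \<mu>0 j \<in> B \<and> f (\<mu>0 j) = l 0 j" for j
  proof (induction j)
    case 0
    then show ?case using a r0 by simp
  next
    case (Suc j)
    then have "near (f (\<mu>0 j)) (l 0 (Suc j))" using near1[of 0 j 0 "Suc j"] by simp
    then show ?case using transport[of "\<mu>0 j" "l 0 (Suc j)"] Suc r0 by (simp add: nb_def)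
  qed
  have row0': "nb (\<mu>0 j) (\<mu>0 (Suc j))" if "j < N" for j
    using transport(1)[of "\<mu>0 j" "l 0 (Suc j)"] row0[of j] near1[of 0 j 0 "Suc j"] r0 that by simp
  have rows: "i \<le> N \<Longrightarrow> (\<forall>j\<le>N. \<mu> i j \<in> B \<and> f (\<mu> i j) = l i j) \<and> (\<forall>j<N. nb (\<mu> i j) (\<mu> i (Suc j)))" for i
  proof (induction i)
    case 0
    then show ?case using row0 row0' r by simp
  next
    case (Suc i)
    then have IH: "\<And>j. j \<le> N \<Longrightarrow> \<mu> i j \<in> B" "\<And>j. j \<le> N \<Longrightarrow> f (\<mu> i j) = l i j"
      "\<And>j. j < N \<Longrightarrow> nb (\<mu> i j) (\<mu> i (Suc j))" by auto
    have v: "nb (\<mu> i j) (\<mu> (Suc i) j)" "f (\<mu> (Suc i) j) = l (Suc i) j" if "j \<le> N" for j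
      using transport[of "\<mu> i j" "l (Suc i) j"] IH(1,2)[OF that] near1[of i j "Suc i" j] Suc.prems that r by auto
    have h: "nb (\<mu> (Suc i) j) (\<mu> (Suc i) (Suc j))" if j: "j < N" for j
    proof -
      \<comment> \<open>This is the diagonal of the grid square; the two applications of
        \<open>nb_triangle\<close> treat the triangles on its two sides.\<close>
      have "nb (\<mu> i (Suc j)) (\<mu> (Suc i) j)"
        by (rule nb_triangle[OF IH(3)[OF j] v(1)])
          (use j v(2)[of j] IH(2)[of "Suc j"] near1[of i "Suc j" "Suc i" j] Suc.prems in auto)
      then show ?thesis
        by (rule nb_triangle[OF _ v(1)[of "Suc j"]])
          (use j v(2)[of j] v(2)[of "Suc j"] near1[of "Suc i" j "Suc i" "Suc j"] Suc.prems in auto)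
    qed
    have "\<mu> (Suc i) j \<in> B" if "j \<le> N" for j using v(1)[OF that] by (simp add: nb_def)
    then show ?case using v(2) h by blast
  qed
  have f\<mu>: "f (\<mu> i j) = l i j" if "i \<le> N" "j \<le> N" for i j using rows that by blast
  \<comment> \<open>In the last row all labels agree, so neighbouring lifts agree.\<close>
  have "j \<le> N \<Longrightarrow> \<mu> N j = \<mu> N 0" for j
  proof (induction j)
    case (Suc j)
    have "nb (\<mu> N j) (\<mu> N (Suc j))" using rows[of N] Suc.prems by simp
    moreover have "nb (\<mu> N j) (\<mu> N j)" using rows[of N] Suc.prems by (simp add: nb_def)
    ultimately have "\<mu> N (Suc j) = \<mu> N j"
      using nb_unique[of "\<mu> N j" "\<mu> N (Suc j)" "\<mu> N j"] f\<mu>[of N j] f\<mu>[of N "Suc j"]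
        top[of j] top[of "Suc j"] Suc.prems by simp
    then show ?case using Suc by simp
  qed simp
  from this[of N] have NN: "\<mu> N 0 = \<mu> N N" by simp
  \<comment> \<open>Induction outwards from the centre: the two ends of a row are neighbours of the
    same vertex of the next row and have the same label.\<close>
  have "k \<le> N \<Longrightarrow> \<mu> (N - k) 0 = \<mu> (N - k) N" for k
  proof (induction k)
    case (Suc k)
    define i where "i = N - Suc k"
    have i: "Suc i = N - k" "Suc i \<le> N" using Suc.prems by (auto simp: i_def)
    have v: "nb (\<mu> (Suc i) j) (\<mu> i j)" if "j \<le> N" for j
    proof (rule nb_sym)
      have "\<mu> i j \<in> B" "f (\<mu> i j) = l i j" using rows[of i] i that by auto
      then show "nb (\<mu> i j) (\<mu> (Suc i) j)"
        unfolding r using transport(1)[of "\<mu> i j" "l (Suc i) j"] near1[of i j "Suc i" j] i that by simp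
    qed
    have "nb (\<mu> (Suc i) 0) (\<mu> i N)" using v[of N] Suc i by simp
    then show ?case
      using nb_unique[OF v[of 0], of "\<mu> i N"] f\<mu>[of i] sides[of i] i by (simp add: i_def)
  qed (use NN in simp)
  from this[of N] have "\<mu>0 0 = \<mu>0 N" using r(1) by simp
  then have "\<mu>0 N = a" using r0(1) by simp
  moreover have "f (\<mu>0 j) = l 0 j" if "j \<le> N" for j using row0[OF that] by blast
  ultimately show ?thesis by (intro that[of \<mu>0] r0(1) row0')
qed

end

section \<open>The union of the partial covers\<close>

context conn_graph
begin

primrec cover :: "'a \<Rightarrow> nat \<Rightarrow> 'a list set \<times> 'a list rel" where
  "cover v 0 = ({[v]}, {})"
| "cover v (Suc n) = (next_verts n (fst (cover v n)) (snd (cover v n)), next_edges n (fst (cover v n)) (snd (cover v n)))"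

lemma cover_partial:
  assumes "C4_free V E" "W5_hat_condition V E" "v \<in> V"
  shows "partial_cover V E v n (fst (cover v n)) (snd (cover v n))"
proof (induction n)
  case 0
  show ?case by unfold_locales (use assms in auto)
next
  case (Suc n)
  then interpret partial_cover V E v n "fst (cover v n)" "snd (cover v n)" .
  show ?case using next_partial_cover by simp
qed

text \<open>The stages increase, and each required property involves finitely many vertices and
  edges, so it can be read off at one sufficiently late stage.\<close>

lemma graph_cover_exists:
  assumes "C4_free V E" "W5_hat_condition V E" "v \<in> V"
  shows "\<exists>B A. graph_cover V E hd (\<lambda>w. length w - 1) [v] B A"
proof -
  let ?B = "\<lambda>n. fst (cover v n)" and ?A = "\<lambda>n. snd (cover v n)"
  define B where "B = (\<Union>n. ?B n)"
  define A where "A = (\<Union>n. ?A n)"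
  have P: "partial_cover V E v n (?B n) (?A n)" for n using cover_partial assms by blast
  have B_mono: "?B i \<subseteq> ?B j" if "i \<le> j" for i j
    by (rule lift_Suc_mono_le[OF _ that]) (simp add: next_verts_def)
  have A_mono: "?A i \<subseteq> ?A j" if "i \<le> j" for i j
    by (rule lift_Suc_mono_le[OF _ that]) (simp add: next_edges_def le_infI1 sup.coboundedI1)
  have A1: "\<exists>n. (a, b) \<in> ?A n" if "(a, b) \<in> A" for a b using that by (auto simp: A_def)
  have A2: "\<exists>n. (a, b) \<in> ?A n \<and> (a', b') \<in> ?A n" if "(a, b) \<in> A" "(a', b') \<in> A" for a b a' b'
  proof -
    obtain i j where "(a, b) \<in> ?A i" "(a', b') \<in> ?A j" 
      using A1[OF \<open>(a, b) \<in> A\<close>] A1[OF \<open>(a', b') \<in> A\<close>] by blast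
    then have "(a, b) \<in> ?A (max i j)" "(a', b') \<in> ?A (max i j)" using A_mono[of i "max i j"] A_mono[of j "max i j"] by auto
    then show ?thesis by blast
  qed
  have AI: "(a, b) \<in> ?A n \<Longrightarrow> (a, b) \<in> A" for a b n by (auto simp: A_def)
  have B_ne: "w \<noteq> []" if "w \<in> B" for w using that partial_cover.B_len[OF P] by (auto simp: B_def)
  have A_B: "a \<in> B \<and> b \<in> B" if "(a, b) \<in> A" for a b
    using A1[OF that] partial_cover.A_B[OF P] by (force simp: B_def)
  have len: "Suc (length w - 1) = length w" if "w \<in> B" for w using B_ne[OF that] by (cases w) auto
  have "graph_cover V E hd (\<lambda>w. length w - 1) [v] B A"
  proof unfold_locales
    show "hd w \<in> V" if "w \<in> B" for w using that partial_cover.B_V[OF P] by (auto simp: B_def)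
    show "a \<in> B \<and> b \<in> B" if "(a, b) \<in> A" for a b using A_B[OF that] .
    show "(b, a) \<in> A" if "(a, b) \<in> A" for a b
      using A1[OF that] partial_cover.A_sym[OF P] AI by blast
    show "(hd a, hd b) \<in> E" if "(a, b) \<in> A" for a b
      using A1[OF that] partial_cover.A_hom[OF P] by blast
    show "length a - 1 \<le> Suc (length b - 1)" if "(a, b) \<in> A" for a b
      using A1[OF that] partial_cover.A_len[OF P, of a b] by force
    show "[v] \<in> B" using partial_cover.root[OF P] by (auto simp: B_def)
    show "length [v] - 1 = 0" by simp
    show "w = [v]" if "w \<in> B" "length w - 1 = 0" for w
    proof -
      obtain n where "w \<in> ?B n" using \<open>w \<in> B\<close> by (auto simp: B_def)
      moreover have "length w = Suc 0" using len[OF that(1)] that(2) by simp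
      ultimately show ?thesis using partial_cover.B_1[OF P] by blast
    qed
    show "\<exists>u. (u, w) \<in> A \<and> length u - 1 = n" if "w \<in> B" "length w - 1 = Suc n" for w n
    proof -
      obtain k where k: "w \<in> ?B k" using \<open>w \<in> B\<close> by (auto simp: B_def)
      moreover have "length w \<noteq> Suc 0" using that(2) by auto
      ultimately obtain u where "(u, w) \<in> ?A k" "Suc (length u) = length w"
        using partial_cover.parent[OF P] by blast
      then show ?thesis using AI that(2) by (intro exI[of _ u]) auto
    qed
    show "a = b" if "(a, w) \<in> A" "(b, w) \<in> A" "hd a = hd b" for a b w
      using A2[OF that(1,2)] partial_cover.inj[OF P _ _ that(3)] by blast
    show "(a, b) \<in> A" if "(a, w) \<in> A" "(b, w) \<in> A" "(hd a, hd b) \<in> E" for a b w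
      using A2[OF that(1,2)] partial_cover.full[OF P _ _ that(3)] AI by blast
    show "\<exists>a. (a, w) \<in> A \<and> hd a = z" if "w \<in> B" "(hd w, z) \<in> E" for w z
    proof -
      obtain k where k: "w \<in> ?B k" using \<open>w \<in> B\<close> by (auto simp: B_def)
      \<comment> \<open>From stage \<open>length w\<close> on, \<open>w\<close> is an inner vertex
        and has all its neighbours.\<close>
      then have "w \<in> ?B (max k (length w))" using B_mono[of k "max k (length w)"] by auto
      then obtain a where "(a, w) \<in> ?A (max k (length w))" "hd a = z"
        using partial_cover.surj[OF P _ _ \<open>(hd w, z) \<in> E\<close>] by force
      then show ?thesis using AI by blast
    qed
    show "a = b \<or> (a, b) \<in> A" if "(a, w) \<in> A" "(b, w) \<in> A" "Suc (length a - 1) = length w - 1"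
      "Suc (length b - 1) = length w - 1" for a b w
    proof -
      have "Suc (length a) = length w" "Suc (length b) = length w"
        using len[of a] len[of b] len[of w] A_B[OF that(1)] A_B[OF that(2)] that(3,4) by auto
      then show ?thesis using A2[OF that(1,2)] partial_cover.lower[OF P] AI by blast
    qed
    show "\<exists>u. (u, w) \<in> A \<and> (u, w') \<in> A \<and> Suc (length u - 1) = length w - 1"
      if "(w, w') \<in> A" "length w - 1 = length w' - 1" for w w'
    proof -
      have "w \<in> B" "w' \<in> B" using A_B[OF that(1)] by auto
      then have "length w = length w'" using len[of w] len[of w'] that(2) by linarith
      moreover obtain k where "(w, w') \<in> ?A k" using A1[OF \<open>(w, w') \<in> A\<close>] by blast
      ultimately obtain u where u: "(u, w) \<in> ?A k" "(u, w') \<in> ?A k" "Suc (length u) = length w"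
        using partial_cover.common[OF P, of w w' k] by blast
      have "u \<in> B" using A_B AI u(1) by blast
      then have "Suc (length u - 1) = length w - 1" using len[of u] u(3) by simp
      then show ?thesis using AI u by blast
    qed
  qed
  then show ?thesis by blast
qed

end

section \<open>Monodromy over the disc\<close>

context flag_complex
begin

text \<open>The walk \<open>c\<close> traversed linearly in the realization. Step \<open>i\<close>
  has a piecewise linear bump of height 1 centred at time \<open>i / m\<close>, and the sum accounts
  for vertices that are visited repeatedly.\<close>

definition walk_point :: "(nat \<Rightarrow> 'a) \<Rightarrow> nat \<Rightarrow> real \<Rightarrow> 'a \<Rightarrow> real" where
  "walk_point c m t u = (\<Sum>i\<le>m. if c i = u then max 0 (1 - \<bar>real m * t - real i\<bar>) else 0)"

lemma walk_point_local:
  assumes "k < m" "real k \<le> real m * t" "real m * t \<le> real (Suc k)"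
  shows "walk_point c m t u = (if c k = u then 1 - (real m * t - real k) else 0) +
    (if c (Suc k) = u then real m * t - real k else 0)"
proof -
  have "walk_point c m t u = (\<Sum>i\<in>{k, Suc k}. if c i = u then max 0 (1 - \<bar>real m * t - real i\<bar>) else 0)"
    unfolding walk_point_def
  proof (rule sum.mono_neutral_right)
    show "\<forall>i\<in>{..m} - {k, Suc k}. (if c i = u then max 0 (1 - \<bar>real m * t - real i\<bar>) else 0) = 0"
    proof
      fix i assume i: "i \<in> {..m} - {k, Suc k}"
      then have "i < k \<or> Suc k < i" by auto
      then have "real i \<le> real k - 1 \<or> real (Suc k) + 1 \<le> real i" by auto
      then have "1 \<le> \<bar>real m * t - real i\<bar>" using assms by linarith
      then show "(if c i = u then max 0 (1 - \<bar>real m * t - real i\<bar>) else 0) = 0" by simp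
    qed
  qed (use assms in auto)
  also have "\<dots> = (if c k = u then 1 - (real m * t - real k) else 0) +
      (if c (Suc k) = u then real m * t - real k else 0)"
    using assms(2,3) by simp
  finally show ?thesis .
qed

lemma segment_index:
  assumes "0 < m" "t \<in> {0..1::real}"
  obtains k where "k < m" "real k \<le> real m * t" "real m * t \<le> real (Suc k)"
proof (cases "t = 1")
  case True
  \<comment> \<open>At time 1 the floor would be \<open>m\<close>; the end point is assigned to the
    last segment.\<close>
  show ?thesis by (rule that[of "m - 1"]) (use True assms(1) in auto)
next
  case False
  define k where "k = nat \<lfloor>real m * t\<rfloor>"
  have "0 \<le> real m * t" using assms by simp
  then have k: "real k \<le> real m * t" "real m * t \<le> real (Suc k)" unfolding k_def by linarith+
  have "real m * t < real m * 1" using False assms by (intro mult_strict_left_mono) auto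
  then have "k < m" using k(1) by simp
  then show ?thesis using that k by blast
qed

lemma walk_point_realization:
  assumes "0 < m" "\<And>k. k < m \<Longrightarrow> (c k, c (Suc k)) \<in> edges X" "t \<in> {0..1}"
  shows "walk_point c m t \<in> realization_points X"
proof -
  obtain k where k: "k < m" "real k \<le> real m * t" "real m * t \<le> real (Suc k)"
    using segment_index[OF assms(1,3)] .
  define x where "x = real m * t - real k"
  have x: "0 \<le> x" "x \<le> 1" using k by (auto simp: x_def)
  have p: "walk_point c m t u = (if c k = u then 1 - x else 0) + (if c (Suc k) = u then x else 0)" for u
    unfolding x_def by (rule walk_point_local[OF k])
  have e: "(c k, c (Suc k)) \<in> edges X" by (rule assms(2)[OF k(1)])
  then have ne: "c k \<noteq> c (Suc k)" using adj_irrefl by metis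
  have "{u. walk_point c m t u \<noteq> 0} = (if x \<noteq> 1 then {c k} else {}) \<union> (if x \<noteq> 0 then {c (Suc k)} else {})"
    using ne by (auto simp: p)
  then have supp: "{u. walk_point c m t u \<noteq> 0} \<subseteq> {c k, c (Suc k)}" "{u. walk_point c m t u \<noteq> 0} \<noteq> {}" by auto
  have "c k \<in> vertices X" "c (Suc k) \<in> vertices X" "(c (Suc k), c k) \<in> edges X"
    using e adj_V adj_sym by blast+
  then have "{c k, c (Suc k)} \<in> X"
    unfolding simplex_iff using e by simp
  then have "{u. walk_point c m t u \<noteq> 0} \<in> X" using face supp by blast
  moreover have "(\<Sum>u\<in>{u. walk_point c m t u \<noteq> 0}. walk_point c m t u) = (\<Sum>u\<in>{c k, c (Suc k)}. walk_point c m t u)"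
    by (rule sum.mono_neutral_left) (use supp in auto)
  moreover have "\<dots> = 1" using ne by (simp add: p)
  ultimately show ?thesis unfolding realization_points_def using x by (simp add: p)
qed

lemma walk_point_continuous:
  assumes "0 < m" "\<And>k. k < m \<Longrightarrow> (c k, c (Suc k)) \<in> edges X"
  shows "continuous_map (top_of_set {0..1}) (realization X) (walk_point c m)"
proof (rule continuous_map_into_realization[where F = "c ` {..m}"])
  show "finite (c ` {..m})" by simp
  show "walk_point c m t \<in> realization_points X" if "t \<in> topspace (top_of_set {0..1})" for t
    using walk_point_realization[of m c t] assms that by simp
  show "u \<in> c ` {..m}" if "walk_point c m t u \<noteq> 0" for t u
  proof (rule ccontr)
    assume "u \<notin> c ` {..m}"
    then have "walk_point c m t u = 0" unfolding walk_point_def by (intro sum.neutral) auto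
    then show False using that by simp
  qed
  fix u
  have "continuous_on {0..1} (\<lambda>t. if c i = u then max 0 (1 - \<bar>real m * t - real i\<bar>) else 0)" for i
    by (cases "c i = u") (auto intro!: continuous_intros)
  then have "continuous_on {0..1} (\<lambda>t. walk_point c m t u)"
    unfolding walk_point_def by (intro continuous_on_sum)
  then show "continuous_map (top_of_set {0..1}) euclideanreal (\<lambda>t. walk_point c m t u)" by simp
qed

lemma walk_extends:
  assumes sc: "simply_connected_space (realization X)"
    and m: "0 < m" "\<And>k. k < m \<Longrightarrow> (c k, c (Suc k)) \<in> edges X" and closed: "c 0 = c m"
  obtains g where "continuous_map (top_of_set (cball (0::complex) 1)) (realization X) g"
    "\<And>t. t \<in> {0..1} \<Longrightarrow> g (unit_polar (0, t)) = walk_point c m t"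
proof -
  have "walk_point c m 0 = walk_point c m 1"
  proof
    fix u
    have "walk_point c m 0 u = (if c 0 = u then 1 else 0)"
      using walk_point_local[of 0 m 0 c u] m(1) by simp
    moreover have "walk_point c m 1 u = (if c m = u then 1 else 0)"
      using walk_point_local[of "m - 1" m 1 c u] m(1) by simp
    ultimately show "walk_point c m 0 u = walk_point c m 1 u" using closed by simp
  qed
  then have "walk_point c m x = walk_point c m y"
    if "x \<in> topspace (top_of_set {0..1})" "y \<in> topspace (top_of_set {0..1})"
      "unit_polar (0, x) = unit_polar (0, y)" for x y
    using unit_polar_eq[of 0 x 0 y] that by (auto simp: doubleton_eq_iff)
  then obtain f where f: "continuous_map (top_of_set (sphere 0 1)) (realization X) f"
    "\<And>t. t \<in> topspace (top_of_set {0..1}) \<Longrightarrow> f (unit_polar (0, t)) = walk_point c m t"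
    using quotient_map_lift_exists[OF quotient_map_unit_circle walk_point_continuous[of m c]] m by metis
  then obtain g where g: "continuous_map (top_of_set (cball (0::complex) 1)) (realization X) g"
    "\<forall>z\<in>sphere 0 1. g z = f z"
    using sc unfolding simply_connected_space_def by blast
  show ?thesis
  proof (rule that[OF g(1)])
    fix t :: real assume "t \<in> {0..1}"
    then show "g (unit_polar (0, t)) = walk_point c m t"
      using g(2) f(2)[of t] by (simp add: unit_polar_norm)
  qed
qed

text \<open>A Lebesgue number for the preimages of the open stars. The label of \<open>z\<close>
  lies in the support of every point near \<open>z\<close>, not only of \<open>z\<close>, so labels
  of neighbouring grid points occur in a common support and are equal or adjacent.\<close>

lemma disc_labelling:
  assumes g: "continuous_map (top_of_set (cball (0::complex) 1)) (realization X) g"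
  obtains \<epsilon> l where "0 < \<epsilon>" "\<And>z z'. z \<in> cball 0 1 \<Longrightarrow> z' \<in> cball 0 1 \<Longrightarrow> dist z z' < \<epsilon> \<Longrightarrow> g z' (l z) \<noteq> 0"
proof -
  define S where "S u = {z \<in> cball 0 1. g z u \<noteq> 0}" for u
  have "openin (top_of_set (cball 0 1)) (S u)" for u
  proof -
    have "openin (realization X) {p \<in> realization_points X. p u \<in> - {0}}"
      by (rule openin_realization_coordinate) auto
    from openin_continuous_map_preimage[OF g this] show ?thesis
      using continuous_map_image_subset_topspace[OF g] by (auto simp: S_def image_subset_iff elim: back_subst[of "openin _"])
  qed
  then have "\<exists>O'. open O' \<and> S u = cball 0 1 \<inter> O'" for u by (simp add: openin_open)
  then obtain O' where O': "\<And>u. open (O' u)" "\<And>u. S u = cball 0 1 \<inter> O' u" by metis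
  have "cball 0 1 \<subseteq> \<Union>(range O')"
  proof
    fix z :: complex assume z: "z \<in> cball 0 1"
    then have "g z \<in> realization_points X"
      using continuous_map_image_subset_topspace[OF g] by auto
    then have "{u. g z u \<noteq> 0} \<in> X" by (simp add: realization_points_def)
    from simplexD(1)[OF this] obtain u where "g z u \<noteq> 0" by blast
    then have "z \<in> S u" using z by (simp add: S_def)
    then show "z \<in> \<Union>(range O')" using O'(2) by blast
  qed
  then obtain \<epsilon> where \<epsilon>: "0 < \<epsilon>" "\<And>z. z \<in> cball 0 1 \<Longrightarrow> \<exists>G\<in>range O'. ball z \<epsilon> \<subseteq> G"
    using Heine_Borel_lemma[of "cball (0::complex) 1" "range O'"] O'(1) compact_cball by blast
  define l where "l z = (SOME u. ball z \<epsilon> \<subseteq> O' u)" for z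
  have l: "ball z \<epsilon> \<subseteq> O' (l z)" if "z \<in> cball 0 1" for z
  proof -
    obtain u where "ball z \<epsilon> \<subseteq> O' u" using \<epsilon>(2)[OF \<open>z \<in> cball 0 1\<close>] by blast
    then show ?thesis unfolding l_def by (rule someI)
  qed
  show ?thesis
  proof (rule that[OF \<epsilon>(1)])
    fix z z' :: complex assume z: "z \<in> cball 0 1" "z' \<in> cball 0 1" "dist z z' < \<epsilon>"
    then have "z' \<in> S (l z)" using l[OF z(1)] O'(2)[of "l z"] by auto
    then show "g z' (l z) \<noteq> 0" by (simp add: S_def)
  qed
qed

text \<open>A walk in the cover between two points \<open>a\<close>, \<open>b\<close> of one fibre
  projects to a closed walk, which bounds a disc. The labels on the boundary of the disc trace this
  walk, so their lift from \<open>a\<close> traces the given walk upstairs and ends at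
  \<open>b\<close>; by \<open>grid_monodromy\<close> it ends at \<open>a\<close>.\<close>

lemma simply_connected_cover_inj:
  assumes sc: "simply_connected_space (realization X)"
    and cover: "graph_cover (vertices X) (edges X) f lev r B A"
  shows "inj_on f B"
proof (rule inj_onI)
  interpret C: graph_cover "vertices X" "edges X" f lev r B A by (rule cover)
  fix a b assume ab: "a \<in> B" "b \<in> B" "f a = f b"
  obtain m where "(a, b) \<in> A ^^ m" using C.walk_connected[OF ab(1,2)] by blast
  then obtain s where s: "s 0 = a" "s m = b" "\<And>k. k < m \<Longrightarrow> (s k, s (Suc k)) \<in> A"
    unfolding relpow_fun_conv by blast
  show "a = b"
  proof (cases "m = 0")
    case True
    then show ?thesis using s by simp
  next
    case False
    then have m: "0 < m" by simp
    define c where "c k = f (s k)" for k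
    have ce: "(c k, c (Suc k)) \<in> edges X" if "k < m" for k using C.A_hom[OF s(3)[OF that]] by (simp add: c_def)
    have cc: "c 0 = c m" using s ab by (simp add: c_def)
    have cne: "c k \<noteq> c (Suc k)" if "k < m" for k using ce[OF that] adj_irrefl by metis
    obtain g where g: "continuous_map (top_of_set (cball (0::complex) 1)) (realization X) g"
      "\<And>t. t \<in> {0..1} \<Longrightarrow> g (unit_polar (0, t)) = walk_point c m t"
      using walk_extends[of m c] sc m ce cc by blast
    obtain \<epsilon> l where \<epsilon>: "0 < \<epsilon>"
      "\<And>z z'. z \<in> cball 0 1 \<Longrightarrow> z' \<in> cball 0 1 \<Longrightarrow> dist z z' < \<epsilon> \<Longrightarrow> g z' (l z) \<noteq> 0"
      using disc_labelling[OF g(1)] by blast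
    have "uniformly_continuous_on ({0..1} \<times> {0..1}) unit_polar"
      by (intro compact_uniformly_continuous unit_polar_continuous compact_Times) auto
    then obtain \<delta> where \<delta>: "0 < \<delta>" "\<And>x y. x \<in> {0..1} \<times> {0..1} \<Longrightarrow> y \<in> {0..1} \<times> {0..1} \<Longrightarrow> dist y x < \<delta> \<Longrightarrow>
        dist (unit_polar y) (unit_polar x) < \<epsilon>"
      unfolding uniformly_continuous_on_def using \<epsilon>(1) by meson
    \<comment> \<open>The factor 2 arises because neighbouring grid points differ by at most one
      step in each of the two coordinates.\<close>
    obtain M :: nat where "max 1 (2 / \<delta>) < real M" using reals_Archimedean2 by blast
    then have M: "0 < M" "2 / \<delta> < real M" by auto
    \<comment> \<open>A multiple of \<open>m\<close>, so that every vertex of the walk is at a grid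
      point, with \<open>M\<close> grid steps along each edge.\<close>
    define N where "N = m * M"
    have N0: "0 < N" using m M by (simp add: N_def)
    have "M \<le> N" using m by (simp add: N_def)
    then have N: "2 / real N < \<delta>"
    proof -
      have "2 / \<delta> < real N" using M(2) \<open>M \<le> N\<close> by linarith
      then show ?thesis using \<delta>(1) N0 by (simp add: field_simps)
    qed
    define P where "P i j = unit_polar (real i / real N, real j / real N)" for i j
    define L where "L i j = l (P i j)" for i j
    have unit: "real i / real N \<in> {0..1}" if "i \<le> N" for i using that N0 by simp
    have Pb: "P i j \<in> cball 0 1" if "i \<le> N" for i j
      unfolding P_def using unit[OF that] by (simp add: unit_polar_norm)
    have near_pt: "g (P i j) (L i' j') \<noteq> 0"
      if "i \<le> N" "j \<le> N" "i' \<le> N" "j' \<le> N" "i' \<le> Suc i" "i \<le> Suc i'" "j' \<le> Suc j" "j \<le> Suc j'" for i j i' j'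
    proof -
      have d1: "\<bar>real x / real N - real y / real N\<bar> \<le> 1 / real N" if "x \<le> Suc y" "y \<le> Suc x" for x y
      proof -
        have "\<bar>real x - real y\<bar> \<le> 1" using that by linarith
        then have "\<bar>real x - real y\<bar> / real N \<le> 1 / real N" using N0 by (intro divide_right_mono) auto
        then show ?thesis using N0 by (simp flip: diff_divide_distrib)
      qed
      have "dist (real i' / real N, real j' / real N) (real i / real N, real j / real N)
          \<le> \<bar>real i' / real N - real i / real N\<bar> + \<bar>real j' / real N - real j / real N\<bar>"
        unfolding dist_Pair_Pair dist_real_def by (rule order_trans[OF sqrt_sum_squares_le_sum_abs]) simp
      also have "\<dots> \<le> 1 / real N + 1 / real N" by (intro add_mono d1 that)
      also have "\<dots> < \<delta>" using N by simp
      finally have "dist (P i' j') (P i j) < \<epsilon>"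
        unfolding P_def using \<delta>(2)[of "(real i / real N, real j / real N)" "(real i' / real N, real j' / real N)"]
          unit that by simp
      then show ?thesis unfolding L_def using \<epsilon>(2) Pb that by blast
    qed
    have adj: "C.near u v" if "g (P i j) u \<noteq> 0" "g (P i j) v \<noteq> 0" "i \<le> N" for i j u v
    proof -
      have "g (P i j) \<in> realization_points X"
        using continuous_map_image_subset_topspace[OF g(1)] Pb[OF that(3)] by auto
      then have "{u. g (P i j) u \<noteq> 0} \<in> X" by (simp add: realization_points_def)
      from simplexD(3)[OF this, of u v] show ?thesis using that unfolding C.near_def by blast
    qed
    have bd: "g (P 0 j) = walk_point c m (real j / real N)" if "j \<le> N" for j
      using g(2)[OF unit[OF that]] by (simp add: P_def)
    have mt: "real m * (real j / real N) = real j / real M" for j using m M by (simp add: N_def)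
    have seg: "real k \<le> real m * (real j / real N)" "real m * (real j / real N) \<le> real (Suc k)"
      if "k * M \<le> j" "j \<le> Suc k * M" for k j
    proof -
      have "real (k * M) \<le> real j" "real j \<le> real (Suc k * M)" using that of_nat_mono by blast+
      then show "real k \<le> real m * (real j / real N)" "real m * (real j / real N) \<le> real (Suc k)"
        unfolding mt using M(1) by (simp_all add: field_simps)
    qed
    have lab: "L 0 j = c k \<or> L 0 j = c (Suc k)" if "k < m" "k * M \<le> j" "j \<le> Suc k * M" "j \<le> N" for k j
    proof -
      have "walk_point c m (real j / real N) (L 0 j) \<noteq> 0" using near_pt[of 0 j 0 j] bd that by simp
      then show ?thesis using walk_point_local[OF that(1) seg[OF that(2,3)], of c "L 0 j"] by (auto split: if_splits)
    qed
    \<comment> \<open>At these grid points the loop is at a vertex of the complex, whose support is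
      a single vertex, so the label is forced.\<close>
    have lab_vertex: "L 0 (k * M) = c k" if "k \<le> m" for k
    proof -
      have kN: "k * M \<le> N" using that by (simp add: N_def)
      have w: "walk_point c m (real (k * M) / real N) (L 0 (k * M)) \<noteq> 0" using near_pt[of 0 "k * M" 0 "k * M"] bd kN by simp
      have mk: "real m * (real (k * M) / real N) = real k" unfolding mt using M(1) by simp
      show ?thesis
      proof (cases "k = m")
        case False
        then have "k < m" using that by simp
        from walk_point_local[OF this seg[of k "k * M"], of c "L 0 (k * M)", unfolded mk] w
        show ?thesis by (auto split: if_splits)
      next
        case True
        then obtain k' where k': "k = Suc k'" "k' < m" using m by (cases k) auto
        then have "k' * M \<le> k * M" "k * M \<le> Suc k' * M" by auto
        from walk_point_local[OF k'(2) seg[OF this], of c "L 0 (k * M)", unfolded mk] w k'(1)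
        show ?thesis by (auto split: if_splits)
      qed
    qed
    obtain \<mu> where \<mu>: "\<mu> 0 = a" "\<mu> N = a" "\<And>j. j \<le> N \<Longrightarrow> f (\<mu> j) = L 0 j" "\<And>j. j < N \<Longrightarrow> C.nb (\<mu> j) (\<mu> (Suc j))"
    proof (rule C.grid_monodromy[of N L a])
      fix i j i' j' assume h: "i \<le> N" "j \<le> N" "i' \<le> N" "j' \<le> N" "i' \<le> Suc i" "i \<le> Suc i'" "j' \<le> Suc j" "j \<le> Suc j'"
      show "C.near (L i j) (L i' j')"
        using adj[OF near_pt[of i j i j] near_pt[of i j i' j']] h by simp
    next
      fix i
      show "L i 0 = L i N" using N0 by (simp add: L_def P_def unit_polar_def)
    next
      fix j
      show "L N j = L N 0" using N0 by (simp add: L_def P_def unit_polar_def)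
    next
      show "f a = L 0 0" using lab_vertex[of 0] s by (simp add: c_def)
    qed (use ab in auto)
    have sB: "s k \<in> B" if "k \<le> m" for k
      using that C.A_B[OF s(3)[of k]] s(2) ab by (cases "k = m") auto
    have nbs: "C.nb x y" if "k < m" "x \<in> {s k, s (Suc k)}" "y \<in> {s k, s (Suc k)}" for k x y
      using that s(3)[OF that(1)] C.A_sym[OF s(3)[OF that(1)]] sB[of k] sB[of "Suc k"] unfolding C.nb_def by auto
    \<comment> \<open>Along one edge of the walk the labels are its two ends, and their lifts next
      to the current vertex are unique; so the lift never leaves the corresponding edge
      upstairs.\<close>
    have step: "\<mu> (Suc j) \<in> {s k, s (Suc k)}"
      if k: "k < m" "k * M \<le> j" "Suc j \<le> Suc k * M" and j: "\<mu> j \<in> {s k, s (Suc k)}" and jN: "Suc j \<le> N" for k j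
    proof -
      have "f (\<mu> (Suc j)) = c k \<or> f (\<mu> (Suc j)) = c (Suc k)"
        using lab[of k "Suc j"] \<mu>(3)[of "Suc j"] k jN by simp
      then have "\<exists>y\<in>{s k, s (Suc k)}. f y = f (\<mu> (Suc j))" unfolding c_def by auto
      then obtain y where y: "y \<in> {s k, s (Suc k)}" "f y = f (\<mu> (Suc j))" by blast
      have "C.nb (\<mu> j) y" using nbs[OF k(1) j y(1)] .
      moreover have "C.nb (\<mu> j) (\<mu> (Suc j))" using \<mu>(4) jN by simp
      ultimately have "y = \<mu> (Suc j)" using C.nb_unique y(2) by blast
      then show ?thesis using y by simp
    qed
    \<comment> \<open>At the end of the edge the label is \<open>c (Suc k)\<close>, which differs
      from \<open>c k\<close>; this decides between the two ends upstairs.\<close>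
    have follow: "\<mu> (k * M) = s k" if "k \<le> m" for k
      using that
    proof (induction k)
      case 0
      then show ?case using \<mu>(1) s(1) by simp
    next
      case (Suc k)
      then have k: "k < m" and IH: "\<mu> (k * M) = s k" by auto
      have SN: "Suc k * M \<le> N" using k unfolding N_def by (intro mult_le_mono1) simp
      have "r \<le> M \<Longrightarrow> \<mu> (k * M + r) \<in> {s k, s (Suc k)}" for r
      proof (induction r)
        case 0
        then show ?case using IH by simp
      next
        case (Suc r)
        then have "\<mu> (k * M + r) \<in> {s k, s (Suc k)}" by simp
        then show ?case using step[OF k, of "k * M + r"] Suc.prems SN by simp
      qed
      from this[of M] have "\<mu> (Suc k * M) \<in> {s k, s (Suc k)}" by (simp add: add.commute)
      moreover have "f (\<mu> (Suc k * M)) = f (s (Suc k))"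
        using \<mu>(3)[OF SN] lab_vertex[OF Suc.prems] by (simp add: c_def)
      moreover have "f (s k) \<noteq> f (s (Suc k))" using cne[OF k] by (simp add: c_def)
      ultimately show ?case by auto
    qed
    show ?thesis using follow[of m] \<mu>(2) s(2) by (simp add: N_def)
  qed
qed

lemma simply_connected_VE:
  assumes "simply_connected_space (realization X)" "W5_hat_condition (vertices X) (edges X)"
    and "C4_free (vertices X) (edges X)"
  shows VE
  unfolding VE_def
proof
  fix v assume v: "v \<in> vertices X"
  obtain B A where C: "graph_cover (vertices X) (edges X) hd (\<lambda>w. length w - 1) [v] B A"
    using graph_cover_exists[OF assms(3,2) v] by blast
  then interpret C: graph_cover "vertices X" "edges X" hd "\<lambda>w. length w - 1" "[v]" B A .
  have "inj_on hd B" by (rule simply_connected_cover_inj[OF assms(1) C])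
  then show "Vcond v \<and> Econd v" using C.Vcond_root C.Econd_root by simp
qed

section \<open>Links and the equivalence of the conditions\<close>

lemma mem_link: "u \<in> vertices (link \<sigma> X) \<longleftrightarrow> u \<notin> \<sigma> \<and> insert u \<sigma> \<in> X" if \<sigma>: "\<sigma> \<in> X"
proof
  assume "u \<in> vertices (link \<sigma> X)"
  then obtain \<tau> where \<tau>: "u \<in> \<tau>" "\<sigma> \<inter> \<tau> = {}" "\<sigma> \<union> \<tau> \<in> X" by (auto simp: vertices_def link_def)
  have "insert u \<sigma> \<subseteq> \<sigma> \<union> \<tau>" using \<tau>(1) by blast
  then show "u \<notin> \<sigma> \<and> insert u \<sigma> \<in> X" using face[OF \<tau>(3)] \<tau> by blast
next
  assume u: "u \<notin> \<sigma> \<and> insert u \<sigma> \<in> X"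
  then have "{u} \<in> X" using face[of "insert u \<sigma>" "{u}"] by blast
  then have "{u} \<in> link \<sigma> X" using u by (simp add: link_def)
  then show "u \<in> vertices (link \<sigma> X)" by (auto simp: vertices_def)
qed

lemma mem_link_adj:
  assumes \<sigma>: "\<sigma> \<in> X" shows "u \<in> vertices (link \<sigma> X) \<longleftrightarrow> (\<forall>x\<in>\<sigma>. (u, x) \<in> edges X)"
proof
  assume "u \<in> vertices (link \<sigma> X)"
  then have u: "u \<notin> \<sigma>" "insert u \<sigma> \<in> X" using mem_link[OF \<sigma>] by auto
  show "\<forall>x\<in>\<sigma>. (u, x) \<in> edges X"
  proof
    fix x assume "x \<in> \<sigma>"
    then show "(u, x) \<in> edges X" using simplexD(3)[OF u(2), of u x] u(1) by auto
  qed
next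
  assume u: "\<forall>x\<in>\<sigma>. (u, x) \<in> edges X"
  then have n: "u \<notin> \<sigma>" using adj_irrefl by blast
  have "u \<in> vertices X" using u simplexD(1)[OF \<sigma>] adj_V by blast
  then have "insert u \<sigma> \<in> X"
    unfolding simplex_iff using u adj_sym simplexD(2,3)[OF \<sigma>] by blast
  then show "u \<in> vertices (link \<sigma> X)" using mem_link[OF \<sigma>] n by blast
qed

lemma singleton_simplex: "w \<in> vertices X \<Longrightarrow> {w} \<in> X"
  unfolding simplex_iff by simp

text \<open>The set in question is nonempty by \<open>common_lower_neighbour\<close>. It is a clique
  because all its members are lower neighbours of any one vertex of \<sigma>, so (V) at that vertex
  suffices.\<close>

lemma VE_weakly_systolic: assumes VE shows "weakly_systolic X"
  unfolding weakly_systolic_def SD_def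
proof (intro ballI allI impI)
  fix v n i \<sigma> assume v: "v \<in> vertices X" and \<sigma>: "\<sigma> \<in> X" "\<sigma> \<subseteq> complex_sphere X (i + 1) v"
  have lev: "\<forall>x\<in>\<sigma>. x \<in> vertices X \<and> d v x = Suc i" using \<sigma>(2) by (auto simp: gsphere_def)
  obtain z where z: "d v z = i" "\<forall>x\<in>\<sigma>. (z, x) \<in> edges X"
    using common_lower_neighbour[OF assms v simplex_finite[OF \<sigma>(1)] simplexD(1)[OF \<sigma>(1)] _ lev]
      simplexD(3)[OF \<sigma>(1)] by blast
  obtain w where w: "w \<in> \<sigma>" using simplexD(1)[OF \<sigma>(1)] by blast
  have zV: "z \<in> vertices X" using z(2) w adj_V by blast
  have VC: "Vcond v" using assms v by (simp add: VE_def)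
  let ?A = "vertices (link \<sigma> X) \<inter> complex_ball X i v"
  have mem: "u \<in> ?A \<longleftrightarrow> (\<forall>x\<in>\<sigma>. (u, x) \<in> edges X) \<and> u \<in> vertices X \<and> d v u \<le> i" for u
    using mem_link_adj[OF \<sigma>(1)] by (auto simp: gball_def)
  show "?A \<in> X"
    unfolding simplex_iff
  proof (intro conjI ballI impI)
    have "z \<in> ?A" unfolding mem using z zV by simp
    then show "?A \<noteq> {}" by blast
    show "?A \<subseteq> vertices X" using mem by blast
    fix x y assume "x \<in> ?A" "y \<in> ?A" "x \<noteq> y"
    then show "(x, y) \<in> edges X"
      unfolding mem using VcondD[OF VC, of x w y] w lev by fastforce
  qed
qed

lemma weakly_systolic_conditions:
  assumes "weakly_systolic X" "v \<in> vertices X"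
  shows "vertex_condition X v i" "edge_condition X v i"
proof -
  have SD: "vertices (link \<sigma> X) \<inter> complex_ball X i v \<in> X"
    if "\<sigma> \<in> X" "\<sigma> \<subseteq> complex_sphere X (i + 1) v" for \<sigma>
    using assms that unfolding weakly_systolic_def SD_def by blast
  show "vertex_condition X v i"
    unfolding vertex_condition_def
  proof
    fix w assume w: "w \<in> complex_sphere X (i + 1) v"
    then have "w \<in> vertices X" by (simp add: gsphere_def)
    then show "vertices (link {w} X) \<inter> complex_ball X i v \<in> X" using SD singleton_simplex w by simp
  qed
  show "edge_condition X v i"
    unfolding edge_condition_def
  proof (intro ballI impI)
    fix x y assume h: "x \<in> complex_sphere X (i + 1) v" "y \<in> complex_sphere X (i + 1) v" "(x, y) \<in> edges X"
    then have "{x, y} \<in> X" by (simp add: edges_def)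
    then have "vertices (link {x, y} X) \<inter> complex_ball X i v \<in> X" using SD h by simp
    then show "vertices (link {x, y} X) \<inter> complex_ball X i v \<noteq> {}" by (rule simplexD(1))
  qed
qed

lemma conditions_VE:
  assumes "\<forall>v\<in>vertices X. \<forall>i. vertex_condition X v i \<and> edge_condition X v i" shows VE
  unfolding VE_def
proof (intro ballI conjI)
  fix v assume v: "v \<in> vertices X"
  show "Vcond v"
    unfolding Vcond_def
  proof (intro allI impI)
    fix w x y assume h: "(x, w) \<in> edges X" "(y, w) \<in> edges X" "d v x < d v w" "d v y < d v w" "x \<noteq> y"
    have V: "x \<in> vertices X" "y \<in> vertices X" "w \<in> vertices X" using h adj_V by blast+
    obtain i where i: "d v w = Suc i" using h(3) by (cases "d v w") auto
    have "vertices (link {w} X) \<inter> complex_ball X i v \<in> X"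
      using assms v V(3) i unfolding vertex_condition_def by (simp add: gsphere_def)
    moreover have "x \<in> vertices (link {w} X) \<inter> complex_ball X i v" "y \<in> vertices (link {w} X) \<inter> complex_ball X i v"
      using mem_link_adj[OF singleton_simplex[OF V(3)]] h V i by (auto simp: gball_def)
    ultimately show "(x, y) \<in> edges X" using simplexD(3) h(5) by blast
  qed
  show "Econd v"
    unfolding Econd_def
  proof (intro allI impI)
    fix x y assume h: "(x, y) \<in> edges X" "d v x = d v y" "0 < d v x"
    have V: "x \<in> vertices X" "y \<in> vertices X" using h adj_V by blast+
    obtain i where i: "d v x = Suc i" using h(3) gr0_conv_Suc by blast
    have "vertices (link {x, y} X) \<inter> complex_ball X i v \<noteq> {}"
      using assms v V h i unfolding edge_condition_def by (simp add: gsphere_def)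
    then obtain z where z: "z \<in> vertices (link {x, y} X)" "d v z \<le> i" by (auto simp: gball_def)
    have "{x, y} \<in> X" using h(1) by (simp add: edges_def)
    then have zxy: "(z, x) \<in> edges X" "(z, y) \<in> edges X" using mem_link_adj z(1) by auto
    moreover have "Suc (d v z) = d v x" using dist_step[OF v zxy(1)] z(2) i by simp
    ultimately show "\<exists>z. (z, x) \<in> edges X \<and> (z, y) \<in> edges X \<and> Suc (d v z) = d v x" by blast
  qed
qed

lemma VE_iff:
  shows "VE \<longleftrightarrow> weakly_systolic X"
    and "VE \<longleftrightarrow> (\<forall>v\<in>vertices X. \<forall>i. vertex_condition X v i \<and> edge_condition X v i)"
    and "VE \<longleftrightarrow> weakly_modular (vertices X) (edges X) \<and> thin_graph (vertices X) (edges X)"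
    and "VE \<longleftrightarrow> weakly_modular (vertices X) (edges X) \<and> C4_free (vertices X) (edges X)"
    and "VE \<longleftrightarrow> weakly_modular (vertices X) (edges X) \<and> convex_balls (vertices X) (edges X)"
    and "VE \<longleftrightarrow> convex_balls (vertices X) (edges X) \<and> C5s_in_W5s (vertices X) (edges X)"
    and "VE \<longleftrightarrow> simply_connected_space (realization X) \<and> W5_hat_condition (vertices X) (edges X) \<and>
      C4_free (vertices X) (edges X)"
proof -
  show "VE \<longleftrightarrow> weakly_systolic X"
    using VE_weakly_systolic weakly_systolic_conditions conditions_VE by blast
  show "VE \<longleftrightarrow> (\<forall>v\<in>vertices X. \<forall>i. vertex_condition X v i \<and> edge_condition X v i)"
    using VE_weakly_systolic weakly_systolic_conditions conditions_VE by blast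
  show "VE \<longleftrightarrow> weakly_modular (vertices X) (edges X) \<and> thin_graph (vertices X) (edges X)"
    using VE_weakly_modular VE_thin thin_C4_free weakly_modular_C4_free_VE by blast
  show "VE \<longleftrightarrow> weakly_modular (vertices X) (edges X) \<and> C4_free (vertices X) (edges X)"
    using VE_weakly_modular VE_C4_free weakly_modular_C4_free_VE by blast
  show "VE \<longleftrightarrow> weakly_modular (vertices X) (edges X) \<and> convex_balls (vertices X) (edges X)"
    using VE_weakly_modular VE_convex_balls convex_balls_C4_free weakly_modular_C4_free_VE by blast
  show "VE \<longleftrightarrow> convex_balls (vertices X) (edges X) \<and> C5s_in_W5s (vertices X) (edges X)"
    using VE_convex_balls VE_C5s_in_W5s convex_balls_C5s_VE by blast
  show "VE \<longleftrightarrow> simply_connected_space (realization X) \<and> W5_hat_condition (vertices X) (edges X) \<and>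
      C4_free (vertices X) (edges X)"
    using VE_simply_connected VE_W5_hat VE_C4_free simply_connected_VE by blast
qed

end

theorem theorem3p1:
  fixes X :: "'a set set"
  assumes "abstract_simplicial_complex X"
    and "flag X"
    and "connected_graph (vertices X) (edges X)"
  shows "(weakly_systolic X \<longleftrightarrow>
            (\<forall>v\<in>vertices X. \<forall>i. vertex_condition X v i \<and> edge_condition X v i)) \<and>
         (weakly_systolic X \<longleftrightarrow>
            weakly_modular (vertices X) (edges X) \<and> thin_graph (vertices X) (edges X)) \<and>
         (weakly_systolic X \<longleftrightarrow>
            weakly_modular (vertices X) (edges X) \<and> C4_free (vertices X) (edges X)) \<and>
         (weakly_systolic X \<longleftrightarrow>
            weakly_modular (vertices X) (edges X) \<and> convex_balls (vertices X) (edges X)) \<and>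
         (weakly_systolic X \<longleftrightarrow>
            convex_balls (vertices X) (edges X) \<and> C5s_in_W5s (vertices X) (edges X)) \<and>
         (weakly_systolic X \<longleftrightarrow>
            simply_connected_space (realization X) \<and>
            W5_hat_condition (vertices X) (edges X) \<and>
            C4_free (vertices X) (edges X))"
proof -
  interpret flag_complex X by unfold_locales (use assms in auto)
  show ?thesis by (intro conjI) (simp only: VE_iff(1)[symmetric], rule VE_iff)+
qed

end
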